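(* Let $k$ be a field of characteristic zero. For $G=S_3,S_4$ and each of their nontrivial conjugacy classes $\mathcal{C}$, the flat connections $\alpha=\phi-\theta$ with constant coefficients and $\phi\neq0$ are exactly given by the following $\phi$, each up to an overall nonzero scale, organised by cardinality (strata $F_n$ not listed, $n\ge1$, are empty). Here the symbols $\lambda,\mu,\nu$ denote arbitrary independent nonzero elements of $k$, and $\theta_i$ denotes the sum of the $e_{(ij)}$, $j\ne i$. $S_3$, class of $(12)$: $F_3=\{\theta\}$; $F_1=\{e_{23},e_{13},e_{12}\}$. $S_3$, class of $(123)$: $F_2=\{\lambda e_{123}+\mu e_{132}\}$; $F_1=\{e_{123},e_{132}\}$. $S_4$, class of $(12)$: $F_6=\{\theta\}$; $F_3=\{\theta-\theta_i\mid i=1,\dots,4\}$; $F_2=\{\lambda e_{14}+\mu e_{23},\ \lambda e_{13}+\mu e_{24},\ \lambda e_{12}+\mu e_{34}\}$; $F_1=\{e_a\mid a\in\mathcal{C}\}$. $S_4$, class of $(12)(34)$: $F_3=\{\lambda e_{12,34}+\mu e_{13,24}+\nu e_{14,23}\}$; $F_2=\{\lambda e_{12,34}+\mu e_{13,24},\ \lambda e_{13,24}+\mu e_{14,23},\ \lambda e_{12,34}+\mu e_{14,23}\}$; $F_1=\{e_a\mid a\in\mathcal{C}\}$. $S_4$, class of $(123)$: $F_8=\{\lambda(e_{123}+e_{142}+e_{134}+e_{243})+\mu(e_{132}+e_{124}+e_{143}+e_{234})\}$; $F_4=\{e_{123}+e_{142}+e_{134}+e_{243},\ e_{132}+e_{124}+e_{143}+e_{234}\}$;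 $F_2=\{\lambda e_{123}+\mu e_{132},\ \lambda e_{142}+\mu e_{124},\ \lambda e_{134}+\mu e_{143},\ \lambda e_{243}+\mu e_{234}\}$; $F_1=\{e_a\mid a\in\mathcal{C}\}$. $S_4$, class of $(1234)$: $F_6=\{\theta\}$; $F_2=\{\lambda e_{1234}+\mu e_{1432},\ \lambda e_{1243}+\mu e_{1342},\ \lambda e_{1324}+\mu e_{1423}\}$; $F_1=\{e_a\mid a\in\mathcal{C}\}$. Moreover the associated representations $V_n$ are the following irreducible ones. For $S_3$: class $(12)$, $V_1\cong$ fund (2-dimensional); class $(123)$, $V_1\cong$ sign. For $S_4$: class $(12)$, $V_3\cong$ fund and $V_2\cong \mathbf{2}$; class $(12)(34)$, $V_2\cong\mathbf{2}$; class $(123)$, $V_4\cong$ sign and $V_2\cong$ fund; class $(1234)$, $V_2\cong\mathbf{2}$. Here fund of $S_N$ is the standard $(N-1)$-dimensional irreducible representation (the permutation representation on $k^N$ modulo the trivial one) and $\mathbf{2}$ is the 2-dimensional irreducible representation of $S_4$.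
   Context: For a finite group $G$ and nontrivial conjugacy class $\mathcal{C}$, let $\Lambda^1=k\mathcal{C}$ with basis $\{e_a\}_{a\in\mathcal{C}}$, $\Psi(e_a\otimes e_b)=e_{aba^{-1}}\otimes e_a$, $\Lambda_{quad}=T\Lambda^1/\langle\ker(\mathrm{id}-\Psi)\rangle$, and $\theta=\sum_{a\in\mathcal{C}}e_a$. On $\Lambda_{quad}$ the differential satisfies $\mathrm{d}e_a=\theta e_a+e_a\theta$. A connection with constant coefficients is $\alpha\in\Lambda^1$; its curvature is $F(\alpha)=\mathrm{d}\alpha+\alpha^2$ and it is flat if $F(\alpha)=0$. Writing $\phi=\alpha+\theta=\sum_a\phi^ae_a$ one has $F(\alpha)=\phi^2$, so flatness means $\phi^2=0$ in $\Lambda_{quad}$. The cardinality of $\alpha$ is the number of $a\in\mathcal{C}$ with $\phi^a\neq0$; $F_n$ denotes the stratum of flat connections (represented by $\phi$) of cardinality $n$. $G$ acts on $\Lambda^1$ by $g\cdot e_a=e_{gag^{-1}}$. The representation associated to $F_n$ is $V_n=kF_n/k\theta$, where $kF_n\subset\Lambda^1$ is the span of the elements $\phi$ of the stratum $F_n$ with coefficients in $\{0,1\}$. Brackets on cycle labels are omitted: $e_{12}=e_{(12)}$, $e_{123}=e_{(123)}$, $e_{12,34}=e_{(12)(34)}$, etc. *)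

theory Defs
  imports "HOL-Algebra.Algebra" "HOL-Algebra.Algebraic_Closure_Type" "HOL-Library.Poly_Mapping"
begin

section \<open>The tensor algebra and the quadratic exterior algebra\<close>

text \<open>
  Lists form a monoid under concatenation, so \<^typ>\<open>'g list \<Rightarrow>\<^sub>0 'k\<close> with its convolution product
  from \<^theory>\<open>HOL-Library.Poly_Mapping\<close> is the free (tensor) algebra on the basis \<^typ>\<open>'g\<close>;
  the word \<open>[a, b]\<close> stands for \<open>e\<^sub>a \<otimes> e\<^sub>b\<close>.
\<close>

instantiation list :: (type) monoid_add
begin

definition zero_list :: "'a list" where "zero_list = []"

definition plus_list :: "'a list \<Rightarrow> 'a list \<Rightarrow> 'a list" where "plus_list = (@)"

instance by standard (simp_all add: zero_list_def plus_list_def)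

end

definition scale :: "'k::field_char_0 \<Rightarrow> ('x \<Rightarrow>\<^sub>0 'k) \<Rightarrow> ('x \<Rightarrow>\<^sub>0 'k)"  (infixr \<open>*\<^sub>k\<close> 75)
  where "c *\<^sub>k t = Poly_Mapping.map ((*) c) t"

abbreviation lin_span :: "('x \<Rightarrow>\<^sub>0 'k::field_char_0) set \<Rightarrow> ('x \<Rightarrow>\<^sub>0 'k) set"
  where "lin_span \<equiv> Modules.module.span scale"

definition lin_ext :: "('x \<Rightarrow> ('y \<Rightarrow>\<^sub>0 'k)) \<Rightarrow> ('x \<Rightarrow>\<^sub>0 'k::field_char_0) \<Rightarrow> ('y \<Rightarrow>\<^sub>0 'k)"
  where "lin_ext f t = (\<Sum>x\<in>Poly_Mapping.keys t. Poly_Mapping.lookup t x *\<^sub>k f x)"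

definition conj_by :: "('g, 'm) monoid_scheme \<Rightarrow> 'g \<Rightarrow> 'g \<Rightarrow> 'g"
  where "conj_by G g a = g \<otimes>\<^bsub>G\<^esub> a \<otimes>\<^bsub>G\<^esub> inv\<^bsub>G\<^esub> g"

definition conj_class :: "('g, 'm) monoid_scheme \<Rightarrow> 'g \<Rightarrow> 'g set"
  where "conj_class G a = {conj_by G g a | g. g \<in> carrier G}"

definition nontrivial_conj_classes :: "('g, 'm) monoid_scheme \<Rightarrow> 'g set set"
  where "nontrivial_conj_classes G = {conj_class G a | a. a \<in> carrier G} - {{\<one>\<^bsub>G\<^esub>}}"

definition tensor_algebra :: "'g set \<Rightarrow> ('g list \<Rightarrow>\<^sub>0 'k::field_char_0) ring"
  where "tensor_algebra C =
    \<lparr>carrier = {t. Poly_Mapping.keys t \<subseteq> lists C}, monoid.mult = (*), one = 1, ring.zero = 0, add = (+)\<rparr>"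

text \<open>The component of tensor degree \<open>n\<close>; \<open>\<Lambda>\<^sup>1\<close> is identified with the component of degree 1.\<close>

definition tensor_deg :: "'g set \<Rightarrow> nat \<Rightarrow> ('g list \<Rightarrow>\<^sub>0 'k::field_char_0) set"
  where "tensor_deg C n = {t. Poly_Mapping.keys t \<subseteq> {w \<in> lists C. length w = n}}"

abbreviation one_forms :: "'g set \<Rightarrow> ('g list \<Rightarrow>\<^sub>0 'k::field_char_0) set"
  where "one_forms C \<equiv> tensor_deg C 1"

definition basis_form :: "'g \<Rightarrow> ('g list \<Rightarrow>\<^sub>0 'k::field_char_0)"
  where "basis_form a = Poly_Mapping.single [a] 1"

definition coeff_form :: "('g list \<Rightarrow>\<^sub>0 'k::field_char_0) \<Rightarrow> 'g \<Rightarrow> 'k"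
  where "coeff_form \<phi> a = Poly_Mapping.lookup \<phi> [a]"

definition theta :: "'g set \<Rightarrow> ('g list \<Rightarrow>\<^sub>0 'k::field_char_0)"
  where "theta C = (\<Sum>a\<in>C. basis_form a)"

text \<open>\<open>\<Psi>(e\<^sub>a \<otimes> e\<^sub>b) = e\<^bsub>aba\<^sup>-\<^sup>1\<^esub> \<otimes> e\<^sub>a\<close>; only its values on tensor degree 2 matter.\<close>

definition braiding ::
    "('g, 'm) monoid_scheme \<Rightarrow> ('g list \<Rightarrow>\<^sub>0 'k::field_char_0) \<Rightarrow> ('g list \<Rightarrow>\<^sub>0 'k)"
  where "braiding G = lin_ext (\<lambda>w. basis_form (conj_by G (w ! 0) (w ! 1)) * basis_form (w ! 0))"

definition quad_relations ::
    "('g, 'm) monoid_scheme \<Rightarrow> 'g set \<Rightarrow> ('g list \<Rightarrow>\<^sub>0 'k::field_char_0) set"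
  where "quad_relations G C = {t \<in> tensor_deg C 2. t - braiding G t = 0}"

definition quad_ideal ::
    "('g, 'm) monoid_scheme \<Rightarrow> 'g set \<Rightarrow> ('g list \<Rightarrow>\<^sub>0 'k::field_char_0) set"
  where "quad_ideal G C = genideal (tensor_algebra C) (quad_relations G C)"

definition quad_algebra ::
    "('g, 'm) monoid_scheme \<Rightarrow> 'g set \<Rightarrow> ('g list \<Rightarrow>\<^sub>0 'k::field_char_0) set ring"
  where "quad_algebra G C = tensor_algebra C Quot quad_ideal G C"

definition quad_class ::
    "('g, 'm) monoid_scheme \<Rightarrow> 'g set \<Rightarrow> ('g list \<Rightarrow>\<^sub>0 'k::field_char_0) \<Rightarrow> ('g list \<Rightarrow>\<^sub>0 'k) set"
  where "quad_class G C t = quad_ideal G C +>\<^bsub>tensor_algebra C\<^esub> t"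

section \<open>Flat connections with constant coefficients\<close>

text \<open>The differential on \<open>\<Lambda>\<^sup>1\<close>, determined by linearity and \<open>d e\<^sub>a = \<theta> e\<^sub>a + e\<^sub>a \<theta>\<close>.\<close>

definition diff_form ::
    "('g, 'm) monoid_scheme \<Rightarrow> 'g set \<Rightarrow> ('g list \<Rightarrow>\<^sub>0 'k::field_char_0) \<Rightarrow> ('g list \<Rightarrow>\<^sub>0 'k) set"
  where "diff_form G C \<alpha> = quad_class G C
    (\<Sum>a\<in>C. coeff_form \<alpha> a *\<^sub>k (theta C * basis_form a + basis_form a * theta C))"

definition curvature ::
    "('g, 'm) monoid_scheme \<Rightarrow> 'g set \<Rightarrow> ('g list \<Rightarrow>\<^sub>0 'k::field_char_0) \<Rightarrow> ('g list \<Rightarrow>\<^sub>0 'k) set"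
  where "curvature G C \<alpha> = diff_form G C \<alpha>
    \<oplus>\<^bsub>quad_algebra G C\<^esub> (quad_class G C \<alpha> \<otimes>\<^bsub>quad_algebra G C\<^esub> quad_class G C \<alpha>)"

definition flat ::
    "('g, 'm) monoid_scheme \<Rightarrow> 'g set \<Rightarrow> ('g list \<Rightarrow>\<^sub>0 'k::field_char_0) \<Rightarrow> bool"
  where "flat G C \<alpha> \<longleftrightarrow> curvature G C \<alpha> = \<zero>\<^bsub>quad_algebra G C\<^esub>"

definition cardinality :: "'g set \<Rightarrow> ('g list \<Rightarrow>\<^sub>0 'k::field_char_0) \<Rightarrow> nat"
  where "cardinality C \<alpha> = card {a \<in> C. coeff_form (\<alpha> + theta C) a \<noteq> 0}"

text \<open>The elements of a stratum are the \<open>\<phi> = \<alpha> + \<theta>\<close>, not the connections \<open>\<alpha>\<close> themselves.\<close>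

definition flat_stratum ::
    "('g, 'm) monoid_scheme \<Rightarrow> 'g set \<Rightarrow> nat \<Rightarrow> ('g list \<Rightarrow>\<^sub>0 'k::field_char_0) set"
  where "flat_stratum G C n =
    {\<alpha> + theta C | \<alpha>. \<alpha> \<in> one_forms C \<and> flat G C \<alpha> \<and> cardinality C \<alpha> = n}"

definition up_to_scale :: "('x \<Rightarrow>\<^sub>0 'k::field_char_0) set \<Rightarrow> ('x \<Rightarrow>\<^sub>0 'k) set"
  where "up_to_scale S = {c *\<^sub>k \<phi> | c \<phi>. c \<noteq> 0 \<and> \<phi> \<in> S}"

section \<open>Representations\<close>

text \<open>
  Vector spaces over \<open>'k\<close> are modules over \<^const>\<open>ring_of_type_algebra\<close>. A module record
  also carries the fields \<open>mult\<close> and \<open>one\<close>, which the locale \<^locale>\<open>Module.module\<close>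
  ignores; they are left undefined.
\<close>

record ('g, 'k, 'v) rep = "('k, 'v) module" +
  act :: "'g \<Rightarrow> 'v \<Rightarrow> 'v"

definition is_rep :: "('g, 'm) monoid_scheme \<Rightarrow> ('g, 'k::field_char_0, 'v) rep \<Rightarrow> bool"
  where "is_rep G V \<longleftrightarrow> group G \<and> Module.module (ring_of_type_algebra :: 'k ring) V \<and>
    (\<forall>g\<in>carrier G. \<forall>x\<in>carrier V. act V g x \<in> carrier V) \<and>
    (\<forall>g\<in>carrier G. \<forall>x\<in>carrier V. \<forall>y\<in>carrier V.
      act V g (x \<oplus>\<^bsub>V\<^esub> y) = act V g x \<oplus>\<^bsub>V\<^esub> act V g y) \<and>
    (\<forall>g\<in>carrier G. \<forall>c. \<forall>x\<in>carrier V. act V g (c \<odot>\<^bsub>V\<^esub> x) = c \<odot>\<^bsub>V\<^esub> act V g x) \<and>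
    (\<forall>x\<in>carrier V. act V \<one>\<^bsub>G\<^esub> x = x) \<and>
    (\<forall>g\<in>carrier G. \<forall>h\<in>carrier G. \<forall>x\<in>carrier V.
      act V (g \<otimes>\<^bsub>G\<^esub> h) x = act V g (act V h x))"

definition irreducible_rep :: "('g, 'm) monoid_scheme \<Rightarrow> ('g, 'k::field_char_0, 'v) rep \<Rightarrow> bool"
  where "irreducible_rep G V \<longleftrightarrow> is_rep G V \<and> carrier V \<noteq> {\<zero>\<^bsub>V\<^esub>} \<and>
    (\<forall>H. submodule H (ring_of_type_algebra :: 'k ring) V \<and>
         (\<forall>g\<in>carrier G. \<forall>x\<in>H. act V g x \<in> H)
       \<longrightarrow> H = {\<zero>\<^bsub>V\<^esub>} \<or> H = carrier V)"

definition rep_iso :: "('g, 'm) monoid_scheme \<Rightarrow>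
    ('g, 'k::field_char_0, 'v) rep \<Rightarrow> ('g, 'k, 'w) rep \<Rightarrow> bool"
  where "rep_iso G V W \<longleftrightarrow> is_rep G V \<and> is_rep G W \<and>
    (\<exists>f. bij_betw f (carrier V) (carrier W) \<and>
      (\<forall>x\<in>carrier V. \<forall>y\<in>carrier V. f (x \<oplus>\<^bsub>V\<^esub> y) = f x \<oplus>\<^bsub>W\<^esub> f y) \<and>
      (\<forall>c. \<forall>x\<in>carrier V. f (c \<odot>\<^bsub>V\<^esub> x) = c \<odot>\<^bsub>W\<^esub> f x) \<and>
      (\<forall>g\<in>carrier G. \<forall>x\<in>carrier V. f (act V g x) = act W g (f x)))"

definition has_dim :: "('g, 'k::field_char_0, 'v) rep \<Rightarrow> nat \<Rightarrow> bool"
  where "has_dim V n \<longleftrightarrow> (\<exists>B. finite B \<and> card B = n \<and> B \<subseteq> carrier V \<and>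
    (\<forall>x\<in>carrier V. \<exists>!c. c \<in> B \<rightarrow>\<^sub>E UNIV \<and> x = (\<Oplus>\<^bsub>V\<^esub>b\<in>B. c b \<odot>\<^bsub>V\<^esub> b)))"

text \<open>
  The quotient by a subspace \<open>W\<close>, with cosets \<open>W + x\<close> as elements. Scaling is not elementwise:
  \<open>0\<close> times a coset has to be \<open>W\<close>, not \<open>{0}\<close>. If \<open>W\<close> is not contained in \<open>V\<close>, the result is
  \<open>(V + W)/W\<close>.
\<close>

definition quot_rep :: "('g, 'k::field_char_0, 'v) rep \<Rightarrow> 'v set \<Rightarrow> ('g, 'k, 'v set) rep"
  where "quot_rep V W =
    \<lparr>carrier = a_rcosets\<^bsub>V\<^esub> W, monoid.mult = undefined, one = undefined,
     ring.zero = W, add = set_add V,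
     module.smult = (\<lambda>c S. \<Union>x\<in>S. W +>\<^bsub>V\<^esub> (c \<odot>\<^bsub>V\<^esub> x)),
     act = (\<lambda>g S. \<Union>x\<in>S. W +>\<^bsub>V\<^esub> act V g x)\<rparr>"

text \<open>The space with basis \<open>B\<close>, where the group permutes the basis through \<open>\<sigma>\<close>.\<close>

definition perm_rep :: "'x set \<Rightarrow> ('g \<Rightarrow> 'x \<Rightarrow> 'x) \<Rightarrow> ('g, 'k::field_char_0, 'x \<Rightarrow>\<^sub>0 'k) rep"
  where "perm_rep B \<sigma> =
    \<lparr>carrier = {v. Poly_Mapping.keys v \<subseteq> B}, monoid.mult = undefined, one = undefined,
     ring.zero = 0, add = (+), module.smult = scale,
     act = (\<lambda>g. lin_ext (\<lambda>x. Poly_Mapping.single (\<sigma> g x) 1))\<rparr>"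

definition reduced_perm_rep ::
    "'x set \<Rightarrow> ('g \<Rightarrow> 'x \<Rightarrow> 'x) \<Rightarrow> ('g, 'k::field_char_0, ('x \<Rightarrow>\<^sub>0 'k) set) rep"
  where "reduced_perm_rep B \<sigma> =
    quot_rep (perm_rep B \<sigma>) (lin_span {\<Sum>x\<in>B. Poly_Mapping.single x 1})"

definition fund_rep :: "nat \<Rightarrow> (nat \<Rightarrow> nat, 'k::field_char_0, (nat \<Rightarrow>\<^sub>0 'k) set) rep"
  where "fund_rep N = reduced_perm_rep {1..N} (\<lambda>p. p)"

definition sign_rep :: "(nat \<Rightarrow> nat, 'k::field_char_0, 'k) rep"
  where "sign_rep =
    \<lparr>carrier = UNIV, monoid.mult = undefined, one = undefined, ring.zero = 0, add = (+), module.smult = (*),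
     act = (\<lambda>p x. of_int (sign p) * x)\<rparr>"

text \<open>
  The 2-dimensional irreducible representation of \<open>S\<^sub>4\<close>: the pullback of the standard representation
  of \<open>S\<^sub>3\<close> along the surjection \<open>S\<^sub>4 \<rightarrow> S\<^sub>3\<close> given by permuting the three partitions of \<open>{1,2,3,4}\<close>
  into pairs.
\<close>

definition two_rep :: "(nat \<Rightarrow> nat, 'k::field_char_0, (nat set set \<Rightarrow>\<^sub>0 'k) set) rep"
  where "two_rep = reduced_perm_rep
    {{{1, 2}, {3, 4}}, {{1, 3}, {2, 4}}, {{1, 4}, {2, 3}}} (\<lambda>p. image (image p))"

text \<open>\<open>g \<cdot> e\<^sub>a = e\<^bsub>gag\<^sup>-\<^sup>1\<^esub>\<close>, with \<open>e\<^sub>a\<close> encoded by the word \<open>[a]\<close>.\<close>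

definition one_forms_rep ::
    "('g, 'm) monoid_scheme \<Rightarrow> 'g set \<Rightarrow> ('g, 'k::field_char_0, 'g list \<Rightarrow>\<^sub>0 'k) rep"
  where "one_forms_rep G C = perm_rep {[a] | a. a \<in> C} (\<lambda>g. map (conj_by G g))"

definition stratum_span ::
    "('g, 'm) monoid_scheme \<Rightarrow> 'g set \<Rightarrow> nat \<Rightarrow> ('g list \<Rightarrow>\<^sub>0 'k::field_char_0) set"
  where "stratum_span G C n =
    lin_span {\<phi> \<in> flat_stratum G C n. \<forall>a\<in>C. coeff_form \<phi> a \<in> {0, 1}}"

definition stratum_rep :: "('g, 'm) monoid_scheme \<Rightarrow> 'g set \<Rightarrow> nat \<Rightarrow>
    ('g, 'k::field_char_0, ('g list \<Rightarrow>\<^sub>0 'k) set) rep"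
  where "stratum_rep G C n =
    quot_rep ((one_forms_rep G C)\<lparr>carrier := stratum_span G C n\<rparr>) (lin_span {theta C})"

section \<open>Notation for permutations of small sets\<close>

text \<open>
  \<open>\<ee>[1,2,3]\<close> is \<open>e\<^bsub>(123)\<^esub>\<close>, where \<open>(123)\<close> sends 1 to 2, 2 to 3 and 3 to 1;
  \<open>\<ee>\<ee> [1,2] [3,4]\<close> is \<open>e\<^bsub>(12)(34)\<^esub>\<close>.
\<close>

abbreviation cyc_form :: "nat list \<Rightarrow> ((nat \<Rightarrow> nat) list \<Rightarrow>\<^sub>0 'k::field_char_0)"  (\<open>\<ee>\<close>)
  where "\<ee> c \<equiv> basis_form (cycle_of_list c)"

abbreviation cyc_form2 ::
    "nat list \<Rightarrow> nat list \<Rightarrow> ((nat \<Rightarrow> nat) list \<Rightarrow>\<^sub>0 'k::field_char_0)"  (\<open>\<ee>\<ee>\<close>)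
  where "\<ee>\<ee> c d \<equiv> basis_form (cycle_of_list c \<circ> cycle_of_list d)"

definition theta_at :: "nat \<Rightarrow> ((nat \<Rightarrow> nat) list \<Rightarrow>\<^sub>0 'k::field_char_0)"
  where "theta_at i = (\<Sum>j\<in>{1..4} - {i}. \<ee> [i, j])"

end

theory Submission
  imports Defs "HOL-Combinatorics.Multiset_Permutations"
begin

text \<open>
  In degree 2 the ideal of relations consists of the relations alone, so \<open>\<phi>\<^sup>2 = 0\<close> says that the
  tensor \<open>\<phi> \<otimes> \<phi>\<close> is fixed by \<open>\<Psi>\<close>: for all \<open>a\<close> with \<open>\<phi>\<^sup>a \<noteq> 0\<close> the coefficients of \<open>\<phi>\<close> are invariant
  under conjugation by \<open>a\<close>. Hence the support of \<open>\<phi>\<close> is closed under conjugation by its own elements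
  and \<open>\<phi>\<close> is constant on the orbits of this conjugation, which leaves finitely many possibilities
  (cells) for each class.

  The elements with coefficients in \<open>{0, 1}\<close> of a cell of a given size are permuted by the group
  in the same way as points, as pairings of \<open>{1, 2, 3, 4}\<close>, or as the two elements of a set on which
  odd permutations act by the swap; they are linearly independent and add up to a multiple of \<open>\<theta>\<close>.
  So each \<open>V\<^sub>n\<close> is the quotient of a permutation representation by the constants. Such a quotient is
  irreducible as soon as the group induces all transpositions of the basis.
\<close>

section \<open>Flatness as a condition on coefficients\<close>

text \<open>Two changes of description carry the proof. A permutation is a function on all of
  \<open>nat\<close>, which evaluation can neither compare nor enumerate, so the classes are
  rewritten as lists of one-line notations; supports, conjugation tables and incidence counts then
  become terms that \<open>code_simp\<close> decides, and only a condition on finitely many unknown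
  field elements remains. On the side of representations, cosets are awkward to compare, so a space
  is described only through a map \<open>Q\<close> on all functions on a finite
  \<open>G\<close>-set, whose fibres are the classes modulo constants. Two spaces described by the
  same \<open>G\<close>-set are then isomorphic without computation. Both sides meet in an
  equivariant incidence between class elements and points of the \<open>G\<close>-set: fixing a
  point, preserving a pairing, moving a block of a pairing, or lying in the half of the class that
  the point names. The support of a 0/1 form is the set of elements incident with one point.
  Characteristic 0 enters when dividing by the number of points or by the number of supports through
  an element, and when \<open>c = - c\<close> has to force \<open>c = 0\<close>.\<close>

lemma lookup_scale [simp]:
  "Poly_Mapping.lookup (c *\<^sub>k t) x = c * Poly_Mapping.lookup t x"
  by (simp add: scale_def map.rep_eq when_def)

interpretation poly_vs: vector_space scale
  by unfold_locales (auto intro!: poly_mapping_eqI simp: lookup_add algebra_simps)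

lemma lookup_lin_ext:
  "Poly_Mapping.lookup (lin_ext f t) y =
    (\<Sum>x\<in>Poly_Mapping.keys t. Poly_Mapping.lookup t x * Poly_Mapping.lookup (f x) y)"
  by (simp add: lin_ext_def lookup_sum)

lemma lin_ext_superset:
  assumes "finite A" "Poly_Mapping.keys t \<subseteq> A"
  shows "lin_ext f t = (\<Sum>x\<in>A. Poly_Mapping.lookup t x *\<^sub>k f x)"
  unfolding lin_ext_def using assms
  by (intro sum.mono_neutral_left) (auto simp: in_keys_iff)

lemma lin_ext_add: "lin_ext f (s + t) = lin_ext f s + lin_ext f t"
proof -
  let ?A = "Poly_Mapping.keys s \<union> Poly_Mapping.keys t"
  have "Poly_Mapping.keys (s + t) \<subseteq> ?A" by (rule keys_add)
  then show ?thesis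
    by (simp add: lin_ext_superset[of ?A] lookup_add poly_vs.scale_left_distrib sum.distrib)
qed

lemma lin_ext_scale: "lin_ext f (c *\<^sub>k t) = c *\<^sub>k lin_ext f t"
proof -
  have "Poly_Mapping.keys (c *\<^sub>k t) \<subseteq> Poly_Mapping.keys t" by (auto simp: in_keys_iff)
  then show ?thesis
    by (simp add: lin_ext_superset[of "Poly_Mapping.keys t"] poly_vs.scale_sum_right)
qed

lemma lin_ext_single [simp]: "lin_ext f (Poly_Mapping.single x c) = c *\<^sub>k f x"
  by (simp add: lin_ext_superset[of "{x}"])

lemma lin_ext_zero [simp]: "lin_ext f 0 = 0"
  by (simp add: lin_ext_def)

lemma lin_ext_sum: "lin_ext f (sum g A) = (\<Sum>x\<in>A. lin_ext f (g x))"
  by (induction A rule: infinite_finite_induct) (auto simp: lin_ext_add)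

section \<open>Products and degrees in the free algebra\<close>

lemma basis_form_times: "basis_form a * basis_form b = Poly_Mapping.single [a, b] 1"
  by (simp add: basis_form_def mult_single plus_list_def)

text \<open>A word factors as \<open>l @ q\<close> exactly when \<open>l\<close> is one of its
  prefixes, and then \<open>q\<close> is the rest, so the convolution collapses to a finite sum over
  cut positions. Words of length 2 have only three cuts, which keeps all later coefficient
  computations small.\<close>

lemma lookup_list_mult:
  fixes s t :: "'a list \<Rightarrow>\<^sub>0 'k::field_char_0"
  shows "Poly_Mapping.lookup (s * t) w =
    (\<Sum>i\<le>length w. Poly_Mapping.lookup s (take i w) * Poly_Mapping.lookup t (drop i w))"
proof -
  let ?p = "\<lambda>i. take i w"
  have inner: "(\<Sum>q. Poly_Mapping.lookup t q when w = l + q) =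
      (if \<exists>i\<le>length w. l = ?p i then Poly_Mapping.lookup t (drop (length l) w) else 0)" for l
  proof (cases "\<exists>i\<le>length w. l = ?p i")
    case True
    then have "(\<lambda>q. Poly_Mapping.lookup t q when w = l + q) =
        (\<lambda>q. Poly_Mapping.lookup t q when drop (length l) w = q)"
      by (auto simp: plus_list_def append_eq_conv_conj fun_eq_iff when_def)
    with True show ?thesis by (simp only: Sum_any_when_equal' if_True)
  next
    case False
    then have "w \<noteq> l + q" for q
      by (metis append_eq_conv_conj length_append le_add1 plus_list_def)
    then show ?thesis using False by (simp only: if_False when_simps Sum_any.neutral)
  qed
  have inj: "inj_on ?p {..length w}"
    by (rule inj_on_inverseI[where g = length]) simp
  have "Poly_Mapping.lookup (s * t) w = (\<Sum>l. Poly_Mapping.lookup s l *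
     (if \<exists>i\<le>length w. l = ?p i then Poly_Mapping.lookup t (drop (length l) w) else 0))"
    by (simp only: lookup_mult inner)
  also have "\<dots> = (\<Sum>l\<in>?p ` {..length w}. Poly_Mapping.lookup s l *
     (if \<exists>i\<le>length w. l = ?p i then Poly_Mapping.lookup t (drop (length l) w) else 0))"
    by (rule Sum_any.expand_superset) auto
  also have "\<dots> = (\<Sum>l\<in>?p ` {..length w}. Poly_Mapping.lookup s l * Poly_Mapping.lookup t (drop
      (length l) w))"
    by (rule sum.cong) auto
  also have "\<dots> = (\<Sum>i\<le>length w. Poly_Mapping.lookup s (?p i) * Poly_Mapping.lookup t (drop i w))"
    by (simp add: sum.reindex[OF inj])
  finally show ?thesis .
qed

lemma ring_tensor_algebra: "ring (tensor_algebra C :: ('g list \<Rightarrow>\<^sub>0 'k::field_char_0) ring)"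
proof (intro ringI abelian_groupI monoidI)
  fix x y :: "'g list \<Rightarrow>\<^sub>0 'k"
  let ?R = "tensor_algebra C :: ('g list \<Rightarrow>\<^sub>0 'k) ring"
  show "\<one>\<^bsub>?R\<^esub> \<in> carrier ?R" "\<zero>\<^bsub>?R\<^esub> \<in> carrier ?R"
    by (auto simp: tensor_algebra_def zero_list_def)
  { assume xy: "x \<in> carrier ?R" "y \<in> carrier ?R"
    show "x \<oplus>\<^bsub>?R\<^esub> y \<in> carrier ?R"
      using xy keys_add[of x y] by (auto simp: tensor_algebra_def)
    show "x \<otimes>\<^bsub>?R\<^esub> y \<in> carrier ?R"
      using xy keys_mult[of x y] by (fastforce simp: tensor_algebra_def plus_list_def) }
  assume "x \<in> carrier ?R"
  then show "\<exists>y\<in>carrier ?R. y \<oplus>\<^bsub>?R\<^esub> x = \<zero>\<^bsub>?R\<^esub>"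
    by (intro bexI[of _ "-x"]) (auto simp: tensor_algebra_def in_keys_iff)
qed (auto simp: tensor_algebra_def algebra_simps)

lemma keys_one_form:
  assumes "\<phi> \<in> tensor_deg C n" "w \<in> Poly_Mapping.keys \<phi>" shows "w \<in> lists C" "length w = n"
  using assms by (auto simp: tensor_deg_def)

lemma coeff_theta: "finite C \<Longrightarrow> coeff_form (theta C) a = (if a \<in> C then 1 else 0)"
  by (simp add: coeff_form_def theta_def lookup_sum basis_form_def lookup_single when_def)

lemma one_form_eq_sum:
  assumes "finite C" "\<alpha> \<in> one_forms C"
  shows "\<alpha> = (\<Sum>a\<in>C. coeff_form \<alpha> a *\<^sub>k basis_form a)"
proof (rule poly_mapping_eqI)
  fix w
  have "Poly_Mapping.lookup (\<Sum>a\<in>C. coeff_form \<alpha> a *\<^sub>k basis_form a) w =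
      (\<Sum>a\<in>C. if w = [a] then Poly_Mapping.lookup \<alpha> [a] else 0)"
    by (auto simp: lookup_sum coeff_form_def basis_form_def lookup_single when_def intro!: sum.cong)
  also have "\<dots> = Poly_Mapping.lookup \<alpha> w"
  proof (cases "\<exists>a\<in>C. w = [a]")
    case True
    then show ?thesis using assms(1) by auto
  next
    case False
    then have "w \<notin> Poly_Mapping.keys \<alpha>"
      using keys_one_form[OF assms(2), of w] False by (fastforce simp: length_Suc_conv)
    then show ?thesis using False by (force simp: in_keys_iff intro!: sum.neutral)
  qed
  finally show "Poly_Mapping.lookup \<alpha> w = Poly_Mapping.lookup (\<Sum>a\<in>C.
      coeff_form \<alpha> a *\<^sub>k basis_form a) w" ..
qed

text \<open>The two outer cuts of \<open>[a, b]\<close> involve the constant term of a one-form,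
  which is 0; only the middle cut survives.\<close>

lemma lookup_one_forms_mult:
  assumes "\<phi> \<in> one_forms C" "\<psi> \<in> one_forms C"
  shows "Poly_Mapping.lookup (\<phi> * \<psi>) [a, b] = coeff_form \<phi> a * coeff_form \<psi> b"
    "\<phi> * \<psi> \<in> tensor_deg C 2"
proof -
  have "Poly_Mapping.lookup \<phi> [] = 0" "Poly_Mapping.lookup \<psi> [] = 0"
    using keys_one_form(2)[OF assms(1), of "[]"] keys_one_form(2)[OF assms(2), of "[]"]
    by (auto simp: in_keys_iff)
  then show "Poly_Mapping.lookup (\<phi> * \<psi>) [a, b] = coeff_form \<phi> a * coeff_form \<psi> b"
    by (simp add: lookup_list_mult coeff_form_def sum.atMost_Suc)
  show "\<phi> * \<psi> \<in> tensor_deg C 2"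
    using assms keys_mult[of \<phi> \<psi>] by (fastforce simp: tensor_deg_def plus_list_def)
qed

lemma theta_one_form: "(theta C :: 'g list \<Rightarrow>\<^sub>0 'k::field_char_0) \<in> one_forms C"
proof -
  have "Poly_Mapping.keys (theta C :: 'g list \<Rightarrow>\<^sub>0 'k) \<subseteq> (\<Union>a\<in>C.
      Poly_Mapping.keys (basis_form a :: 'g list \<Rightarrow>\<^sub>0 'k))"
    unfolding theta_def by (rule keys_sum)
  then show ?thesis by (auto simp: tensor_deg_def basis_form_def)
qed

lemma tensor_deg_add: "s \<in> tensor_deg C n \<Longrightarrow> t \<in> tensor_deg C n \<Longrightarrow> s + t \<in> tensor_deg C n"
  using keys_add[of s t] by (fastforce simp: tensor_deg_def)

lemma tensor_deg_diff: "s \<in> tensor_deg C n \<Longrightarrow> t \<in> tensor_deg C n \<Longrightarrow> s - t \<in> tensor_deg C n"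
  using keys_diff[of s t] by (fastforce simp: tensor_deg_def)

lemma tensor_deg_zero: "0 \<in> tensor_deg C n"
  by (simp add: tensor_deg_def)

lemma tensor_deg_scale: "t \<in> tensor_deg C n \<Longrightarrow> c *\<^sub>k t \<in> tensor_deg C n"
  by (fastforce simp: tensor_deg_def in_keys_iff subset_iff)

lemma tensor_deg_sum: "(\<And>i. i \<in> I \<Longrightarrow> h i \<in> tensor_deg C n) \<Longrightarrow> (\<Sum>i\<in>I. h i) \<in> tensor_deg C n"
  by (induction I rule: infinite_finite_induct) (auto intro: tensor_deg_add tensor_deg_zero)

lemma basis_form_one_form: "a \<in> C \<Longrightarrow> basis_form a \<in> one_forms C"
  by (simp add: tensor_deg_def basis_form_def)

section \<open>The braiding, the quadratic ideal and the criterion for flatness\<close>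

context
  fixes G :: "('g, 'm) monoid_scheme" and C :: "'g set"
  assumes grp: "group G" and CG: "C \<subseteq> carrier G"
    and closed: "\<And>a b. a \<in> C \<Longrightarrow> b \<in> C \<Longrightarrow> conj_by G a b \<in> C"
begin

interpretation group G by (rule grp)

interpretation T: ring "tensor_algebra C :: ('g list \<Rightarrow>\<^sub>0 'k::field_char_0) ring"
  by (rule ring_tensor_algebra)

lemma conj_by_inj: "a \<in> C \<Longrightarrow> b \<in> C \<Longrightarrow> c \<in> C \<Longrightarrow> conj_by G a b = conj_by G a c \<longleftrightarrow> b = c"
  using CG by (auto simp: conj_by_def subset_iff)

text \<open>An injective self-map of a finite set is onto. Hence every word \<open>[c, a]\<close>
  over \<open>C\<close> has the form \<open>[conj_by G a b, a]\<close>, so that comparing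
  coefficients at these words compares all of degree 2.\<close>

lemma conj_by_surj:
  assumes "finite C" "a \<in> C" "c \<in> C"
  obtains b where "b \<in> C" "conj_by G a b = c"
proof -
  have "conj_by G a ` C \<subseteq> C" using closed assms by auto
  moreover have "inj_on (conj_by G a) C" using conj_by_inj assms(2) by (auto intro: inj_onI)
  ultimately have "conj_by G a ` C = C" using assms(1) by (simp add: endo_inj_surj)
  then show thesis using assms(3) that by (metis imageE)
qed

text \<open>Among the words of length 2 over \<open>C\<close>, only \<open>[a, b]\<close> is sent to
  \<open>[conj_by G a b, a]\<close>, so the braiding merely transports coefficients.\<close>

lemma lookup_braiding:
  fixes t :: "'g list \<Rightarrow>\<^sub>0 'k::field_char_0"
  assumes t: "t \<in> tensor_deg C 2" and a: "a \<in> C" and b: "b \<in> C"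
  shows "Poly_Mapping.lookup (braiding G t) [conj_by G a b, a] = Poly_Mapping.lookup t [a, b]"
proof -
  have eq: "(conj_by G (w ! 0) (w ! 1) = conj_by G a b \<and> w ! 0 = a) \<longleftrightarrow> w = [a, b]"
    if w0: "w \<in> Poly_Mapping.keys t" for w
  proof -
    obtain c d where w: "w = [c, d]" "c \<in> C" "d \<in> C"
      using keys_one_form[OF t w0] by (auto simp: length_Suc_conv numeral_2_eq_2)
    then show ?thesis using conj_by_inj a b by auto
  qed
  have "Poly_Mapping.lookup (braiding G t) [conj_by G a b, a] =
      (\<Sum>w\<in>Poly_Mapping.keys t. Poly_Mapping.lookup t w * (if w = [a, b] then 1 else 0))"
    unfolding braiding_def lookup_lin_ext
    by (rule sum.cong) (use eq in \<open>auto simp: basis_form_times lookup_single when_def\<close>)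
  also have "\<dots> = (\<Sum>w\<in>Poly_Mapping.keys t. if w = [a, b] then Poly_Mapping.lookup t [a, b] else 0)"
    by (rule sum.cong) auto
  also have "\<dots> = Poly_Mapping.lookup t [a, b]"
    by (simp add: in_keys_iff)
  finally show ?thesis .
qed

lemma braiding_deg:
  fixes t :: "'g list \<Rightarrow>\<^sub>0 'k::field_char_0"
  assumes t: "t \<in> tensor_deg C 2"
  shows "braiding G t \<in> tensor_deg C 2"
proof -
  have "w \<in> {w \<in> lists C. length w = 2}" if "w \<in> Poly_Mapping.keys (braiding G t)" for w
  proof -
    have "Poly_Mapping.lookup (braiding G t) w \<noteq> 0" using that by (simp add: in_keys_iff)
    then obtain v where v: "v \<in> Poly_Mapping.keys t"
      "Poly_Mapping.lookup (basis_form (conj_by G (v ! 0) (v ! 1)) * basis_form (v ! 0) :: 'g list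
          \<Rightarrow>\<^sub>0 'k) w \<noteq> 0"
      unfolding braiding_def lookup_lin_ext by (auto elim!: sum.not_neutral_contains_not_neutral)
    then have "w = [conj_by G (v ! 0) (v ! 1), v ! 0]"
      by (auto simp: basis_form_times lookup_single when_def split: if_splits)
    moreover have "v ! 0 \<in> C" "v ! 1 \<in> C" using keys_one_form[OF t v(1)] by auto
    ultimately show ?thesis using closed by auto
  qed
  then show ?thesis by (auto simp: tensor_deg_def)
qed

lemma quad_relations_iff:
  fixes t :: "'g list \<Rightarrow>\<^sub>0 'k::field_char_0"
  assumes fin: "finite C" and t: "t \<in> tensor_deg C 2"
  shows "t \<in> quad_relations G C \<longleftrightarrow>
    (\<forall>a\<in>C. \<forall>b\<in>C. Poly_Mapping.lookup t [conj_by G a b, a] = Poly_Mapping.lookup t [a, b])"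
proof
  assume "t \<in> quad_relations G C"
  then have "t = braiding G t" by (simp add: quad_relations_def)
  with lookup_braiding[OF t]
  show "\<forall>a\<in>C. \<forall>b\<in>C. Poly_Mapping.lookup t [conj_by G a b, a] = Poly_Mapping.lookup t [a, b]"
    by metis
next
  assume *: "\<forall>a\<in>C. \<forall>b\<in>C. Poly_Mapping.lookup t [conj_by G a b, a] = Poly_Mapping.lookup t [a, b]"
  have "Poly_Mapping.lookup t w = Poly_Mapping.lookup (braiding G t) w" for w
  proof (cases "w \<in> lists C \<and> length w = 2")
    case True
    then obtain c a where w: "w = [c, a]" "c \<in> C" "a \<in> C"
        by (auto simp: length_Suc_conv numeral_2_eq_2)
    obtain b where "b \<in> C" "conj_by G a b = c" using conj_by_surj[OF fin w(3,2)] .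
    with w * lookup_braiding[OF t] show ?thesis by auto
  next
    case False
    then show ?thesis using keys_one_form[OF t, of w] keys_one_form[OF braiding_deg[OF t], of w]
      by (metis in_keys_iff)
  qed
  then have "t = braiding G t" by (rule poly_mapping_eqI)
  then show "t \<in> quad_relations G C" using t by (simp add: quad_relations_def)
qed

text \<open>The elements without constant and linear part whose quadratic part is a relation form an
  ideal, so that the ideal of relations contains no further elements of degree 2.\<close>

lemma quad_ideal_deg_2:
  fixes t :: "'g list \<Rightarrow>\<^sub>0 'k::field_char_0"
  assumes fin: "finite C" and t: "t \<in> tensor_deg C 2"
  shows "t \<in> quad_ideal G C \<longleftrightarrow>
    (\<forall>a\<in>C. \<forall>b\<in>C. Poly_Mapping.lookup t [conj_by G a b, a] = Poly_Mapping.lookup t [a, b])"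
proof -
  let ?R = "tensor_algebra C :: ('g list \<Rightarrow>\<^sub>0 'k) ring"
  define K :: "('g list \<Rightarrow>\<^sub>0 'k) set" where "K = {t \<in> carrier ?R.
    (\<forall>w. length w < 2 \<longrightarrow> Poly_Mapping.lookup t w = 0) \<and>
    (\<forall>a\<in>C. \<forall>b\<in>C. Poly_Mapping.lookup t [conj_by G a b, a] = Poly_Mapping.lookup t [a, b])}"
  have rel_sub: "quad_relations G C \<subseteq> K"
  proof
    fix s :: "'g list \<Rightarrow>\<^sub>0 'k" assume s: "s \<in> quad_relations G C"
    then have deg: "s \<in> tensor_deg C 2" by (simp add: quad_relations_def)
    moreover have "s \<in> carrier ?R" using deg by (auto simp: tensor_algebra_def tensor_deg_def)
    moreover have "Poly_Mapping.lookup s w = 0" if "length w < 2" for w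
      using keys_one_form(2)[OF deg, of w] that by (auto simp: in_keys_iff)
    ultimately show "s \<in> K" using s quad_relations_iff[OF fin deg] by (auto simp: K_def)
  qed
  have "ideal K ?R"
  proof (intro idealI ring_tensor_algebra T.add.subgroupI)
    show "K \<subseteq> carrier ?R" by (auto simp: K_def)
    have "0 \<in> K" by (auto simp: K_def tensor_algebra_def)
    then show "K \<noteq> {}" by auto
    fix x assume x: "x \<in> K"
    { have "- x \<in> K" "x \<oplus>\<^bsub>?R\<^esub> (- x) = \<zero>\<^bsub>?R\<^esub>"
        using x by (auto simp: K_def tensor_algebra_def in_keys_iff)
      moreover have "x \<in> carrier ?R" "- x \<in> carrier ?R"
        using x \<open>- x \<in> K\<close> by (auto simp: K_def)
      ultimately show "\<ominus>\<^bsub>?R\<^esub> x \<in> K"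
        using T.minus_equality[of "- x" x] by (metis T.add.m_comm) }
    { fix y assume "y \<in> K"
      then show "x \<oplus>\<^bsub>?R\<^esub> y \<in> K"
        using x keys_add[of x y] by (auto simp: K_def tensor_algebra_def lookup_add) }
    { fix y assume y: "y \<in> carrier ?R"
      have "x \<otimes>\<^bsub>?R\<^esub> y \<in> carrier ?R" "y \<otimes>\<^bsub>?R\<^esub> x \<in> carrier ?R"
        using x y by (auto simp: K_def)
      then have xy: "x * y \<in> carrier ?R" "y * x \<in> carrier ?R" by (simp_all add: tensor_algebra_def)
      have "Poly_Mapping.lookup (x * y) w = 0" "Poly_Mapping.lookup (y * x) w = 0"
          if "length w < 2" for w
        using x that by (auto simp: lookup_list_mult K_def intro!: sum.neutral)
      \<comment> \<open>Since \<open>x\<close> has no constant or linear part, a single cut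
        survives: multiplying by \<open>y\<close> scales the quadratic part of \<open>x\<close> by
        the constant term of \<open>y\<close>, which preserves the linear conditions in
        \<open>K\<close>.\<close>
      moreover have "Poly_Mapping.lookup (x * y) [a, b] = Poly_Mapping.lookup x [a,
          b] * Poly_Mapping.lookup y []"
        "Poly_Mapping.lookup (y * x) [a, b] = Poly_Mapping.lookup y [] * Poly_Mapping.lookup x [a,
            b]" for a b
        using x by (auto simp: lookup_list_mult K_def numeral_2_eq_2 sum.atMost_Suc)
      ultimately have "x * y \<in> K" "y * x \<in> K"
        using x xy by (auto simp: K_def)
      then show "x \<otimes>\<^bsub>?R\<^esub> y \<in> K" "y \<otimes>\<^bsub>?R\<^esub> x \<in> K"
        by (simp_all add: tensor_algebra_def) }
  qed
  then have "quad_ideal G C \<subseteq> K"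
    unfolding quad_ideal_def using rel_sub by (rule T.genideal_minimal)
  moreover have "quad_relations G C \<subseteq> (quad_ideal G C :: ('g list \<Rightarrow>\<^sub>0 'k) set)"
    unfolding quad_ideal_def using rel_sub by (intro T.genideal_self) (auto simp: K_def)
  ultimately show ?thesis using quad_relations_iff[OF fin t] by (auto simp: K_def)
qed

lemma ideal_quad_ideal: "ideal (quad_ideal G C) (tensor_algebra C :: ('g list \<Rightarrow>\<^sub>0
    'k::field_char_0) ring)"
  unfolding quad_ideal_def
  by (rule T.genideal_ideal) (auto simp: quad_relations_def tensor_deg_def tensor_algebra_def)

text \<open>Already in the free algebra \<open>\<theta> * \<alpha> + \<alpha> * \<theta> + \<alpha>
  * \<alpha> = \<phi> * \<phi> - \<theta> * \<theta>\<close>, so flatness becomes membership of a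
  degree 2 tensor in the ideal. Cancelling the common factor at \<open>a\<close> produces the
  premise that this coefficient is nonzero.\<close>

lemma flat_iff:
  fixes \<alpha> :: "'g list \<Rightarrow>\<^sub>0 'k::field_char_0"
  assumes fin: "finite C" and \<alpha>: "\<alpha> \<in> one_forms C"
  shows "flat G C \<alpha> \<longleftrightarrow> (\<forall>a\<in>C. \<forall>b\<in>C. coeff_form (\<alpha> + theta C) a \<noteq> 0 \<longrightarrow>
    coeff_form (\<alpha> + theta C) (conj_by G a b) = coeff_form (\<alpha> + theta C) b)"
proof -
  let ?R = "tensor_algebra C :: ('g list \<Rightarrow>\<^sub>0 'k) ring"
  let ?\<theta> = "theta C :: 'g list \<Rightarrow>\<^sub>0 'k"
  let ?\<phi> = "\<alpha> + ?\<theta>"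
  interpret I: ideal "quad_ideal G C" ?R by (rule ideal_quad_ideal)
  have \<phi>: "?\<phi> \<in> one_forms C" by (intro tensor_deg_add \<alpha> theta_one_form)
  have carr: "t \<in> carrier ?R" if "t \<in> tensor_deg C n" for t n
    using that by (auto simp: tensor_deg_def tensor_algebra_def)
  define Q where "Q = (\<Sum>a\<in>C. coeff_form \<alpha> a *\<^sub>k (?\<theta> * basis_form a + basis_form a * ?\<theta>))"
  have "Q = ?\<theta> * (\<Sum>a\<in>C. coeff_form \<alpha> a *\<^sub>k basis_form a) + (\<Sum>a\<in>C.
      coeff_form \<alpha> a *\<^sub>k basis_form a) * ?\<theta>"
  proof -
    have scale_mult: "c *\<^sub>k (s * t) = s * (c *\<^sub>k t)" "c *\<^sub>k (s * t) = (c *\<^sub>k s) * t" for c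
        and s t :: "'g list \<Rightarrow>\<^sub>0 'k"
      by (auto intro!: poly_mapping_eqI simp: lookup_list_mult sum_distrib_left ac_simps)
    show ?thesis
      unfolding Q_def sum_distrib_left sum_distrib_right sum.distrib[symmetric]
          poly_vs.scale_right_distrib
      by (metis (no_types, lifting) scale_mult)
  qed
  then have Q: "Q = ?\<theta> * \<alpha> + \<alpha> * ?\<theta>" using one_form_eq_sum[OF fin \<alpha>] by simp
  have Qc: "Q \<in> tensor_deg C 2" unfolding Q
    by (intro tensor_deg_add lookup_one_forms_mult(2) \<alpha> theta_one_form)
  have eq: "Q + \<alpha> * \<alpha> = ?\<phi> * ?\<phi> - ?\<theta> * ?\<theta>" unfolding Q by (simp add: algebra_simps)
  have deg: "Q + \<alpha> * \<alpha> \<in> tensor_deg C 2"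
    by (intro tensor_deg_add Qc lookup_one_forms_mult(2) \<alpha>)
  have "curvature G C \<alpha> = quad_class G C Q \<oplus>\<^bsub>quad_algebra G C\<^esub> quad_class G C (\<alpha> * \<alpha>)"
    unfolding curvature_def diff_form_def Q_def[symmetric] quad_class_def quad_algebra_def
        FactRing_def
    using I.rcoset_mult_add[OF carr[OF \<alpha>] carr[OF \<alpha>]] by (simp add: tensor_algebra_def)
  also have "\<dots> = quad_class G C (Q + \<alpha> * \<alpha>)"
    unfolding quad_class_def quad_algebra_def FactRing_def
    using I.a_rcos_sum[OF carr[OF Qc] carr[OF lookup_one_forms_mult(2)[OF \<alpha> \<alpha>]]]
    by (simp add: tensor_algebra_def)
  finally have "flat G C \<alpha> \<longleftrightarrow> quad_class G C (Q + \<alpha> * \<alpha>) = quad_ideal G C"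
    by (simp add: flat_def quad_algebra_def FactRing_def)
  also have "\<dots> \<longleftrightarrow> Q + \<alpha> * \<alpha> \<in> quad_ideal G C"
    unfolding quad_class_def
    using I.a_rcos_self[OF carr[OF deg]] I.a_rcos_const by metis
  \<comment> \<open>The two terms \<open>- 1\<close> stem from \<open>?\<theta> * ?\<theta>\<close>,
    whose coefficient is 1 at every word of length 2 over \<open>C\<close>; they cancel.\<close>
  also have "\<dots> \<longleftrightarrow> (\<forall>a\<in>C. \<forall>b\<in>C. coeff_form ?\<phi> (conj_by G a b) * coeff_form ?\<phi> a - 1
      = coeff_form ?\<phi> a * coeff_form ?\<phi> b - 1)"
    unfolding quad_ideal_deg_2[OF fin deg] unfolding eq
    using closed by (simp add: lookup_minus lookup_one_forms_mult[OF \<phi> \<phi>]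
      lookup_one_forms_mult[OF theta_one_form theta_one_form] coeff_theta[OF fin])
  also have "\<dots> \<longleftrightarrow> (\<forall>a\<in>C. \<forall>b\<in>C. coeff_form ?\<phi> a \<noteq> 0 \<longrightarrow> coeff_form ?\<phi> (conj_by G a b)
      = coeff_form ?\<phi> b)"
    by (auto simp: mult.commute)
  finally show ?thesis .
qed

lemma flat_stratum_eq:
  assumes fin: "finite C"
  shows "(flat_stratum G C n :: ('g list \<Rightarrow>\<^sub>0 'k::field_char_0) set) = {\<phi> \<in> one_forms C.
    (\<forall>a\<in>C. \<forall>b\<in>C. coeff_form \<phi> a \<noteq> 0 \<longrightarrow> coeff_form \<phi> (conj_by G a b) = coeff_form \<phi> b) \<and>
    card {a \<in> C. coeff_form \<phi> a \<noteq> 0} = n}" (is "_ = ?S")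
proof (intro equalityI subsetI)
  fix \<phi> :: "'g list \<Rightarrow>\<^sub>0 'k" assume "\<phi> \<in> flat_stratum G C n"
  then obtain \<alpha> where "\<phi> = \<alpha> + theta C" "\<alpha> \<in> one_forms C" "flat G C \<alpha>" "cardinality C \<alpha> = n"
    by (auto simp: flat_stratum_def)
  then show "\<phi> \<in> ?S"
    using tensor_deg_add[OF _ theta_one_form] by (auto simp: flat_iff[OF fin] cardinality_def)
next
  fix \<phi> :: "'g list \<Rightarrow>\<^sub>0 'k" assume \<phi>: "\<phi> \<in> ?S"
  then have \<alpha>: "\<phi> - theta C \<in> one_forms C" by (blast intro: tensor_deg_diff theta_one_form)
  moreover have "flat G C (\<phi> - theta C)" using \<phi> flat_iff[OF fin \<alpha>] by simp
  moreover have "cardinality C (\<phi> - theta C) = n" using \<phi> by (simp add: cardinality_def)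
  ultimately show "\<phi> \<in> flat_stratum G C n" unfolding flat_stratum_def
    by (intro CollectI exI[of _ "\<phi> - theta C"]) simp
qed

end

section \<open>Permutation representations modulo constants\<close>

text \<open>\<open>V\<close> is the space of functions on the \<open>G\<close>-set \<open>B\<close> modulo constants, with \<open>Q\<close> as quotient map.\<close>

locale perm_model = group G for G :: "('g, 'm) monoid_scheme" (structure) +
  fixes B :: "'x set" and \<sigma> :: "'g \<Rightarrow> 'x \<Rightarrow> 'x"
    and V :: "('g, 'k::field_char_0, 'v) rep" and Q :: "('x \<Rightarrow> 'k) \<Rightarrow> 'v"
  assumes finite_B: "finite B"
    and \<sigma>_closed: "\<And>g x. g \<in> carrier G \<Longrightarrow> x \<in> B \<Longrightarrow> \<sigma> g x \<in> B"
    and \<sigma>_one: "\<And>x. x \<in> B \<Longrightarrow> \<sigma> \<one> x = x"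
    and \<sigma>_mult: "\<And>g h x. g \<in> carrier G \<Longrightarrow> h \<in> carrier G \<Longrightarrow> x \<in> B \<Longrightarrow> \<sigma> (g \<otimes> h) x = \<sigma> g (\<sigma> h x)"
    and carrier_V: "carrier V = range Q"
    and zero_V: "\<zero>\<^bsub>V\<^esub> = Q (\<lambda>_. 0)"
    and add_V: "\<And>c d. Q c \<oplus>\<^bsub>V\<^esub> Q d = Q (\<lambda>x. c x + d x)"
    and smult_V: "\<And>k c. k \<odot>\<^bsub>V\<^esub> Q c = Q (\<lambda>x. k * c x)"
    and act_V: "\<And>g c. g \<in> carrier G \<Longrightarrow> act V g (Q c) = Q (\<lambda>x. c (\<sigma> (inv g) x))"
    and Q_eq_iff: "\<And>c d. Q c = Q d \<longleftrightarrow> (\<exists>k. \<forall>x\<in>B. c x = d x + k)"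
begin

lemma Q_cong: "(\<And>x. x \<in> B \<Longrightarrow> c x = d x) \<Longrightarrow> Q c = Q d"
  by (auto simp: Q_eq_iff intro: exI[of _ 0])

lemma \<sigma>_inv:
  assumes "g \<in> carrier G" "x \<in> B"
  shows "\<sigma> g (\<sigma> (inv g) x) = x" "\<sigma> (inv g) (\<sigma> g x) = x"
  using assms \<sigma>_mult[of g "inv g" x] \<sigma>_mult[of "inv g" g x] by (simp_all add: \<sigma>_one)

lemma abelian_group_V: "abelian_group V"
proof (rule abelian_groupI)
  fix v assume "v \<in> carrier V"
  then obtain c where "v = Q c" by (auto simp: carrier_V)
  then show "\<exists>w\<in>carrier V. w \<oplus>\<^bsub>V\<^esub> v = \<zero>\<^bsub>V\<^esub>"
    by (intro bexI[of _ "Q (\<lambda>x. - c x)"]) (auto simp: carrier_V zero_V add_V)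
qed (auto simp: carrier_V zero_V add_V algebra_simps)

lemma module_V: "Module.module (ring_of_type_algebra :: 'k ring) V"
  by (intro moduleI abelian_group_V cring_from_type_algebra)
    (auto simp: carrier_V zero_V add_V smult_V ring_of_type_algebra_def algebra_simps)

lemma is_rep_V: "is_rep G V"
  unfolding is_rep_def
proof (intro conjI ballI allI)
  fix g h v assume gh: "g \<in> carrier G" "h \<in> carrier G" and "v \<in> carrier V"
  then obtain c where c: "v = Q c" by (auto simp: carrier_V)
  show "act V (g \<otimes> h) v = act V g (act V h v)"
    using gh by (auto simp: c act_V inv_mult_group \<sigma>_mult intro!: Q_cong)
qed (auto simp: group_axioms module_V carrier_V add_V smult_V act_V \<sigma>_one intro!: Q_cong)

interpretation V: abelian_group V by (rule abelian_group_V)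

lemma finsum_Q: "(\<Oplus>\<^bsub>V\<^esub>i\<in>I. Q (c i)) = Q (\<lambda>x. \<Sum>i\<in>I. c i x)" if "finite I"
  using that
proof (induction I)
  case (insert i I)
  then show ?case by (subst V.finsum_insert) (auto simp: carrier_V add_V)
qed (auto simp: zero_V)

definition \<delta> :: "'x \<Rightarrow> 'x \<Rightarrow> 'k" where "\<delta> x y = (if y = x then 1 else 0)"

text \<open>Every class modulo constants has exactly one representative vanishing at a chosen point
  \<open>b\<close>. The indicators of the other points therefore form a basis, with coordinates
  \<open>d x - d b\<close>.\<close>

lemma has_dim_V:
  assumes "B \<noteq> {}" shows "has_dim V (card B - 1)"
proof -
  obtain b where b: "b \<in> B" using assms by auto
  let ?B = "B - {b}"
  let ?E = "\<lambda>x. Q (\<delta> x)"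
  have inj: "inj_on ?E ?B"
  proof (rule inj_onI)
    fix x y assume xy: "x \<in> ?B" "y \<in> ?B" "Q (\<delta> x) = Q (\<delta> y)"
    then obtain k where k: "\<And>z. z \<in> B \<Longrightarrow> \<delta> x z = \<delta> y z + k" by (auto simp: Q_eq_iff)
    \<comment> \<open>At \<open>b\<close> both indicators vanish, which gives \<open>k = 0\<close>;
      at \<open>x\<close> they can then agree only if \<open>x = y\<close>.\<close>
    from k[of b] k[of x] xy b show "x = y" by (auto simp: \<delta>_def split: if_splits)
  qed
  have sum: "(\<Oplus>\<^bsub>V\<^esub>v\<in>?E ` ?B. c v \<odot>\<^bsub>V\<^esub> v) = Q (\<lambda>y. if y \<in> ?B then c (?E y) else 0)" for c
  proof -
    have "(\<Oplus>\<^bsub>V\<^esub>v\<in>?E ` ?B. c v \<odot>\<^bsub>V\<^esub> v) = (\<Oplus>\<^bsub>V\<^esub>x\<in>?B. c (?E x) \<odot>\<^bsub>V\<^esub> ?E x)"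
      by (rule V.add.finprod_reindex) (auto simp: inj carrier_V smult_V)
    also have "\<dots> = Q (\<lambda>y. \<Sum>x\<in>?B. c (?E x) * \<delta> x y)"
      unfolding smult_V using finite_B by (simp add: finsum_Q)
    also have "(\<lambda>y. \<Sum>x\<in>?B. c (?E x) * \<delta> x y) = (\<lambda>y. if y \<in> ?B then c (?E y) else 0)"
    proof
      fix y
      have "(\<Sum>x\<in>?B. c (?E x) * \<delta> x y) = (\<Sum>x\<in>?B. if y = x then c (?E x) else 0)"
        by (rule sum.cong) (auto simp: \<delta>_def)
      then show "(\<Sum>x\<in>?B. c (?E x) * \<delta> x y) = (if y \<in> ?B then c (?E y) else 0)"
        using finite_B by simp
    qed
    finally show ?thesis .
  qed
  have "\<exists>!c. c \<in> ?E ` ?B \<rightarrow>\<^sub>E UNIV \<and> v = (\<Oplus>\<^bsub>V\<^esub>v\<in>?E ` ?B. c v \<odot>\<^bsub>V\<^esub> v)" if "v \<in> carrier V" for v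
  proof -
    have "v \<in> range Q" using that by (simp add: carrier_V)
    then obtain d where d: "v = Q d" by blast
    have iff: "v = (\<Oplus>\<^bsub>V\<^esub>v\<in>?E ` ?B. c v \<odot>\<^bsub>V\<^esub> v) \<longleftrightarrow> (\<forall>x\<in>?B. c (?E x) = d x - d b)" for c
    proof
      assume "v = (\<Oplus>\<^bsub>V\<^esub>v\<in>?E ` ?B. c v \<odot>\<^bsub>V\<^esub> v)"
      then obtain k where k: "\<And>x. x \<in> B \<Longrightarrow> d x = (if x \<in> ?B then c (?E x) else 0) + k"
        unfolding d sum by (auto simp: Q_eq_iff)
      from k[OF b] have "k = d b" by simp
      then show "\<forall>x\<in>?B. c (?E x) = d x - d b" using k by auto
    next
      assume "\<forall>x\<in>?B. c (?E x) = d x - d b"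
      then show "v = (\<Oplus>\<^bsub>V\<^esub>v\<in>?E ` ?B. c v \<odot>\<^bsub>V\<^esub> v)"
        unfolding d sum Q_eq_iff by (intro exI[of _ "d b"]) auto
    qed
    show ?thesis unfolding iff
    proof (rule ex1I)
      \<comment> \<open>\<open>has_dim\<close> indexes coordinates by basis vectors instead of
        points, hence the inverse of \<open>?E\<close>; \<open>restrict\<close> supplies the
        extensionality demanded by the function space.\<close>
      let ?c = "restrict (\<lambda>v. d (the_inv_into ?B ?E v) - d b) (?E ` ?B)"
      show *: "?c \<in> ?E ` ?B \<rightarrow>\<^sub>E UNIV \<and> (\<forall>x\<in>?B. ?c (?E x) = d x - d b)"
        by (auto simp: the_inv_into_f_f[OF inj])
      fix c assume c: "c \<in> ?E ` ?B \<rightarrow>\<^sub>E UNIV \<and> (\<forall>x\<in>?B. c (?E x) = d x - d b)"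
      show "c = ?c"
        by (rule PiE_ext[of _ "?E ` ?B" "\<lambda>_. UNIV"]) (use c * in auto)
    qed
  qed
  moreover have "card (?E ` ?B) = card B - 1" using b by (simp add: card_image[OF inj])
  ultimately show ?thesis unfolding has_dim_def using finite_B
    by (intro exI[of _ "?E ` ?B"]) (auto simp: carrier_V)
qed

text \<open>A vector with two different coordinates and its image under the transposition of these
  coordinates differ by a multiple of \<open>\<delta> x - \<delta> y\<close>; modulo constants, these differences
  add up to a multiple of \<open>\<delta> x\<close>.\<close>

lemma irreducible_V:
  assumes two: "card B \<ge> 2"
    and swaps: "\<And>x y. x \<in> B \<Longrightarrow> y \<in> B \<Longrightarrow> x \<noteq> y \<Longrightarrow>
      \<exists>g\<in>carrier G. \<forall>z\<in>B. \<sigma> g z = Transposition.transpose x y z"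
  shows "irreducible_rep G V"
proof -
  have act_swap: "\<exists>g\<in>carrier G. \<forall>c. act V g (Q c) = Q (\<lambda>z. c (Transposition.transpose x y z))"
    if xy: "x \<in> B" "y \<in> B" "x \<noteq> y" for x y
  proof -
    obtain g where g: "g \<in> carrier G" and gz: "\<And>z. z \<in> B \<Longrightarrow> \<sigma> g z = Transposition.transpose x y z"
      using swaps[OF xy] by auto
    have tr: "Transposition.transpose x y z \<in> B" if "z \<in> B" for z
      using that xy by (auto simp: Transposition.transpose_def)
    have "\<sigma> (inv g) z = Transposition.transpose x y z" if "z \<in> B" for z
      using \<sigma>_inv(2)[OF g tr[OF that]] gz[OF tr[OF that]] by simp
    then show ?thesis using g by (intro bexI[of _ g]) (auto simp: act_V intro!: Q_cong)
  qed
  have "H = {\<zero>\<^bsub>V\<^esub>} \<or> H = carrier V"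
    if H: "submodule H (ring_of_type_algebra :: 'k ring) V"
      and inv: "\<forall>g\<in>carrier G. \<forall>x\<in>H. act V g x \<in> H" for H
  proof -
    interpret M: Module.module "ring_of_type_algebra :: 'k ring" V by (rule module_V)
    have sub: "H \<subseteq> range Q" and ne: "H \<noteq> {}"
      and add: "Q c \<in> H \<Longrightarrow> Q d \<in> H \<Longrightarrow> Q (\<lambda>x. c x + d x) \<in> H"
      and smult: "Q c \<in> H \<Longrightarrow> Q (\<lambda>x. k * c x) \<in> H" for c d k
      using M.submoduleE[OF H] by (auto simp: carrier_V ring_of_type_algebra_def add_V[symmetric]
          smult_V[symmetric])
    have swap: "Q (\<lambda>z. c (Transposition.transpose x y z)) \<in> H"
      if "Q c \<in> H" "x \<in> B" "y \<in> B" "x \<noteq> y" for c x y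
      using act_swap[OF that(2-4)] inv that(1) by metis
    obtain c0 where "Q c0 \<in> H" using ne sub by blast
    from smult[OF this, of 0] have zero: "Q (\<lambda>_. 0) \<in> H" by simp
    have sums: "Q (\<lambda>x. \<Sum>i\<in>I. c i x) \<in> H" if "finite I" "\<And>i. i \<in> I \<Longrightarrow> Q (c i) \<in> H"
      for I :: "'x set" and c using that by (induction I) (auto simp: zero add)
    show ?thesis
    proof (cases "H = {\<zero>\<^bsub>V\<^esub>}")
      case False
      with ne obtain v where v: "v \<in> H" "v \<noteq> \<zero>\<^bsub>V\<^esub>" by blast
      with sub obtain c where "v = Q c" by blast
      with v have c: "Q c \<in> H" "Q c \<noteq> Q (\<lambda>_. 0)" by (simp_all add: zero_V)
      have "\<not> (\<forall>x\<in>B. \<forall>y\<in>B. c x = c y)"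
      proof
        assume *: "\<forall>x\<in>B. \<forall>y\<in>B. c x = c y"
        then obtain k where "\<forall>x\<in>B. c x = k" by blast
        then have "\<exists>k. \<forall>x\<in>B. c x = 0 + k" by simp
        then show False using c(2) unfolding Q_eq_iff by blast
      qed
      then obtain x y where xy: "x \<in> B" "y \<in> B" "c x \<noteq> c y" by auto
      then have "x \<noteq> y" by auto
      note sw = swap[OF c(1) xy(1,2) this]
      have "(\<lambda>z. 1 / (c x - c y) * (c z + (- 1) * c (Transposition.transpose x y z))) =
          (\<lambda>z. \<delta> x z - \<delta> y z)"
        using xy(3) \<open>x \<noteq> y\<close> by (auto simp: fun_eq_iff \<delta>_def Transposition.transpose_def
            divide_simps)
      then have d: "Q (\<lambda>z. \<delta> x z - \<delta> y z) \<in> H"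
        using smult[OF add[OF c(1) smult[OF sw, of "-1"]], of "1 / (c x - c y)"] by simp
      have d': "Q (\<lambda>w. \<delta> x w - \<delta> z w) \<in> H" if "z \<in> B" for z
      proof (cases "z = x \<or> z = y")
        case False
        have "(\<lambda>w. \<delta> x (Transposition.transpose y z w) - \<delta> y (Transposition.transpose y z w)) =
            (\<lambda>w. \<delta> x w - \<delta> z w)"
          using False \<open>x \<noteq> y\<close> by (auto simp: \<delta>_def Transposition.transpose_def fun_eq_iff)
        then show ?thesis using swap[OF d xy(2) that] False by auto
      qed (use d zero in auto)
      have "Q (\<lambda>w. \<Sum>z\<in>B. \<delta> x w - \<delta> z w) \<in> H" by (rule sums) (use finite_B d' in auto)
      \<comment> \<open>The indicators of all points add up to the constant 1, whence the witness
        \<open>-1\<close>. Afterwards \<open>card B\<close> can be divided out because the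
        characteristic is 0.\<close>
      also have "Q (\<lambda>w. \<Sum>z\<in>B. \<delta> x w - \<delta> z w) = Q (\<lambda>w. of_nat (card B) * \<delta> x w)"
        unfolding Q_eq_iff using finite_B
        by (intro exI[of _ "-1"]) (auto simp: sum_subtractf \<delta>_def)
      finally have "Q (\<lambda>w. 1 / of_nat (card B) * (of_nat (card B) * \<delta> x w)) \<in> H" by (rule smult)
      then have dx: "Q (\<lambda>w. \<delta> x w) \<in> H" using two by simp
      have dz: "Q (\<lambda>w. \<delta> z w) \<in> H" if "z \<in> B" for z
      proof -
        have "(\<lambda>w. \<delta> x w + (-1) * (\<delta> x w - \<delta> z w)) = \<delta> z" by auto
        then show ?thesis using add[OF dx smult[OF d'[OF that], of "-1"]] by simp
      qed
      have "Q e \<in> H" for e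
      proof -
        have "Q (\<lambda>w. \<Sum>z\<in>B. e z * \<delta> z w) \<in> H" by (rule sums) (use finite_B dz smult in auto)
        also have "Q (\<lambda>w. \<Sum>z\<in>B. e z * \<delta> z w) = Q e"
          using finite_B by (intro Q_cong) (simp add: \<delta>_def if_distrib[of "\<lambda>k.
              _ * k"] cong: if_cong)
        finally show ?thesis .
      qed
      then show ?thesis using sub by (auto simp: carrier_V)
    qed simp
  qed
  moreover have "carrier V \<noteq> {\<zero>\<^bsub>V\<^esub>}"
  proof -
    obtain x y where "x \<in> B" "y \<in> B" "x \<noteq> y" using two card_le_Suc0_iff_eq[OF finite_B] by force
    then have "Q (\<delta> x) \<noteq> Q (\<lambda>_. 0)" unfolding Q_eq_iff \<delta>_def by (metis add_0 zero_neq_one)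
    then show ?thesis by (auto simp: carrier_V zero_V)
  qed
  ultimately show ?thesis unfolding irreducible_rep_def using is_rep_V by auto
qed

end

section \<open>Comparing models, and building them from explicit quotients\<close>

lemma perm_model_iso:
  assumes "perm_model G B \<sigma> V Q" "perm_model G B \<sigma> V' Q'"
  shows "rep_iso G V V'"
proof -
  interpret V: perm_model G B \<sigma> V Q by fact
  interpret V': perm_model G B \<sigma> V' Q' by fact
  \<comment> \<open>\<open>Q\<close> and \<open>Q'\<close> identify the same functions, namely those
    differing by a constant on \<open>B\<close>; so the value does not depend on the chosen
    \<open>c\<close>, and \<open>h\<close> is injective as well.\<close>
  define h where "h v = Q' (SOME c. Q c = v)" for v
  have h: "h (Q c) = Q' c" for c
  proof -
    have "Q (SOME d. Q d = Q c) = Q c" by (rule someI[where x = c]) simp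
    then show ?thesis by (simp add: h_def V.Q_eq_iff V'.Q_eq_iff)
  qed
  have "inj_on h (range Q)"
    by (rule inj_onI) (auto simp: h V.Q_eq_iff V'.Q_eq_iff)
  moreover have "h ` range Q = range Q'" by (auto simp: h image_iff)
  ultimately have "bij_betw h (carrier V) (carrier V')"
    by (simp add: bij_betw_def V.carrier_V V'.carrier_V)
  then show ?thesis unfolding rep_iso_def
    by (intro conjI exI[of _ h] V.is_rep_V V'.is_rep_V)
      (auto simp: h V.carrier_V V.add_V V'.add_V V.smult_V V'.smult_V V.act_V V'.act_V)
qed

text \<open>Independence identifies the span with the functions on \<open>B\<close>, and
  \<open>sum_f\<close> identifies the line of \<open>w\<close> with the constants:
  \<open>k *\<^sub>k w\<close> is the combination with all coefficients \<open>k / m\<close>. The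
  factor \<open>m\<close> is kept general because several supports may contain the same class
  element.\<close>

lemma perm_model_quot_rep:
  fixes f :: "'x \<Rightarrow> ('y \<Rightarrow>\<^sub>0 'k::field_char_0)"
  assumes "group G" and fin: "finite B"
    and \<sigma>_closed: "\<And>g x. g \<in> carrier G \<Longrightarrow> x \<in> B \<Longrightarrow> \<sigma> g x \<in> B"
    and \<sigma>_one: "\<And>x. x \<in> B \<Longrightarrow> \<sigma> \<one>\<^bsub>G\<^esub> x = x"
    and \<sigma>_mult: "\<And>g h x. g \<in> carrier G \<Longrightarrow> h \<in> carrier G \<Longrightarrow> x \<in> B \<Longrightarrow>
      \<sigma> (g \<otimes>\<^bsub>G\<^esub> h) x = \<sigma> g (\<sigma> h x)"
    and T_add: "\<And>g u v. g \<in> carrier G \<Longrightarrow> T g (u + v) = T g u + T g v"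
    and T_scale: "\<And>g k u. g \<in> carrier G \<Longrightarrow> T g (k *\<^sub>k u) = k *\<^sub>k T g u"
    and T_f: "\<And>g x. g \<in> carrier G \<Longrightarrow> x \<in> B \<Longrightarrow> T g (f x) = f (\<sigma> g x)"
    and indep: "\<And>c x. (\<Sum>x\<in>B. c x *\<^sub>k f x) = 0 \<Longrightarrow> x \<in> B \<Longrightarrow> c x = 0"
    and sum_f: "(\<Sum>x\<in>B. f x) = m *\<^sub>k w" and m: "m \<noteq> 0"
  shows "perm_model G B \<sigma> (quot_rep \<lparr>carrier = lin_span (f ` B), monoid.mult = undefined,
      one = undefined, ring.zero = 0, add = (+), module.smult = scale, act = T\<rparr> (lin_span {w}))
    (\<lambda>c. (\<lambda>u. u + (\<Sum>x\<in>B. c x *\<^sub>k f x)) ` lin_span {w})" (is "perm_model G B \<sigma> (quot_rep ?U ?W) ?Q")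
proof -
  interpret group G by fact
  define lc where "lc c = (\<Sum>x\<in>B. c x *\<^sub>k f x)" for c
  define coset where "coset v = (\<lambda>u. u + v) ` ?W" for v
  have W: "?W = range (\<lambda>k. k *\<^sub>k w)" by (rule poly_vs.span_singleton)
  have lc_add: "lc (\<lambda>x. c x + d x) = lc c + lc d" for c d
    by (simp add: lc_def poly_vs.scale_left_distrib sum.distrib)
  have lc_scale: "lc (\<lambda>x. k * c x) = k *\<^sub>k lc c" for k c
    by (simp add: lc_def poly_vs.scale_sum_right)
  have lc_diff: "lc (\<lambda>x. c x - d x) = lc c - lc d" for c d
    by (simp add: lc_def poly_vs.scale_left_diff_distrib sum_subtractf)
  have lc_const: "lc (\<lambda>_. k) = (k * m) *\<^sub>k w" for k
    by (simp add: lc_def poly_vs.scale_sum_right[symmetric] sum_f)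
  have lc_0: "lc (\<lambda>_. 0) = 0" by (simp add: lc_def)
  have U: "lin_span (f ` B) = range lc"
  proof
    show "range lc \<subseteq> lin_span (f ` B)"
      by (auto simp: lc_def intro!: poly_vs.span_sum poly_vs.span_scale intro: poly_vs.span_base)
    have "f x \<in> range lc" if "x \<in> B" for x
      using that fin by (intro image_eqI[of _ _ "\<lambda>y. if y = x then 1 else 0"])
        (auto simp: lc_def if_distrib[of "\<lambda>k. k *\<^sub>k _"] cong: if_cong)
    moreover have "poly_vs.subspace (range lc)"
      by (auto simp: poly_vs.subspace_def lc_add[symmetric] lc_scale[symmetric] intro:
          image_eqI[of _ _ "\<lambda>_. 0"] lc_0[symmetric])
    ultimately show "lin_span (f ` B) \<subseteq> range lc"
      by (intro poly_vs.span_minimal) auto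
  qed
  have T_lc: "T g (lc c) = lc (\<lambda>x. c (\<sigma> (inv\<^bsub>G\<^esub> g) x))" if g: "g \<in> carrier G" for g c
  proof -
    have T0: "T g 0 = 0" using T_scale[OF g, of 0 0] by simp
    have T_sum: "T g (\<Sum>x\<in>A. h x) = (\<Sum>x\<in>A. T g (h x))" for A :: "'x set" and h
      by (induction A rule: infinite_finite_induct) (auto simp: T0 T_add[OF g])
    have inv: "\<sigma> g (\<sigma> (inv\<^bsub>G\<^esub> g) x) = x" "\<sigma> (inv\<^bsub>G\<^esub> g) (\<sigma> g x) = x" if "x \<in> B" for x
      using that g \<sigma>_mult[of g "inv\<^bsub>G\<^esub> g" x] \<sigma>_mult[of "inv\<^bsub>G\<^esub> g" g x] by (simp_all add: \<sigma>_one)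
    have "T g (lc c) = (\<Sum>x\<in>B. c x *\<^sub>k f (\<sigma> g x))"
      by (simp add: lc_def T_sum T_scale[OF g] T_f[OF g])
    also have "\<dots> = lc (\<lambda>x. c (\<sigma> (inv\<^bsub>G\<^esub> g) x))"
      unfolding lc_def
      by (rule sum.reindex_bij_witness[of _ "\<sigma> (inv\<^bsub>G\<^esub> g)" "\<sigma> g"]) (use g inv \<sigma>_closed in auto)
    finally show ?thesis .
  qed
  have T_w: "T g u \<in> ?W" if g: "g \<in> carrier G" and u: "u \<in> ?W" for g u
  proof -
    obtain k where "u = k *\<^sub>k w" using u by (auto simp: W)
    \<comment> \<open>The divided line comes from constant functions, and these are unchanged when
      the group permutes the points.\<close>
    then have "u = lc (\<lambda>_. k / m)" using m by (simp add: lc_const)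
    then show ?thesis using T_lc[OF g, of "\<lambda>_. k / m"] m by (auto simp: W lc_const)
  qed
  have coset_eq: "coset u = coset v \<longleftrightarrow> u - v \<in> ?W" for u v
  proof
    assume "coset u = coset v"
    moreover have "u \<in> coset u" unfolding coset_def
      by (rule image_eqI[of _ _ 0]) (auto intro: poly_vs.span_zero)
    ultimately show "u - v \<in> ?W" by (auto simp: coset_def)
  next
    assume uv: "u - v \<in> ?W"
    have *: "coset u \<subseteq> coset v" if "u - v \<in> ?W" for u v
    proof
      fix x assume "x \<in> coset u"
      then have "x - u \<in> ?W" by (auto simp: coset_def)
      from poly_vs.span_add[OF this that] show "x \<in> coset v"
        unfolding coset_def by (intro image_eqI[of _ _ "x - v"]) auto
    qed
    from uv poly_vs.span_neg[OF uv] show "coset u = coset v" by (intro equalityI *) auto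
  qed
  have mem_coset: "x \<in> coset v \<longleftrightarrow> x - v \<in> ?W" for x v
    by (auto simp: coset_def image_iff intro: bexI[of _ "x - v"])
  have coset_self: "v \<in> coset v" for v by (simp add: mem_coset poly_vs.span_zero)
  have a_coset: "?W +>\<^bsub>?U\<^esub> v = coset v" for v
    by (auto simp: a_r_coset_def r_coset_def coset_def)
  \<comment> \<open>\<open>quot_rep\<close> defines scaling and action as unions over all
    representatives. A map preserving differences in \<open>?W\<close> sends all representatives
    into one coset, so that the union is this coset.\<close>
  have lift: "(\<Union>x\<in>coset v. coset (F x)) = coset (F v)"
    if F: "\<And>x. x - v \<in> ?W \<Longrightarrow> F x - F v \<in> ?W" for F v
  proof -
    have "coset (F x) = coset (F v)" if x: "x \<in> coset v" for x
      unfolding coset_eq by (rule F) (use x in \<open>simp add: mem_coset\<close>)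
    then have "(\<Union>x\<in>coset v. coset (F x)) = (\<Union>x\<in>coset v. coset (F v))" by (rule SUP_cong[OF refl])
    then show ?thesis using coset_self[of v] by blast
  qed
  have Q: "?Q = (\<lambda>c. coset (lc c))" by (simp add: coset_def lc_def)
  show ?thesis
    unfolding Q
  proof
    show "finite B" by (rule fin)
    show "carrier (quot_rep ?U ?W) = range (\<lambda>c. coset (lc c))"
      by (auto simp: quot_rep_def A_RCOSETS_def RCOSETS_def r_coset_def coset_def U)
    show "\<zero>\<^bsub>quot_rep ?U ?W\<^esub> = coset (lc (\<lambda>_. 0))"
      by (simp add: quot_rep_def lc_0 coset_def)
    fix c d :: "'x \<Rightarrow> 'k" and k
    have "set_add ?U (coset u) (coset v) = coset (u + v)" for u v
    proof (intro equalityI subsetI)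
      fix x assume "x \<in> set_add ?U (coset u) (coset v)"
      then obtain y z where "y - u \<in> ?W" "z - v \<in> ?W" "x = y + z"
        by (auto simp: set_add_def set_mult_def mem_coset)
      then show "x \<in> coset (u + v)" using poly_vs.span_add[of "y - u" "{w}" "z - v"]
        by (simp add: mem_coset algebra_simps)
    next
      fix x assume "x \<in> coset (u + v)"
      then have "x - v \<in> coset u" by (simp add: mem_coset algebra_simps)
      then show "x \<in> set_add ?U (coset u) (coset v)" using coset_self[of v]
        by (force simp: set_add_def set_mult_def)
    qed
    then show "coset (lc c) \<oplus>\<^bsub>quot_rep ?U ?W\<^esub> coset (lc d) = coset (lc (\<lambda>x. c x + d x))"
      by (simp add: quot_rep_def lc_add)
    have "(\<Union>x\<in>coset u. coset (k *\<^sub>k x)) = coset (k *\<^sub>k u)" for u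
      by (rule lift) (metis poly_vs.scale_right_diff_distrib poly_vs.span_scale)
    then show "k \<odot>\<^bsub>quot_rep ?U ?W\<^esub> coset (lc c) = coset (lc (\<lambda>x. k * c x))"
      by (simp add: quot_rep_def a_coset lc_scale)
    show "coset (lc c) = coset (lc d) \<longleftrightarrow> (\<exists>k. \<forall>x\<in>B. c x = d x + k)"
    proof
      assume "coset (lc c) = coset (lc d)"
      then obtain k where "lc c - lc d = k *\<^sub>k w" by (auto simp: coset_eq W)
      then have "lc (\<lambda>x. c x - d x - k / m) = 0" using m by (simp add: lc_diff lc_const)
      then have "c x - d x - k / m = 0" if "x \<in> B" for x
        using indep[OF _ that, of "\<lambda>x. c x - d x - k / m"] by (simp add: lc_def)
      then have "\<forall>x\<in>B. c x = d x + k / m" by (auto simp: algebra_simps)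
      then show "\<exists>k. \<forall>x\<in>B. c x = d x + k" ..
    next
      assume "\<exists>k. \<forall>x\<in>B. c x = d x + k"
      then obtain k where "\<forall>x\<in>B. c x = d x + k" ..
      then have "lc c = lc (\<lambda>x. d x + k)" by (simp add: lc_def)
      then have "lc c = lc d + (k * m) *\<^sub>k w" by (simp add: lc_add lc_const)
      then show "coset (lc c) = coset (lc d)" by (auto simp: coset_eq W)
    qed
    fix g assume g: "g \<in> carrier G"
    have "(\<Union>x\<in>coset u. coset (T g x)) = coset (T g u)" for u
    proof (rule lift)
      fix x assume "x - u \<in> ?W"
      from T_w[OF g this] show "T g x - T g u \<in> ?W"
        using T_add[OF g, of "x - u" u] by simp
    qed
    then show "act (quot_rep ?U ?W) g (coset (lc c)) = coset (lc (\<lambda>x. c (\<sigma> (inv\<^bsub>G\<^esub> g) x)))"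
      by (simp add: quot_rep_def a_coset T_lc[OF g])
  qed (use \<sigma>_closed \<sigma>_one \<sigma>_mult in auto)
qed

text \<open>Rewrites the carrier of \<open>perm_rep\<close> as the span of a basis, the form in
  which \<open>perm_model_quot_rep\<close> expects it.\<close>

lemma span_singles:
  assumes "finite B"
  shows "lin_span ((\<lambda>x. Poly_Mapping.single x 1) ` B) = {v :: 'x \<Rightarrow>\<^sub>0 'k::field_char_0.
      Poly_Mapping.keys v \<subseteq> B}"
proof (intro equalityI subsetI CollectI)
  fix v :: "'x \<Rightarrow>\<^sub>0 'k" assume "v \<in> {v. Poly_Mapping.keys v \<subseteq> B}"
  then have "v = (\<Sum>x\<in>B. Poly_Mapping.lookup v x *\<^sub>k Poly_Mapping.single x 1)"
    using assms by (auto intro!: poly_mapping_eqI simp: lookup_sum lookup_single when_def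
        if_distrib[of "\<lambda>k. _ * k"] in_keys_iff subset_iff cong: if_cong)
  also have "\<dots> \<in> lin_span ((\<lambda>x. Poly_Mapping.single x 1) ` B)"
    by (intro poly_vs.span_sum poly_vs.span_scale poly_vs.span_base) auto
  finally show "v \<in> lin_span ((\<lambda>x. Poly_Mapping.single x 1) ` B)" .
next
  fix v :: "'x \<Rightarrow>\<^sub>0 'k" and x
  assume x: "x \<in> Poly_Mapping.keys v" and "v \<in> lin_span ((\<lambda>x. Poly_Mapping.single x 1) ` B)"
  note this(2)
  moreover have "poly_vs.subspace {v :: 'x \<Rightarrow>\<^sub>0 'k. Poly_Mapping.keys v \<subseteq> B}"
    by (auto simp: poly_vs.subspace_def subset_iff in_keys_iff lookup_add) (metis add_0)
  ultimately have "v \<in> {v. Poly_Mapping.keys v \<subseteq> B}"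
    using poly_vs.span_minimal[of "(\<lambda>x. Poly_Mapping.single x 1) ` B" "{v :: 'x \<Rightarrow>\<^sub>0 'k.
        Poly_Mapping.keys v \<subseteq> B}"] by fastforce
  then show "x \<in> B" using x by auto
qed

lemma perm_model_reduced_perm_rep:
  assumes "group G" and fin: "finite B"
    and "\<And>g x. g \<in> carrier G \<Longrightarrow> x \<in> B \<Longrightarrow> \<sigma> g x \<in> B"
    and "\<And>x. x \<in> B \<Longrightarrow> \<sigma> \<one>\<^bsub>G\<^esub> x = x"
    and "\<And>g h x. g \<in> carrier G \<Longrightarrow> h \<in> carrier G \<Longrightarrow> x \<in> B \<Longrightarrow>
      \<sigma> (g \<otimes>\<^bsub>G\<^esub> h) x = \<sigma> g (\<sigma> h x)"
  shows "\<exists>Q. perm_model G B \<sigma> (reduced_perm_rep B \<sigma> :: ('g, 'k::field_char_0,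
      ('x \<Rightarrow>\<^sub>0 'k) set) rep) Q"
proof -
  have indep: "c x = 0" if "(\<Sum>x\<in>B. c x *\<^sub>k Poly_Mapping.single x 1) = 0" "x \<in> B"
      for c :: "'x \<Rightarrow> 'k" and x
  proof -
    have "c x = Poly_Mapping.lookup (\<Sum>x\<in>B. c x *\<^sub>k Poly_Mapping.single x 1) x"
      using fin that(2) by (simp add: lookup_sum lookup_single when_def if_distrib[of "\<lambda>k.
          _ * k"] cong: if_cong)
    then show ?thesis using that(1) by simp
  qed
  show ?thesis
    unfolding reduced_perm_rep_def perm_rep_def span_singles[OF fin, symmetric]
    \<comment> \<open>Here \<open>m = 1\<close>, because the divided line is spanned by the very sum
      of the basis vectors.\<close>
    by (rule exI, rule perm_model_quot_rep[where m = 1])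
      (use assms indep in \<open>auto simp: lin_ext_add lin_ext_scale\<close>)
qed

text \<open>A point \<open>x\<close> stands for the 0/1 form with support \<open>A x\<close>.
  Exchanging the summations over points and class elements shows that these forms add up to
  \<open>m\<close> times \<open>theta C\<close>, where \<open>m\<close> counts the supports through
  an element. The hypothesis \<open>indep\<close> says that the incidence matrix has trivial
  kernel.\<close>

lemma perm_model_stratum_rep:
  fixes A :: "'x \<Rightarrow> 'g set"
  assumes "group G" "finite B" and fin: "finite C" and "C \<subseteq> carrier G"
    and \<sigma>: "\<And>g x. g \<in> carrier G \<Longrightarrow> x \<in> B \<Longrightarrow> \<sigma> g x \<in> B"
      "\<And>x. x \<in> B \<Longrightarrow> \<sigma> \<one>\<^bsub>G\<^esub> x = x"
      "\<And>g h x. g \<in> carrier G \<Longrightarrow> h \<in> carrier G \<Longrightarrow> x \<in> B \<Longrightarrow>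
      \<sigma> (g \<otimes>\<^bsub>G\<^esub> h) x = \<sigma> g (\<sigma> h x)"
    and A: "\<And>x. x \<in> B \<Longrightarrow> A x \<subseteq> C"
    and conj_A: "\<And>g x. g \<in> carrier G \<Longrightarrow> x \<in> B \<Longrightarrow> conj_by G g ` A x = A (\<sigma> g x)"
    and span: "stratum_span G C n = lin_span ((\<lambda>x. \<Sum>a\<in>A x.
        basis_form a :: 'g list \<Rightarrow>\<^sub>0 'k::field_char_0) ` B)"
    and indep: "\<And>c x. (\<forall>a\<in>C. (\<Sum>x\<in>B. if a \<in> A x then c x else (0::'k)) = 0) \<Longrightarrow> x \<in> B \<Longrightarrow> c x = 0"
    and count: "\<And>a. a \<in> C \<Longrightarrow> card {x \<in> B. a \<in> A x} = m" and m: "m > 0"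
  shows "\<exists>Q. perm_model G B \<sigma> (stratum_rep G C n :: ('g, 'k, ('g list \<Rightarrow>\<^sub>0 'k) set) rep) Q"
proof -
  interpret group G by fact
  let ?f = "\<lambda>x. \<Sum>a\<in>A x. basis_form a :: 'g list \<Rightarrow>\<^sub>0 'k"
  let ?T = "\<lambda>g. lin_ext (\<lambda>x. Poly_Mapping.single (map (conj_by G g) x) 1) :: ('g list \<Rightarrow>\<^sub>0 'k) \<Rightarrow> _"
  have finA: "finite (A x)" if "x \<in> B" for x using A[OF that] fin by (rule finite_subset)
  have coeff: "Poly_Mapping.lookup (?f x) [a] = (if a \<in> A x then 1 else 0)" if "x \<in> B" for x a
    using finA[OF that] by (simp add: lookup_sum basis_form_def lookup_single when_def)
  have inj: "inj_on (conj_by G g) (carrier G)" if "g \<in> carrier G" for g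
    using that by (auto intro!: inj_onI simp: conj_by_def)
  have T_f: "?T g (?f x) = ?f (\<sigma> g x)" if g: "g \<in> carrier G" and x: "x \<in> B" for g x
  proof -
    have "?T g (?f x) = (\<Sum>a\<in>A x. basis_form (conj_by G g a))"
      unfolding lin_ext_sum by (intro sum.cong) (simp_all add: basis_form_def)
    also have "\<dots> = (\<Sum>a\<in>conj_by G g ` A x. basis_form a)"
      using inj_on_subset[OF inj[OF g]] A[OF x] \<open>C \<subseteq> carrier G\<close> by (subst sum.reindex) auto
    finally show ?thesis using conj_A[OF g x] by simp
  qed
  have indep': "c x = 0" if "(\<Sum>x\<in>B. c x *\<^sub>k ?f x) = 0" "x \<in> B" for c x
  proof (rule indep[OF _ that(2)], rule ballI)
    fix a assume "a \<in> C"
    have "(\<Sum>x\<in>B. if a \<in> A x then c x else 0) = Poly_Mapping.lookup (\<Sum>x\<in>B. c x *\<^sub>k ?f x) [a]"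
      by (simp add: lookup_sum[of _ B] coeff if_distrib[of "\<lambda>k. _ * k"] cong: if_cong)
    then show "(\<Sum>x\<in>B. if a \<in> A x then c x else 0) = 0" using that(1) by simp
  qed
  have sum_f: "(\<Sum>x\<in>B. ?f x) = of_nat m *\<^sub>k theta C"
  proof -
    have "(\<Sum>x\<in>B. ?f x) = (\<Sum>x\<in>B. \<Sum>a\<in>C. if a \<in> A x then basis_form a else 0)"
    proof (rule sum.cong)
      fix x assume "x \<in> B"
      then have "C \<inter> A x = A x" using A by auto
      then show "?f x = (\<Sum>a\<in>C. if a \<in> A x then basis_form a else 0)"
        using fin by (simp add: sum.If_cases)
    qed simp
    also have "\<dots> = (\<Sum>a\<in>C. \<Sum>x\<in>B. if a \<in> A x then basis_form a else 0)"
      by (rule sum.swap)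
    also have "\<dots> = (\<Sum>a\<in>C. of_nat m *\<^sub>k basis_form a)"
    proof (rule sum.cong)
      fix a assume "a \<in> C"
      have "(\<Sum>x\<in>B. if a \<in> A x then basis_form a :: 'g list \<Rightarrow>\<^sub>0 'k else 0) = (\<Sum>x\<in>{x \<in> B. a \<in> A x}.
          basis_form a)"
        by (rule sum.inter_filter[OF \<open>finite B\<close>, symmetric])
      also have "\<dots> = of_nat m *\<^sub>k basis_form a"
        unfolding poly_vs.sum_constant_scale count[OF \<open>a \<in> C\<close>] ..
      finally show "(\<Sum>x\<in>B. if a \<in> A x then basis_form a :: 'g list \<Rightarrow>\<^sub>0 'k else 0)
          = of_nat m *\<^sub>k basis_form a" .
    qed simp
    finally show ?thesis by (simp add: theta_def poly_vs.scale_sum_right)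
  qed
  have U: "(one_forms_rep G C)\<lparr>carrier := stratum_span G C n\<rparr> =
     \<lparr>carrier = lin_span (?f ` B), monoid.mult = undefined, one = undefined, ring.zero = 0, add
         = (+),
      module.smult = scale, act = ?T\<rparr>"
    by (simp add: one_forms_rep_def perm_rep_def span)
  show ?thesis
    unfolding stratum_rep_def U
    by (rule exI, rule perm_model_quot_rep[where m = "of_nat m"];
        (rule \<open>group G\<close> \<open>finite B\<close> \<sigma> lin_ext_add lin_ext_scale T_f indep' sum_f; assumption)?)
      (use m in simp)
qed

text \<open>Modulo constants a function on two points is determined by the difference of its values,
  and swapping the points negates this difference. Thus the sign representation is the two-point
  case of the general construction.\<close>

lemma perm_model_sign_rep:
  "perm_model (sym_group n) (UNIV :: bool set) (\<lambda>p. if evenperm p then id else Not)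
    (sign_rep :: (nat \<Rightarrow> nat, 'k::field_char_0, 'k) rep) (\<lambda>c. c True - c False)"
proof -
  interpret group "sym_group n" by (rule sym_group_is_group)
  have perm: "permutation p" if "p \<in> carrier (sym_group n)" for p
    using that by (rule sym_group_carrier')
  show ?thesis
  proof
    show "carrier (sign_rep :: (nat \<Rightarrow> nat, 'k, 'k) rep) = range (\<lambda>c. c True - c False)"
      by (auto simp: sign_rep_def intro: range_eqI[of _ _ "\<lambda>b. if b then _ else 0"])
    show "(if evenperm (g \<otimes>\<^bsub>sym_group n\<^esub> h) then id else Not) x =
        (if evenperm g then id else Not) ((if evenperm h then id else Not) x)"
      if "g \<in> carrier (sym_group n)" "h \<in> carrier (sym_group n)" for g h x
      using that by (simp add: sym_group_mult evenperm_comp perm)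
    show "act (sign_rep :: (nat \<Rightarrow> nat, 'k, 'k) rep) g (c True - c False) =
       c ((if evenperm (inv\<^bsub>sym_group n\<^esub> g) then id else Not) True) -
       c ((if evenperm (inv\<^bsub>sym_group n\<^esub> g) then id else Not) False)"
      if g: "g \<in> carrier (sym_group n)" for g and c :: "bool \<Rightarrow> 'k"
    proof -
      have "inv\<^bsub>sym_group n\<^esub> g \<circ> g = id"
        using l_inv[OF g] by (simp add: sym_group_mult sym_group_one)
      then have "evenperm (inv\<^bsub>sym_group n\<^esub> g) = evenperm g"
        using evenperm_comp[OF perm[OF inv_closed[OF g]] perm[OF g]] by (simp add: evenperm_id)
      then show ?thesis by (simp add: sign_rep_def sign_def)
    qed
    show "c True - c False = d True - d False \<longleftrightarrow> (\<exists>k. \<forall>x\<in>UNIV. c x = d x + k)" for c d :: "bool \<Rightarrow> 'k"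
    proof
      assume "c True - c False = d True - d False"
      then have "c x = d x + (c False - d False)" for x by (cases x) (auto simp: algebra_simps)
      then show "\<exists>k. \<forall>x\<in>UNIV. c x = d x + k" by blast
    qed auto
  qed (auto simp: sign_rep_def sym_group_one evenperm_id algebra_simps)
qed

section \<open>Conjugacy in the symmetric group and cells\<close>

text \<open>One-line notation. Arguments start at 1 and list indices at 0, hence
  \<open>i - 1\<close>; the identity outside the range makes the result comparable with elements of
  \<open>sym_group\<close>.\<close>

definition list_perm :: "nat list \<Rightarrow> nat \<Rightarrow> nat"
  where "list_perm xs i = (if 1 \<le> i \<and> i \<le> length xs then xs ! (i - 1) else i)"

text \<open>\<open>g b g\<inverse>\<close> sends \<open>g i\<close> to \<open>g (b i)\<close>.\<close>

definition conj_list :: "nat list \<Rightarrow> nat list \<Rightarrow> nat list"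
  where "conj_list g b = map (\<lambda>j. the (map_of (zip g (map (list_perm g) b)) j)) [1..<Suc (length
      g)]"

lemma list_perm_nth: "i < length xs \<Longrightarrow> list_perm xs (Suc i) = xs ! i"
  by (simp add: list_perm_def)

lemma list_perm_outside: "i \<notin> {1..length xs} \<Longrightarrow> list_perm xs i = i"
  by (auto simp: list_perm_def)

lemma list_perm_eq_iff: "length xs = length ys \<Longrightarrow> list_perm xs = list_perm ys \<longleftrightarrow> xs = ys"
  by (metis list_perm_nth nth_equalityI)

lemma perm_length: "xs \<in> permutations_of_set {1..n} \<Longrightarrow> length xs = n"
  by (simp add: length_finite_permutations_of_set)

lemma list_perm_permutes:
  assumes xs: "xs \<in> permutations_of_set {1..n}" shows "list_perm xs permutes {1..n}"
proof (rule bij_imp_permutes)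
  note len = perm_length[OF xs]
  have eq: "list_perm xs ` {1..n} = {1..n}"
  proof -
    have "list_perm xs ` {1..n} = list_perm xs ` Suc ` {..<n}"
      by (simp add: image_Suc_lessThan)
    also have "\<dots> = set xs"
      using len by (auto simp: image_image list_perm_nth set_conv_nth image_iff)
    finally show ?thesis using xs by (simp add: permutations_of_set_def)
  qed
  then show "bij_betw (list_perm xs) {1..n} {1..n}"
    by (simp add: bij_betw_def eq_card_imp_inj_on)
  show "list_perm xs i = i" if "i \<notin> {1..n}" for i
    using that len by (simp add: list_perm_outside)
qed

lemma list_perm_map: "p permutes {1..n} \<Longrightarrow> list_perm (map p [1..<Suc n]) = p"
proof
  fix i assume p: "p permutes {1..n}"
  show "list_perm (map p [1..<Suc n]) i = p i"
    using permutes_not_in[OF p, of i]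
    by (cases "i \<in> {1..n}") (auto simp: list_perm_def simp del: upt_Suc)
qed

lemma map_permutes: "p permutes {1..n} \<Longrightarrow> map p [1..<Suc n] \<in> permutations_of_set {1..n}"
  using permutes_image[of p "{1..n}"] permutes_inj_on[of p "{1..n}"]
  by (auto simp: permutations_of_set_def distinct_map atLeastLessThanSuc_atLeastAtMost simp
      del: upt_Suc)

lemma list_perm_upt: "list_perm [1..<Suc n] = id"
  using list_perm_map[OF permutes_id, of n] by simp

lemma carrier_sym_group_eq: "carrier (sym_group n) = list_perm ` permutations_of_set {1..n}"
  using list_perm_map map_permutes list_perm_permutes
  by (auto simp: sym_group_carrier image_iff simp del: One_nat_def upt_Suc) (metis One_nat_def)

text \<open>A rearrangement of \<open>(g a g\<inverse>) g = g a\<close>. Evaluating at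
  \<open>g i\<close> removes the inverse from every later computation.\<close>

lemma conj_by_apply:
  assumes "g \<in> carrier (sym_group n)" "a \<in> carrier (sym_group n)"
  shows "conj_by (sym_group n) g a (g i) = g (a i)"
proof -
  interpret group "sym_group n" by (rule sym_group_is_group)
  have "conj_by (sym_group n) g a \<otimes>\<^bsub>sym_group n\<^esub> g = g \<otimes>\<^bsub>sym_group n\<^esub> a"
    unfolding conj_by_def by (simp only: m_assoc l_inv r_one assms m_closed inv_closed)
  then show ?thesis by (simp add: sym_group_mult fun_eq_iff)
qed

lemma conj_by_mult:
  assumes "group G" "g \<in> carrier G" "h \<in> carrier G" "a \<in> carrier G"
  shows "conj_by G (g \<otimes>\<^bsub>G\<^esub> h) a = conj_by G g (conj_by G h a)"
proof -
  interpret group G by fact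
  show ?thesis unfolding conj_by_def
    by (simp only: m_assoc inv_mult_group assms m_closed inv_closed)
qed

lemma conj_by_list_perm:
  assumes g: "g \<in> permutations_of_set {1..n}" and b: "b \<in> permutations_of_set {1..n}"
  shows "conj_by (sym_group n) (list_perm g) (list_perm b) = list_perm (conj_list g b)"
proof -
  interpret group "sym_group n" by (rule sym_group_is_group)
  have carr: "list_perm g \<in> carrier (sym_group n)" "list_perm b \<in> carrier (sym_group n)"
    using g b by (auto simp: carrier_sym_group_eq)
  let ?c = "conj_by (sym_group n) (list_perm g) (list_perm b)"
  note len = perm_length[OF g] perm_length[OF b]
  have c: "?c \<in> carrier (sym_group n)"
    unfolding conj_by_def by (intro m_closed inv_closed carr)
  have eq: "?c (list_perm g i) = list_perm g (list_perm b i)" for i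
    using carr by (rule conj_by_apply)
  show ?thesis
  proof
    fix j
    show "?c j = list_perm (conj_list g b) j"
    proof (cases "j \<in> {1..n}")
      case True
      then have "j \<in> set g" using g by (simp add: permutations_of_set_def)
      \<comment> \<open>Since \<open>j\<close> stands at index \<open>i\<close> of \<open>g\<close>,
        it is the image of \<open>Suc i\<close>; the association list in \<open>conj_list\<close>
        thus inverts \<open>g\<close> by searching.\<close>
      then obtain i where i: "i < length g" "g ! i = j" by (auto simp: in_set_conv_nth)
      have "map_of (zip g (map (list_perm g) b)) (g ! i) = Some (map (list_perm g) b ! i)"
        using g i(1) len by (intro map_of_zip_nth) (auto simp: permutations_of_set_def)
      moreover have "?c j = list_perm g (b ! i)"
        using eq[of "Suc i"] i len by (simp add: list_perm_nth)
      moreover have "list_perm (conj_list g b) j = the (map_of (zip g (map (list_perm g) b)) j)"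
        using True len by (auto simp: list_perm_def conj_list_def simp del: upt_Suc)
      ultimately show ?thesis using i len by simp
    next
      case False
      moreover have "length (conj_list g b) = n" using len by (simp add: conj_list_def)
      ultimately show ?thesis
        using permutes_not_in[of ?c "{1..n}" j] c list_perm_outside[of j "conj_list g b"]
        by (auto simp: sym_group_carrier)
    qed
  qed
qed

lemma conj_class_list_perm:
  assumes b: "b \<in> permutations_of_set {1..n}"
  shows "conj_class (sym_group n) (list_perm b) = list_perm ` (\<lambda>g.
      conj_list g b) ` permutations_of_set {1..n}"
proof -
  have "conj_class (sym_group n) (list_perm b) =
      (\<lambda>g. conj_by (sym_group n) (list_perm g) (list_perm b)) ` permutations_of_set {1..n}"
    unfolding conj_class_def carrier_sym_group_eq by auto
  then show ?thesis using b by (simp add: image_image conj_by_list_perm)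
qed

lemma nontrivial_conj_classes_sym_group:
  "nontrivial_conj_classes (sym_group n) =
    (\<lambda>b. list_perm ` (\<lambda>g. conj_list g b) ` permutations_of_set {1..n}) ` permutations_of_set
        {1..n} - {{id}}"
proof -
  have "{conj_class (sym_group n) a |a. a \<in> carrier (sym_group n)} =
      (\<lambda>b. conj_class (sym_group n) (list_perm b)) ` permutations_of_set {1..n}"
    unfolding carrier_sym_group_eq by auto
  also have "\<dots> = (\<lambda>b. list_perm ` (\<lambda>g. conj_list g b) ` permutations_of_set {1..n}) `
      permutations_of_set {1..n}"
    by (rule image_cong) (simp_all add: conj_class_list_perm)
  finally show ?thesis
    by (simp add: nontrivial_conj_classes_def sym_group_one)
qed

text \<open>The condition of \<open>flat_iff\<close> on one-line notations. With
  \<open>list_all\<close> it unfolds on a concrete list into a finite conjunction of implications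
  between coefficients.\<close>

definition flat_on :: "nat list list \<Rightarrow> (nat list \<Rightarrow> 'k::zero) \<Rightarrow> bool"
  where "flat_on L x \<longleftrightarrow> list_all (\<lambda>a. x a \<noteq> 0 \<longrightarrow> list_all (\<lambda>b. x (conj_list a b) = x b) L) L"

text \<open>\<open>p\<close> lists the disjoint blocks on which a flat coefficient function is constant and nonzero.\<close>

definition cell_on :: "nat list list \<Rightarrow> nat list list list \<Rightarrow> (nat list \<Rightarrow> 'k::zero) \<Rightarrow> bool"
  where "cell_on L p x \<longleftrightarrow> list_all (\<lambda>P. x (hd P) \<noteq> 0 \<and> list_all (\<lambda>a. x a = x (hd P)) P) p \<and>
    list_all (\<lambda>a. a \<in> set (concat p) \<or> x a = 0) L"

definition block_form :: "nat list list \<Rightarrow> ((nat \<Rightarrow> nat) list \<Rightarrow>\<^sub>0 'k::field_char_0)"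
  where "block_form P = (\<Sum>a\<leftarrow>P. basis_form (list_perm a))"

abbreviation cell_coeff :: "((nat \<Rightarrow> nat) list \<Rightarrow>\<^sub>0 'k::field_char_0) \<Rightarrow> nat list \<Rightarrow> 'k"
  where "cell_coeff \<phi> a \<equiv> coeff_form \<phi> (list_perm a)"

text \<open>All assumptions can be decided by evaluation for concrete lists. That \<open>cs\<close>
  really lists all flat coefficient functions involves the field and enters as the separate
  hypothesis \<open>flat\<close> of the lemmas below.\<close>

locale perm_class =
  fixes n :: nat and L :: "nat list list" and cs :: "nat list list list list"
  assumes distinct_L: "distinct L"
    and L_perms: "set L \<subseteq> permutations_of_set {1..n}"
    and L_closed: "\<And>g a. g \<in> permutations_of_set {1..n} \<Longrightarrow> a \<in> set L \<Longrightarrow> conj_list g a \<in> set L"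
    and cells: "list_all (\<lambda>p. [] \<notin> set p \<and> distinct (concat p) \<and> set (concat p) \<subseteq> set L) cs"
begin

definition C :: "(nat \<Rightarrow> nat) set" where "C = list_perm ` set L"

definition cell :: "nat list list list \<Rightarrow> ((nat \<Rightarrow> nat) list \<Rightarrow>\<^sub>0 'k::field_char_0) set"
  where "cell p = {\<phi> \<in> one_forms C. cell_on L p (cell_coeff \<phi>)}"

lemma finite_C: "finite C" by (simp add: C_def)

lemma C_carrier: "C \<subseteq> carrier (sym_group n)"
  using L_perms by (auto simp: C_def carrier_sym_group_eq)

lemma conj_C: "g \<in> carrier (sym_group n) \<Longrightarrow> a \<in> C \<Longrightarrow> conj_by (sym_group n) g a \<in> C"
  using L_closed L_perms by (auto simp: C_def carrier_sym_group_eq conj_by_list_perm subset_iff)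

lemma list_perm_eq: "a \<in> set L \<Longrightarrow> b \<in> set L \<Longrightarrow> list_perm a = list_perm b \<longleftrightarrow> a = b"
  using L_perms perm_length by (intro list_perm_eq_iff) (metis subsetD)

lemma inj_list_perm: "inj_on list_perm (set L)"
  by (auto intro: inj_onI simp: list_perm_eq)

lemma one_form_eqI:
  assumes "\<phi> \<in> one_forms C" "\<psi> \<in> one_forms C" "\<And>a. a \<in> set L \<Longrightarrow> cell_coeff \<phi> a = cell_coeff \<psi> a"
  shows "\<phi> = \<psi>"
proof -
  have "\<phi> = (\<Sum>a\<in>C. coeff_form \<phi> a *\<^sub>k basis_form a)"
    by (rule one_form_eq_sum[OF finite_C assms(1)])
  also have "\<dots> = (\<Sum>a\<in>C. coeff_form \<psi> a *\<^sub>k basis_form a)"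
    using assms(3) by (intro sum.cong) (auto simp: C_def)
  also have "\<dots> = \<psi>"
    by (rule one_form_eq_sum[OF finite_C assms(2), symmetric])
  finally show ?thesis .
qed

lemma block_form_eq: "distinct P \<Longrightarrow> block_form P = (\<Sum>a\<in>set P. basis_form (list_perm a))"
  by (simp add: block_form_def sum_list_distinct_conv_sum_set)

lemma block_form_one_form: "distinct P \<Longrightarrow> set P \<subseteq> set L \<Longrightarrow> block_form P \<in> one_forms C"
  unfolding block_form_eq by (intro tensor_deg_sum basis_form_one_form) (auto simp: C_def)

lemma coeff_block_form:
  assumes "distinct P" "set P \<subseteq> set L" "a \<in> set L"
  shows "cell_coeff (block_form P) a = (if a \<in> set P then 1 else 0)"
proof -
  have "cell_coeff (block_form P) a = (\<Sum>b\<in>set P. if b = a then 1 else 0)"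
    using assms by (auto simp: block_form_eq coeff_form_def lookup_sum basis_form_def
        lookup_single when_def
      list_perm_eq subset_iff intro!: sum.cong)
  then show ?thesis by simp
qed

text \<open>The blocks are nonempty and disjoint, so a form that is constant on each block has one
  free nonzero parameter per block, which can be read off at the head of the block.\<close>

lemma cell_eq:
  fixes p :: "nat list list list"
  assumes p: "p \<in> set cs"
  shows "(cell p :: ((nat \<Rightarrow> nat) list \<Rightarrow>\<^sub>0 'k::field_char_0) set) =
    {\<Sum>i<length p. \<kappa> i *\<^sub>k block_form (p ! i) | \<kappa>. \<forall>i<length p. \<kappa> i \<noteq> 0}"
proof (intro equalityI subsetI)
  have dist: "distinct (concat p)" and ne: "[] \<notin> set p" and sub: "set (concat p) \<subseteq> set L"
    using cells p by (auto simp: list_all_iff)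
  have block: "distinct (p ! i)" "set (p ! i) \<subseteq> set L" if "i < length p" for i
    using nth_mem[OF that] dist sub by (auto simp: distinct_concat_iff)
  have disj: "i = j" if "i < length p" "j < length p" "a \<in> set (p ! i)" "a \<in> set (p ! j)" for i j a
  proof (rule ccontr)
    assume "i \<noteq> j"
    \<comment> \<open>\<open>distinct_concat_iff\<close> states distinctness only for the list
      without empty blocks.\<close>
    moreover have "removeAll [] p = p" using ne by simp
    then have "distinct p" using dist by (simp add: distinct_concat_iff)
    ultimately have "p ! i \<noteq> p ! j" using that by (simp add: nth_eq_iff_index_eq)
    then have "set (p ! i) \<inter> set (p ! j) = {}"
      using dist that nth_mem by (simp add: distinct_concat_iff)
    then show False using that by auto
  qed
  \<comment> \<open>The premise on \<open>j\<close> is vacuous if \<open>a\<close> lies in no block;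
    \<open>length p\<close> then serves as a dummy index, and the value is 0.\<close>
  have coeff: "cell_coeff (\<Sum>i<length p. \<kappa> i *\<^sub>k block_form (p ! i)) a = (if j < length p \<and> a
      \<in> set (p ! j) then \<kappa> j else 0)"
    if "a \<in> set L" "a \<in> set (concat p) \<Longrightarrow> j < length p \<and> a \<in> set (p ! j)" for \<kappa> :: "nat \<Rightarrow> 'k" and a j
  proof -
    have "cell_coeff (\<Sum>i<length p. \<kappa> i *\<^sub>k block_form (p ! i)) a = (\<Sum>i<length p.
        \<kappa> i * cell_coeff (block_form (p ! i)) a)"
      by (simp add: coeff_form_def lookup_sum)
    also have "\<dots> = (\<Sum>i<length p. if i = j \<and> a \<in> set (p ! j) then \<kappa> j else 0)"
    proof (rule sum.cong)
      fix i assume i: "i \<in> {..<length p}"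
      have "a \<in> set (concat p)" if "a \<in> set (p ! i)"
        using that i by (auto intro: bexI[OF _ nth_mem])
      then have "a \<in> set (p ! i) \<longleftrightarrow> i = j \<and> a \<in> set (p ! j)"
        using that(2) disj[of i j a] i by blast
      then show "\<kappa> i * cell_coeff (block_form (p ! i)) a = (if i = j \<and> a
          \<in> set (p ! j) then \<kappa> j else 0)"
        using coeff_block_form[OF block[of i] \<open>a \<in> set L\<close>] i by auto
    qed simp
    also have "\<dots> = (if j < length p \<and> a \<in> set (p ! j) then \<kappa> j else 0)"
      by (cases "a \<in> set (p ! j)") auto
    finally show ?thesis .
  qed
  { fix \<phi> :: "(nat \<Rightarrow> nat) list \<Rightarrow>\<^sub>0 'k" assume "\<phi> \<in> cell p"
    then have \<phi>: "\<phi> \<in> one_forms C" and on: "cell_on L p (cell_coeff \<phi>)" by (auto simp: cell_def)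
    define \<kappa> where "\<kappa> i = cell_coeff \<phi> (hd (p ! i))" for i
    have "\<phi> = (\<Sum>i<length p. \<kappa> i *\<^sub>k block_form (p ! i))"
    proof (rule one_form_eqI[OF \<phi>])
      show "(\<Sum>i<length p. \<kappa> i *\<^sub>k block_form (p ! i)) \<in> one_forms C"
        by (auto intro!: tensor_deg_sum tensor_deg_scale block_form_one_form block simp
            del: One_nat_def)
      fix a assume a: "a \<in> set L"
      show "cell_coeff \<phi> a = cell_coeff (\<Sum>i<length p. \<kappa> i *\<^sub>k block_form (p ! i)) a"
      proof (cases "a \<in> set (concat p)")
        case True
        then obtain P where "P \<in> set p" "a \<in> set P" by auto
        then obtain j where j: "j < length p" "a \<in> set (p ! j)" by (metis in_set_conv_nth)
        then have "cell_coeff \<phi> a = \<kappa> j" using on by (auto simp: cell_on_def list_all_iff \<kappa>_def)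
        then show ?thesis using coeff[OF a, of j \<kappa>] j by simp
      next
        case False
        then show ?thesis using on a coeff[OF a, of "length p" \<kappa>]
            by (auto simp: cell_on_def list_all_iff)
      qed
    qed
    moreover have "\<kappa> i \<noteq> 0" if "i < length p" for i
      using on that by (auto simp: cell_on_def list_all_iff \<kappa>_def)
    ultimately show "\<phi> \<in> {\<Sum>i<length p. \<kappa> i *\<^sub>k block_form (p ! i) | \<kappa>. \<forall>i<length p. \<kappa> i \<noteq> 0}"
        by auto }
  { fix \<phi> :: "(nat \<Rightarrow> nat) list \<Rightarrow>\<^sub>0 'k"
    assume "\<phi> \<in> {\<Sum>i<length p. \<kappa> i *\<^sub>k block_form (p ! i) | \<kappa>. \<forall>i<length p. \<kappa> i \<noteq> 0}"
    then obtain \<kappa> where \<kappa>: "\<forall>i<length p. \<kappa> i \<noteq> 0" "\<phi> = (\<Sum>i<length p. \<kappa> i *\<^sub>k block_form (p ! i))"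
        by auto
    have "\<phi> \<in> one_forms C" unfolding \<kappa>
      by (auto intro!: tensor_deg_sum tensor_deg_scale block_form_one_form block simp
          del: One_nat_def)
    moreover have co: "cell_coeff \<phi> a = \<kappa> j" if "j < length p" "a \<in> set (p ! j)" for a j
      using coeff[of a j \<kappa>] that block(2)[of j] by (auto simp: \<kappa>(2))
    moreover have "cell_coeff \<phi> a = 0" if "a \<in> set L" "a \<notin> set (concat p)" for a
      using coeff[OF that(1), of "length p" \<kappa>] that(2) by (simp add: \<kappa>(2))
    moreover have "hd (p ! j) \<in> set (p ! j)" if "j < length p" for j
      using ne that by (metis hd_in_set nth_mem)
    ultimately show "\<phi> \<in> cell p" unfolding cell_def cell_on_def list_all_iff
      using \<kappa>(1) by (auto simp: in_set_conv_nth) (metis nth_mem)+ }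
qed

text \<open>On a cell the support is exactly the union of the blocks, so its cardinality is
  \<open>length (concat p)\<close>. The bound \<open>m \<ge> 1\<close> provides the nonzero
  coefficient that \<open>flat\<close> presupposes.\<close>

lemma flat_stratum_cells:
  assumes flat: "\<forall>x :: nat list \<Rightarrow> 'k::field_char_0. list_ex (\<lambda>a. x a \<noteq> 0) L \<longrightarrow>
    (flat_on L x \<longleftrightarrow> list_ex (\<lambda>p. cell_on L p x) cs)" and "m \<ge> 1"
  shows "(flat_stratum (sym_group n) C m :: ((nat \<Rightarrow> nat) list \<Rightarrow>\<^sub>0 'k) set) =
    (\<Union>p\<in>set (filter (\<lambda>p. length (concat p) = m) cs). cell p)"
proof -
  have closed: "conj_by (sym_group n) a b \<in> C" if "a \<in> C" "b \<in> C" for a b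
    using conj_C C_carrier that by auto
  have flat_on: "(\<forall>a\<in>C. \<forall>b\<in>C. coeff_form \<phi> a \<noteq> 0 \<longrightarrow>
      coeff_form \<phi> (conj_by (sym_group n) a b) = coeff_form \<phi> b) \<longleftrightarrow> flat_on L (cell_coeff \<phi>)"
    for \<phi> :: "(nat \<Rightarrow> nat) list \<Rightarrow>\<^sub>0 'k"
    using L_perms by (auto simp: C_def flat_on_def list_all_iff conj_by_list_perm subset_iff)
  have card: "card {a \<in> C. coeff_form \<phi> a \<noteq> 0} = card {a \<in> set L. cell_coeff \<phi> a \<noteq> 0}"
    for \<phi> :: "(nat \<Rightarrow> nat) list \<Rightarrow>\<^sub>0 'k"
  proof -
    have "{a \<in> C. coeff_form \<phi> a \<noteq> 0} = list_perm ` {a \<in> set L. cell_coeff \<phi> a \<noteq> 0}"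
      by (auto simp: C_def)
    then show ?thesis by (simp add: card_image inj_on_subset[OF inj_list_perm])
  qed
  have stratum: "(flat_stratum (sym_group n) C m :: ((nat \<Rightarrow> nat) list \<Rightarrow>\<^sub>0 'k) set) =
      {\<phi> \<in> one_forms C. flat_on L (cell_coeff \<phi>) \<and> card {a \<in> set L. cell_coeff \<phi> a \<noteq> 0} = m}"
    by (subst flat_stratum_eq[OF sym_group_is_group C_carrier closed finite_C]) (simp_all only:
        flat_on card)
  have cell_card: "card {a \<in> set L. cell_coeff \<phi> a \<noteq> 0} = length (concat p)"
    if p: "p \<in> set cs" and on: "cell_on L p (cell_coeff \<phi>)" for p and \<phi> :: "(nat \<Rightarrow> nat) list \<Rightarrow>\<^sub>0 'k"
  proof -
    have "distinct (concat p)" "set (concat p) \<subseteq> set L" using cells p by (auto simp: list_all_iff)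
    moreover have "{a \<in> set L. cell_coeff \<phi> a \<noteq> 0} = set (concat p)"
      using on calculation(2) by (auto simp: cell_on_def list_all_iff)
    ultimately show ?thesis by (metis distinct_card)
  qed
  have nz: "list_ex (\<lambda>a. cell_coeff \<phi> a \<noteq> 0) L" if "card {a \<in> set L. cell_coeff \<phi> a \<noteq> 0} = m"
    for \<phi> :: "(nat \<Rightarrow> nat) list \<Rightarrow>\<^sub>0 'k"
    using that \<open>m \<ge> 1\<close> by (auto simp: list_ex_iff card_gt_0_iff Suc_le_eq)
  show ?thesis
  proof (intro equalityI subsetI)
    fix \<phi> :: "(nat \<Rightarrow> nat) list \<Rightarrow>\<^sub>0 'k" assume "\<phi> \<in> flat_stratum (sym_group n) C m"
    then have *: "\<phi> \<in> one_forms C" "flat_on L (cell_coeff \<phi>)" "card {a \<in> set L.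
        cell_coeff \<phi> a \<noteq> 0} = m"
      by (simp_all only: stratum mem_Collect_eq)
    have "list_ex (\<lambda>p. cell_on L p (cell_coeff \<phi>)) cs"
      using flat[rule_format, OF nz[OF *(3)]] *(2) by simp
    then obtain p where "p \<in> set cs" "cell_on L p (cell_coeff \<phi>)" by (auto simp: list_ex_iff)
    with * cell_card show "\<phi> \<in> (\<Union>p\<in>set (filter (\<lambda>p. length (concat p) = m) cs). cell p)"
      by (auto simp: cell_def simp del: One_nat_def)
  next
    fix \<phi> :: "(nat \<Rightarrow> nat) list \<Rightarrow>\<^sub>0 'k"
    assume "\<phi> \<in> (\<Union>p\<in>set (filter (\<lambda>p. length (concat p) = m) cs). cell p)"
    then obtain p where p: "p \<in> set cs" "length (concat p) = m" "cell_on L p (cell_coeff \<phi>)" "\<phi>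
        \<in> one_forms C"
      by (auto simp: cell_def)
    then have c: "card {a \<in> set L. cell_coeff \<phi> a \<noteq> 0} = m" using cell_card by blast
    have "list_ex (\<lambda>p. cell_on L p (cell_coeff \<phi>)) cs" using p by (auto simp: list_ex_iff)
    then have "flat_on L (cell_coeff \<phi>)" using flat[rule_format, OF nz[OF c]] by simp
    with c p(4) show "\<phi> \<in> flat_stratum (sym_group n) C m" by (simp only: stratum mem_Collect_eq)
  qed
qed

text \<open>A block coefficient is nonzero, so among the values 0 and 1 it must be 1: each cell
  contains exactly one such form, the indicator of its support. Writing the result through the set
  of supports lets it be matched with a family indexed by points.\<close>

lemma stratum_span_cells:
  assumes flat: "\<forall>x :: nat list \<Rightarrow> 'k::field_char_0. list_ex (\<lambda>a. x a \<noteq> 0) L \<longrightarrow>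
    (flat_on L x \<longleftrightarrow> list_ex (\<lambda>p. cell_on L p x) cs)" and "m \<ge> 1"
  shows "(stratum_span (sym_group n) C m :: ((nat \<Rightarrow> nat) list \<Rightarrow>\<^sub>0 'k) set) =
    lin_span ((\<lambda>S. \<Sum>a\<in>S. basis_form (list_perm a)) `
      (\<lambda>p. set (concat p)) ` set (filter (\<lambda>p. length (concat p) = m) cs))"
proof -
  have zero_one: "{\<phi> \<in> cell p. \<forall>a\<in>C. coeff_form \<phi> a \<in> {0, 1::'k}} = {block_form (concat p)}"
    if p: "p \<in> set cs" for p
  proof -
    have cp: "distinct (concat p)" "set (concat p) \<subseteq> set L" and ne: "[] \<notin> set p"
      using cells p by (auto simp: list_all_iff)
    note bf = block_form_one_form[OF cp] coeff_block_form[OF cp]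
    show ?thesis
    proof (intro equalityI subsetI)
      fix \<phi> :: "(nat \<Rightarrow> nat) list \<Rightarrow>\<^sub>0 'k"
      assume "\<phi> \<in> {\<phi> \<in> cell p. \<forall>a\<in>C. coeff_form \<phi> a \<in> {0, 1}}"
      then have \<phi>: "\<phi> \<in> one_forms C" and on: "cell_on L p (cell_coeff \<phi>)"
        and 01: "\<And>a. a \<in> set L \<Longrightarrow> cell_coeff \<phi> a \<in> {0, 1}" by (auto simp: cell_def C_def)
      have "\<phi> = block_form (concat p)"
      proof (rule one_form_eqI[OF \<phi> bf(1)])
        fix a assume "a \<in> set L"
        then show "cell_coeff \<phi> a = cell_coeff (block_form (concat p)) a"
          using on 01[of a] by (auto simp: bf cell_on_def list_all_iff)
      qed
      then show "\<phi> \<in> {block_form (concat p)}" by simp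
    next
      fix \<phi> :: "(nat \<Rightarrow> nat) list \<Rightarrow>\<^sub>0 'k" assume "\<phi> \<in> {block_form (concat p)}"
      moreover have "a \<in> set L" if "P \<in> set p" "a \<in> set P" for P a
        using that cp(2) by auto
      moreover have "hd P \<in> set L \<and> (\<exists>P'\<in>set p. hd P \<in> set P')" if "P \<in> set p" for P
      proof -
        have "hd P \<in> set P" using that ne by (metis hd_in_set)
        then show ?thesis using that cp(2) by auto
      qed
      ultimately show "\<phi> \<in> {\<phi> \<in> cell p. \<forall>a\<in>C. coeff_form \<phi> a \<in> {0, 1}}"
        using bf(1) cp(2) by (auto simp: bf(2) cell_def cell_on_def list_all_iff C_def subset_iff)
    qed
  qed
  have "\<phi> \<in> cell p \<and> (\<forall>a\<in>C. coeff_form \<phi> a \<in> {0, 1}) \<longleftrightarrow> \<phi> = block_form (concat p)"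
    if "p \<in> set cs" for p and \<phi> :: "(nat \<Rightarrow> nat) list \<Rightarrow>\<^sub>0 'k"
    using zero_one[OF that] by blast
  then have "{\<phi> \<in> flat_stratum (sym_group n) C m. \<forall>a\<in>C. coeff_form \<phi> a \<in> {0, 1::'k}} =
      (\<lambda>p. block_form (concat p)) ` set (filter (\<lambda>p. length (concat p) = m) cs)"
    unfolding flat_stratum_cells[OF assms] by (auto simp del: insert_iff)
  also have "\<dots> = (\<lambda>S. \<Sum>a\<in>S. basis_form (list_perm a)) `
      (\<lambda>p. set (concat p)) ` set (filter (\<lambda>p. length (concat p) = m) cs)"
    unfolding image_image using cells
    by (intro image_cong refl block_form_eq) (auto simp: list_all_iff)
  finally show ?thesis unfolding stratum_span_def by simp
qed

lemma id_neq_C: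
  assumes "[1..<Suc n] \<notin> set L" shows "{id} \<noteq> C"
proof
  assume "{id} = C"
  then have "id \<in> list_perm ` set L" unfolding C_def by blast
  then obtain a where a: "a \<in> set L" "list_perm a = id" by (metis imageE)
  moreover have "length a = n" using a(1) L_perms perm_length by blast
  ultimately have "a = [1..<Suc n]"
    using list_perm_eq_iff[of a "[1..<Suc n]"] list_perm_upt[of n] by simp
  then show False using a(1) assms by simp
qed

end

section \<open>The representations of the strata\<close>

lemma perm_model_facts:
  assumes V: "perm_model G B \<sigma> V Q" and W: "perm_model G B \<sigma> W Q'"
    and "card B = Suc d" "d \<ge> 1"
    and swaps: "\<And>x y. x \<in> B \<Longrightarrow> y \<in> B \<Longrightarrow> x \<noteq> y \<Longrightarrow>
      \<exists>g\<in>carrier G. \<forall>z\<in>B. \<sigma> g z = Transposition.transpose x y z"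
  shows "rep_iso G V W \<and> irreducible_rep G V \<and> has_dim V d"
proof -
  have "B \<noteq> {}" using assms(3) by auto
  then show ?thesis
    using perm_model_iso[OF V W] perm_model.irreducible_V[OF V _ swaps] perm_model.has_dim_V[OF V]
        assms(3,4)
    by auto
qed

context perm_class
begin

text \<open>\<open>R\<close> is the incidence between class elements and points. By
  \<open>sets\<close> the supports of the cells of size \<open>m\<close> are the sets of elements
  incident with one point, and equivariance of \<open>R\<close> makes conjugation permute these
  supports as \<open>\<sigma>\<close> permutes the points.\<close>

lemma stratum_model:
  fixes R :: "(nat \<Rightarrow> nat) \<Rightarrow> 'x \<Rightarrow> bool" and B :: "'x set"
  assumes flat: "\<forall>x :: nat list \<Rightarrow> 'k::field_char_0. list_ex (\<lambda>a. x a \<noteq> 0) L \<longrightarrow>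
    (flat_on L x \<longleftrightarrow> list_ex (\<lambda>p. cell_on L p x) cs)" and "m \<ge> 1"
    and "finite B"
    and \<sigma>: "\<And>g x. g \<in> carrier (sym_group n) \<Longrightarrow> x \<in> B \<Longrightarrow> \<sigma> g x \<in> B"
      "\<And>x. x \<in> B \<Longrightarrow> \<sigma> id x = x"
      "\<And>g h x. g \<in> carrier (sym_group n) \<Longrightarrow> h \<in> carrier (sym_group n) \<Longrightarrow> x \<in> B \<Longrightarrow>
        \<sigma> (g \<circ> h) x = \<sigma> g (\<sigma> h x)"
    and R: "\<And>g a x. g \<in> carrier (sym_group n) \<Longrightarrow> a \<in> C \<Longrightarrow> x \<in> B \<Longrightarrow>
      R (conj_by (sym_group n) g a) (\<sigma> g x) \<longleftrightarrow> R a x"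
    and sets: "(\<lambda>x. set (filter (\<lambda>a. R (list_perm a) x) L)) ` B =
      (\<lambda>p. set (concat p)) ` set (filter (\<lambda>p. length (concat p) = m) cs)"
    and count: "\<And>a. a \<in> set L \<Longrightarrow> card {x \<in> B. R (list_perm a) x} = k" and "k > 0"
    and indep: "\<And>c :: 'x \<Rightarrow> 'k. (\<forall>a\<in>set L. (\<Sum>x\<in>B. if R (list_perm a) x then c x else 0) = 0)
        \<Longrightarrow> \<forall>x\<in>B. c x = 0"
  shows "\<exists>Q. perm_model (sym_group n) B \<sigma>
    (stratum_rep (sym_group n) C m :: (nat \<Rightarrow> nat, 'k, ((nat \<Rightarrow> nat) list \<Rightarrow>\<^sub>0 'k) set) rep) Q"
proof (rule perm_model_stratum_rep[where A = "\<lambda>x. {a \<in> C. R a x}" and m = k])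
  interpret group "sym_group n" by (rule sym_group_is_group)
  show "group (sym_group n)" by (rule sym_group_is_group)
  show "conj_by (sym_group n) g ` {a \<in> C. R a x} = {a \<in> C. R a (\<sigma> g x)}"
    if g: "g \<in> carrier (sym_group n)" and x: "x \<in> B" for g x
  proof (intro equalityI subsetI)
    fix b assume b: "b \<in> {a \<in> C. R a (\<sigma> g x)}"
    \<comment> \<open>Equivariance directly gives only one inclusion; conjugating back by the
      inverse supplies preimages for the other.\<close>
    let ?a = "conj_by (sym_group n) (inv\<^bsub>sym_group n\<^esub> g) b"
    have a: "?a \<in> C" using b g by (intro conj_C inv_closed) auto
    have "conj_by (sym_group n) g ?a = conj_by (sym_group n) \<one>\<^bsub>sym_group n\<^esub> b"
      using b g C_carrier by (subst conj_by_mult[symmetric]) (auto simp del: sym_group_inv_equality)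
    also have "\<dots> = b" using b C_carrier unfolding conj_by_def by (auto simp
        del: sym_group_inv_equality)
    finally have "b = conj_by (sym_group n) g ?a" ..
    moreover have "R ?a x" using R[OF g a x] calculation b by simp
    ultimately show "b \<in> conj_by (sym_group n) g ` {a \<in> C. R a x}" using a by blast
  qed (use R g x conj_C in auto)
  show "stratum_span (sym_group n) C m = lin_span ((\<lambda>x. \<Sum>a\<in>{a \<in> C. R a x}.
      basis_form a :: (nat \<Rightarrow> nat) list \<Rightarrow>\<^sub>0 'k) ` B)"
  proof -
    have "(\<Sum>a\<in>{a \<in> C. R a x}. basis_form a :: (nat \<Rightarrow> nat) list \<Rightarrow>\<^sub>0 'k) =
        (\<Sum>a\<in>set (filter (\<lambda>a. R (list_perm a) x) L). basis_form (list_perm a))" for x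
      by (rule sum.reindex_cong[of list_perm]) (auto simp: C_def intro: inj_on_subset[OF
          inj_list_perm])
    then show ?thesis
      unfolding stratum_span_cells[OF flat \<open>m \<ge> 1\<close>] sets[symmetric] by (simp add: image_image)
  qed
  show "card {x \<in> B. a \<in> {a \<in> C. R a x}} = k" if "a \<in> C" for a
    using that count by (auto simp: C_def)
  show "c x = 0" if "\<forall>a\<in>C. (\<Sum>x\<in>B. if a \<in> {a \<in> C. R a x} then c x else 0) = 0" "x \<in> B"
      for c :: "'x \<Rightarrow> 'k" and x
  proof -
    have "\<forall>a\<in>set L. (\<Sum>x\<in>B. if R (list_perm a) x then c x else 0) = 0"
      using that(1) by (auto simp: C_def)
    then show ?thesis using indep that(2) by blast
  qed
qed (use assms in \<open>auto simp: finite_C C_carrier[THEN subsetD] sym_group_one sym_group_mult\<close>)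

end

section \<open>Points, pairings and parity as index sets\<close>

lemma transpose_carrier:
  "i \<in> {1..n} \<Longrightarrow> j \<in> {1..n} \<Longrightarrow> Transposition.transpose i j \<in> carrier (sym_group n)"
  by (simp add: sym_group_carrier permutes_swap_id)

lemma fund_model: "\<exists>Q. perm_model (sym_group n) {1..n} (\<lambda>p. p)
  (fund_rep n :: (nat \<Rightarrow> nat, 'k::field_char_0, _) rep) Q"
  unfolding fund_rep_def
  by (rule perm_model_reduced_perm_rep)
    (auto simp: sym_group_is_group sym_group_one sym_group_mult sym_group_carrier dest:
        permutes_in_image)

abbreviation pairings :: "nat set set set"
  where "pairings \<equiv> {{{1, 2}, {3, 4}}, {{1, 3}, {2, 4}}, {{1, 4}, {2, 3}}}"

text \<open>Every permutation of \<open>{1..4}\<close> is a product of transpositions, and for a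
  transposition all cases can be listed.\<close>

lemma image_pairings:
  assumes "p \<in> carrier (sym_group 4)" "P \<in> pairings" shows "(`) ((`) p) P \<in> pairings"
proof -
  have transp: "(`) ((`) (Transposition.transpose i j)) P \<in> pairings"
    if "i \<in> {1..4}" "j \<in> {1..4}" "P \<in> pairings" for i j :: nat and P
  proof -
    have "{1..4::nat} = {1, 2, 3, 4}" by auto
    then have "i = 1 \<or> i = 2 \<or> i = 3 \<or> i = 4" "j = 1 \<or> j = 2 \<or> j = 3 \<or> j = 4"
      using that(1,2) by auto
    with that(3) show ?thesis
      by (elim disjE insertE emptyE; simp add: Transposition.transpose_def doubleton_eq_iff)
  qed
  have "p permutes {1..4}" using assms(1) by (simp add: sym_group_carrier)
  from this finite_atLeastAtMost have "\<forall>P\<in>pairings. (`) ((`) p) P \<in> pairings"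
  proof (induction rule: permutes_induct)
    case (swap i j p)
    have "(`) ((`) (Transposition.transpose i j \<circ> p)) P
        = (`) ((`) (Transposition.transpose i j)) ((`) ((`) p) P)" for P
      by (simp add: image_image image_comp)
    then show ?case
      by (intro ballI, simp only:) (rule transp[OF swap(1,2)], erule bspec[OF swap.IH])
  qed simp
  then show ?thesis using assms(2) by (rule bspec)
qed

text \<open>The action on the three pairings is onto their symmetric group: (23), (24) and (12) each
  exchange two pairings and fix the third.\<close>

lemma swap_pairings:
  assumes "P \<in> pairings" "P' \<in> pairings"
  shows "\<exists>p\<in>carrier (sym_group 4). \<forall>Z\<in>pairings. (`) ((`) p) Z = Transposition.transpose P P' Z"
proof -
  let ?G = "carrier (sym_group 4)"
  have t: "id \<in> ?G" "Transposition.transpose 2 3 \<in> ?G" "Transposition.transpose 2 4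
      \<in> ?G" "Transposition.transpose 1 2 \<in> ?G"
    by (auto intro!: permutes_swap_id simp: sym_group_carrier permutes_id)
  let ?A = "{{1, 2}, {3, 4}} :: nat set set" and ?B = "{{1, 3}, {2, 4}} :: nat set set"
    and ?C = "{{1, 4}, {2, 3}} :: nat set set"
  let ?P = "\<lambda>P P'. \<exists>p\<in>?G. \<forall>Z\<in>pairings. (`) ((`) p) Z = Transposition.transpose P P' Z"
  have "?A \<noteq> ?B" "?A \<noteq> ?C" "?B \<noteq> ?C" by (simp_all add: doubleton_eq_iff)
  then have "?P ?A ?B" "?P ?A ?C" "?P ?B ?C"
    using t by (intro bexI[of _ "Transposition.transpose 2 3"] bexI[of _ "Transposition.transpose
        2 4"]
      bexI[of _ "Transposition.transpose 1 2"]; simp add: Transposition.transpose_def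
          insert_commute)+
  moreover have "?P P P" for P
    using t(1) by (intro bexI[of _ id]) auto
  moreover have "?P P P' \<Longrightarrow> ?P P' P" for P P' by (simp only: transpose_commute)
  ultimately show ?thesis using assms by (elim insertE emptyE) (simp_all only:)
qed

lemma card_pairings: "card pairings = 3"
  by code_simp

lemma two_model: "\<exists>Q. perm_model (sym_group 4) pairings (\<lambda>p. (`) ((`) p))
  (two_rep :: (nat \<Rightarrow> nat, 'k::field_char_0, _) rep) Q"
  unfolding two_rep_def
proof (rule perm_model_reduced_perm_rep)
  show "(`) ((`) g) P \<in> pairings" if "g \<in> carrier (sym_group 4)" "P \<in> pairings" for g P
    using that by (rule image_pairings)
qed (auto simp: sym_group_is_group sym_group_one sym_group_mult image_comp[symmetric] image_image)

context perm_class
begin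

text \<open>Incidence means that \<open>a\<close> fixes \<open>i\<close>, so the support at
  \<open>i\<close> consists of the class elements in the stabiliser of \<open>i\<close>. Conjugation
  by \<open>g\<close> carries the stabiliser of \<open>i\<close> to that of
  \<open>g i\<close>.\<close>

lemma stratum_fund:
  assumes flat: "\<forall>x :: nat list \<Rightarrow> 'k::field_char_0. list_ex (\<lambda>a. x a \<noteq> 0) L \<longrightarrow>
    (flat_on L x \<longleftrightarrow> list_ex (\<lambda>p. cell_on L p x) cs)" and "m \<ge> 1" and "n = Suc d" "d \<ge> 1"
    and sets: "(\<lambda>i. set (filter (\<lambda>a. list_perm a i = i) L)) ` {1..n} =
      (\<lambda>p. set (concat p)) ` set (filter (\<lambda>p. length (concat p) = m) cs)"
    and count: "\<forall>a\<in>set L. card {i \<in> {1..n}. list_perm a i = i} = k" and "k > 0"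
    and indep: "\<And>c :: nat \<Rightarrow> 'k. (\<forall>a\<in>set L. (\<Sum>i=1..n. if list_perm a i = i then c i else 0) = 0)
        \<Longrightarrow> \<forall>i\<in>{1..n}. c i = 0"
  shows "rep_iso (sym_group n) (stratum_rep (sym_group n) C m :: (nat \<Rightarrow> nat, 'k,
      _) rep) (fund_rep n) \<and>
    irreducible_rep (sym_group n) (stratum_rep (sym_group n) C m :: (nat \<Rightarrow> nat, 'k, _) rep) \<and>
    has_dim (stratum_rep (sym_group n) C m :: (nat \<Rightarrow> nat, 'k, _) rep) d"
proof -
  have "\<exists>Q. perm_model (sym_group n) {1..n} (\<lambda>p. p) (stratum_rep (sym_group n) C m :: (nat \<Rightarrow> nat,
      'k, _) rep) Q"
  proof (rule stratum_model[where R = "\<lambda>a i. a i = i" and k = k, OF flat \<open>m \<ge> 1\<close>])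
    show "conj_by (sym_group n) g a (g i) = g i \<longleftrightarrow> a i = i"
      if "g \<in> carrier (sym_group n)" "a \<in> C" for g a i
      using that C_carrier permutes_inj[of g "{1..n}"]
      by (auto simp: conj_by_apply subset_iff sym_group_carrier[of g] inj_eq)
  qed (use assms count in \<open>auto simp: sym_group_carrier dest: permutes_in_image\<close>)
  then show ?thesis
    using fund_model[of n] \<open>d \<ge> 1\<close> \<open>n = Suc d\<close> transpose_carrier
    by (elim exE, intro perm_model_facts) auto
qed

text \<open>The incidence \<open>R\<close> stays a parameter because the classes need different
  ones: an element may preserve a pairing as a whole, or move one of its blocks.\<close>

lemma stratum_two:
  assumes flat: "\<forall>x :: nat list \<Rightarrow> 'k::field_char_0. list_ex (\<lambda>a. x a \<noteq> 0) L \<longrightarrow>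
    (flat_on L x \<longleftrightarrow> list_ex (\<lambda>p. cell_on L p x) cs)" and "m \<ge> 1" and "n = 4"
    and R: "\<And>g a P. g \<in> carrier (sym_group n) \<Longrightarrow> a \<in> C \<Longrightarrow> P \<in> pairings \<Longrightarrow>
      R (conj_by (sym_group n) g a) ((`) ((`) g) P) \<longleftrightarrow> R a P"
    and sets: "(\<lambda>P. set (filter (\<lambda>a. R (list_perm a) P) L)) ` pairings =
      (\<lambda>p. set (concat p)) ` set (filter (\<lambda>p. length (concat p) = m) cs)"
    and count: "\<forall>a\<in>set L. card {P \<in> pairings. R (list_perm a) P} = k" and "k > 0"
    and indep: "\<And>c :: nat set set \<Rightarrow> 'k. (\<forall>a\<in>set L. (\<Sum>P\<in>pairings.
        if R (list_perm a) P then c P else 0) = 0) \<Longrightarrow>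
      \<forall>P\<in>pairings. c P = 0"
  shows "rep_iso (sym_group n) (stratum_rep (sym_group n) C m :: (nat \<Rightarrow> nat, 'k, _) rep) two_rep \<and>
    irreducible_rep (sym_group n) (stratum_rep (sym_group n) C m :: (nat \<Rightarrow> nat, 'k, _) rep) \<and>
    has_dim (stratum_rep (sym_group n) C m :: (nat \<Rightarrow> nat, 'k, _) rep) 2"
proof -
  have "\<exists>Q. perm_model (sym_group n) pairings (\<lambda>p.
      (`) ((`) p)) (stratum_rep (sym_group n) C m :: (nat \<Rightarrow> nat, 'k, _) rep) Q"
  proof (rule stratum_model[where R = R and k = k, OF flat \<open>m \<ge> 1\<close> _ _ _ _ R sets])
    show "(`) ((`) g) P \<in> pairings" if "g \<in> carrier (sym_group n)" "P \<in> pairings" for g P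
      using that unfolding \<open>n = 4\<close> by (rule image_pairings)
  qed (use \<open>k > 0\<close> count indep in \<open>simp_all add: image_image\<close>)
  then obtain Q where Q: "perm_model (sym_group n) pairings (\<lambda>p.
      (`) ((`) p)) (stratum_rep (sym_group n) C m :: (nat \<Rightarrow> nat, 'k, _) rep) Q" ..
  obtain Q' where Q': "perm_model (sym_group n) pairings (\<lambda>p. (`) ((`) p)) (two_rep :: (nat \<Rightarrow> nat,
      'k, _) rep) Q'"
    using two_model unfolding \<open>n = 4\<close> ..
  show ?thesis
  proof (rule perm_model_facts[OF Q Q'])
    show "\<exists>g\<in>carrier (sym_group n). \<forall>Z\<in>pairings. (`) ((`) g) Z = Transposition.transpose P P' Z"
      if "P \<in> pairings" "P' \<in> pairings" for P P'
      using swap_pairings[OF that] unfolding \<open>n = 4\<close> .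
    show "card pairings = Suc 2" unfolding card_pairings by simp
  qed simp
qed

text \<open>The two supports are \<open>K\<close> and its complement in the class, named by the
  booleans. Evaluation checks only that transpositions exchange them; induction over products of
  transpositions turns this into the parity rule.\<close>

lemma stratum_sign:
  assumes flat: "\<forall>x :: nat list \<Rightarrow> 'k::field_char_0. list_ex (\<lambda>a. x a \<noteq> 0) L \<longrightarrow>
    (flat_on L x \<longleftrightarrow> list_ex (\<lambda>p. cell_on L p x) cs)" and "m \<ge> 1" and "n \<ge> 2"
    and sets: "{set (filter (\<lambda>a. a \<in> set K) L), set (filter (\<lambda>a. a \<notin> set K) L)} =
      (\<lambda>p. set (concat p)) ` set (filter (\<lambda>p. length (concat p) = m) cs)"
    and odd: "\<forall>i\<in>{1..n}. \<forall>j\<in>{1..n}. i = j \<or> (\<forall>a\<in>set L.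
      conj_list (map (Transposition.transpose i j) [1..<Suc n]) a \<in> set K \<longleftrightarrow> a \<notin> set K)"
    and ne: "\<exists>a\<in>set L. a \<in> set K" "\<exists>a\<in>set L. a \<notin> set K"
    and K: "set K \<subseteq> set L"
  shows "rep_iso (sym_group n) (stratum_rep (sym_group n) C m :: (nat \<Rightarrow> nat, 'k, _) rep) sign_rep \<and>
    irreducible_rep (sym_group n) (stratum_rep (sym_group n) C m :: (nat \<Rightarrow> nat, 'k, _) rep) \<and>
    has_dim (stratum_rep (sym_group n) C m :: (nat \<Rightarrow> nat, 'k, _) rep) 1"
proof -
  let ?\<sigma> = "\<lambda>p. if evenperm p then id else Not"
  let ?R = "\<lambda>a x. a \<in> list_perm ` set K \<longleftrightarrow> x"
  have perm: "permutation p" if "p \<in> carrier (sym_group n)" for p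
    using that by (rule sym_group_carrier')
  have mem: "list_perm a \<in> list_perm ` set K \<longleftrightarrow> a \<in> set K" if "a \<in> set L" for a
    using that K by (auto simp: list_perm_eq subset_iff)
  have flip: "conj_by (sym_group n) (Transposition.transpose i j) a \<in> list_perm ` set K
      \<longleftrightarrow> a \<notin> list_perm ` set K"
    if ij: "i \<in> {1..n}" "j \<in> {1..n}" "i \<noteq> j" and a: "a \<in> C" for i j a
  proof -
    let ?t = "map (Transposition.transpose i j) [1..<Suc n]"
    have t: "Transposition.transpose i j permutes {1..n}" using ij by (intro permutes_swap_id)
    obtain b where b: "b \<in> set L" "a = list_perm b" using a by (auto simp: C_def)
    have "conj_by (sym_group n) (Transposition.transpose i j) a = list_perm (conj_list ?t b)"
      using conj_by_list_perm[OF map_permutes[OF t], of b, unfolded list_perm_map[OF t]] b L_perms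
          by blast
    moreover have "conj_list ?t b \<in> set L" using L_closed[OF map_permutes[OF t] b(1)] .
    ultimately show ?thesis using odd ij b mem by (metis (no_types, lifting))
  qed
  have R: "?R (conj_by (sym_group n) g a) (?\<sigma> g x) \<longleftrightarrow> ?R a x"
    if "g \<in> carrier (sym_group n)" "a \<in> C" for g a x
  proof -
    interpret group "sym_group n" by (rule sym_group_is_group)
    define E where "E g \<longleftrightarrow> (\<forall>a\<in>C. \<forall>x. ?R (conj_by (sym_group n) g a) (?\<sigma> g x) \<longleftrightarrow> ?R a x)" for g
    have "g permutes {1..n}" using that(1) by (simp add: sym_group_carrier)
    from this finite_atLeastAtMost have "E g"
    proof (rule permutes_induct)
      have "conj_by (sym_group n) id a = a" if "a \<in> C" for a
        using conj_by_apply[of id n a] that C_carrier one_closed by (auto simp: sym_group_one)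
      then show "E id" by (simp add: E_def evenperm_id)
    next
      fix i j p assume ij: "i \<in> {1..n}" "j \<in> {1..n}" "i \<noteq> j" and Ep: "E p" and "p permutes {1..n}"
      let ?t = "Transposition.transpose i j"
      have t: "?t \<in> carrier (sym_group n)" and p: "p \<in> carrier (sym_group n)"
        using ij \<open>p permutes {1..n}\<close> transpose_carrier by (simp_all only: sym_group_carrier)
      have "evenperm (?t \<circ> p) \<longleftrightarrow> \<not> evenperm p"
        using evenperm_comp[OF perm[OF t] perm[OF p]] ij(3) by (simp add: evenperm_swap)
      moreover have "conj_by (sym_group n) (?t \<circ> p) a
          = conj_by (sym_group n) ?t (conj_by (sym_group n) p a)"
        if "a \<in> C" for a
        using conj_by_mult[OF sym_group_is_group t p, of a] that C_carrier
            by (auto simp: sym_group_mult)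
      ultimately show "E (?t \<circ> p)"
        using Ep conj_C[OF p] flip[OF ij] unfolding E_def by (auto split: if_splits)
    qed
    then show ?thesis using that(2) by (simp add: E_def)
  qed
  have "\<exists>Q. perm_model (sym_group n) (UNIV :: bool set) ?\<sigma> (stratum_rep (sym_group n) C m :: (nat
      \<Rightarrow> nat, 'k, _) rep) Q"
  proof (rule stratum_model[where R = ?R and k = 1, OF flat \<open>m \<ge> 1\<close> _ _ _ _ R])
    have "set (filter (\<lambda>a. ?R (list_perm a) x) L) = set (filter (\<lambda>a. a \<in> set K \<longleftrightarrow> x) L)" for x
      using mem by auto
    then show "(\<lambda>x. set (filter (\<lambda>a. ?R (list_perm a) x) L)) ` UNIV =
      (\<lambda>p. set (concat p)) ` set (filter (\<lambda>p. length (concat p) = m) cs)"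
      using sets by (simp add: UNIV_bool insert_commute)
    show "\<forall>x\<in>UNIV. c x = 0"
      if "\<forall>a\<in>set L. (\<Sum>x\<in>UNIV. if ?R (list_perm a) x then c x else 0) = 0" for c :: "bool \<Rightarrow> 'k"
    proof -
      \<comment> \<open>Each \<open>a\<close> lies in exactly one of the two supports, so its
        equation has a single term.\<close>
      have "c (a \<in> set K) = 0" if a: "a \<in> set L" for a
        using \<open>\<forall>a\<in>set L. _ = 0\<close>[THEN bspec, OF a] mem[OF a]
            by (cases "a \<in> set K") (auto simp: UNIV_bool)
      then have "c True = 0" "c False = 0" using ne by fastforce+
      then show ?thesis by (metis (full_types))
    qed
    show "card {x \<in> UNIV. ?R (list_perm a) x} = 1" if "a \<in> set L" for a
      by (simp add: Collect_conv_if)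
  qed (auto simp: evenperm_id evenperm_comp perm)
  then obtain Q where Q: "perm_model (sym_group n) (UNIV :: bool set) ?\<sigma> (stratum_rep (sym_group
      n) C m :: (nat \<Rightarrow> nat, 'k, _) rep) Q" ..
  have swaps: "\<exists>g\<in>carrier (sym_group n). \<forall>z\<in>UNIV. ?\<sigma> g z = Transposition.transpose x y z"
      if "x \<noteq> y" for x y
  proof (rule bexI)
    \<comment> \<open>One odd permutation suffices, since \<open>bool\<close> has only one
      nontrivial swap; \<open>n \<ge> 2\<close> provides it.\<close>
    show "Transposition.transpose 1 2 \<in> carrier (sym_group n)" using \<open>n \<ge> 2\<close>
        by (intro transpose_carrier) auto
    show "\<forall>z\<in>UNIV. ?\<sigma> (Transposition.transpose 1 (2::nat)) z = Transposition.transpose x y z"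
      using that by (auto simp: evenperm_swap Transposition.transpose_def)
  qed
  show ?thesis
    by (rule perm_model_facts[OF Q perm_model_sign_rep _ _ swaps]) auto
qed

end

text \<open>When the supports partition the class, every row of the incidence matrix has one nonzero
  entry, and the equation of \<open>a\<close> isolates one coefficient. By \<open>ne\<close> every
  coefficient is isolated by some row.\<close>

lemma indep_of_card_1:
  fixes c :: "'x \<Rightarrow> 'k::field_char_0"
  assumes "finite B" and count: "\<forall>a\<in>A. card {x \<in> B. R a x} = 1" and ne: "\<forall>x\<in>B. \<exists>a\<in>A. R a x"
    and eq: "\<forall>a\<in>A. (\<Sum>x\<in>B. if R a x then c x else 0) = 0"
  shows "\<forall>x\<in>B. c x = 0"
proof
  fix x assume x: "x \<in> B"
  then obtain a where a: "a \<in> A" "R a x" using ne by blast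
  then have "card {x \<in> B. R a x} = 1" using count by blast
  then obtain y where "{x \<in> B. R a x} = {y}" by (auto simp: card_1_singleton_iff)
  moreover have "x \<in> {x \<in> B. R a x}" using x a by simp
  ultimately have "{x \<in> B. R a x} = {x}" by simp
  then have "(\<Sum>x\<in>B. if R a x then c x else 0) = c x"
    using \<open>finite B\<close> by (simp add: sum.inter_filter[symmetric])
  then show "c x = 0" using eq a by simp
qed

section \<open>Scaling of families, cells with few blocks, and cycle notation\<close>

lemma up_to_scale_Un: "up_to_scale (A \<union> B) = up_to_scale A \<union> up_to_scale B"
  by (auto simp: up_to_scale_def)

text \<open>The second \<open>insert\<close> makes the rule stop at singletons, so it can be used
  for rewriting.\<close>

lemma up_to_scale_insert: "up_to_scale (insert \<phi> (insert \<psi> A)) = up_to_scale {\<phi>}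
    \<union> up_to_scale (insert \<psi> A)"
  by (auto simp: up_to_scale_def)

lemma up_to_scale_UN: "up_to_scale A = (\<Union>\<phi>\<in>A. up_to_scale {\<phi>})"
  by (auto simp: up_to_scale_def)

text \<open>A cycle with entries in \<open>{1..n}\<close> fixes everything else, so finitely many
  values determine it, and the equality of functions becomes a goal for evaluation.\<close>

lemma cycle_of_list_eq:
  assumes "set c \<subseteq> {1..n}" "map (cycle_of_list c) [1..<Suc n] = xs"
  shows "cycle_of_list c = list_perm xs"
  using list_perm_map[OF permutes_subset[OF cycle_permutes assms(1)]] assms(2) by simp

lemma cycles_comp_eq:
  assumes "set c \<subseteq> {1..n}" "set d \<subseteq> {1..n}"
    and "map (cycle_of_list c \<circ> cycle_of_list d) [1..<Suc n] = xs"
  shows "cycle_of_list c \<circ> cycle_of_list d = list_perm xs"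
  using list_perm_map[OF permutes_compose[OF permutes_subset[OF cycle_permutes assms(2)]
      permutes_subset[OF cycle_permutes assms(1)]]] assms(3) by simp

context perm_class
begin

text \<open>With a single block, the block coefficient is the overall scale.\<close>

lemma cell_1:
  assumes "[S] \<in> set cs" shows "cell [S] = up_to_scale {block_form S :: _ \<Rightarrow>\<^sub>0 'k::field_char_0}"
  unfolding cell_eq[OF assms] up_to_scale_def
proof (intro equalityI subsetI)
  fix \<phi> :: "(nat \<Rightarrow> nat) list \<Rightarrow>\<^sub>0 'k" assume "\<phi> \<in> {c *\<^sub>k \<phi> |c \<phi>. c \<noteq> 0 \<and> \<phi> \<in> {block_form S}}"
  then obtain c where "c \<noteq> 0" "\<phi> = c *\<^sub>k block_form S" by auto
  then show "\<phi> \<in> {\<Sum>i<length [S]. \<kappa> i *\<^sub>k block_form ([S] ! i) |\<kappa>. \<forall>i<length [S]. \<kappa> i \<noteq> 0}"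
    by (intro CollectI exI[of _ "\<lambda>_. c"]) simp
qed auto

text \<open>Independent nonzero coefficients absorb an overall nonzero scale: one inclusion uses
  scale 1, the other multiplies the scale into the coefficients.\<close>

lemma cell_2:
  assumes "[S, T] \<in> set cs"
  shows "cell [S, T] = up_to_scale {\<kappa> *\<^sub>k block_form S + \<mu> *\<^sub>k block_form T :: _ \<Rightarrow>\<^sub>0
      'k::field_char_0 | \<kappa> \<mu>.
    \<kappa> \<noteq> 0 \<and> \<mu> \<noteq> 0}"
  unfolding cell_eq[OF assms] up_to_scale_def
proof (intro equalityI subsetI)
  let ?F = "{\<kappa> *\<^sub>k block_form S + \<mu> *\<^sub>k block_form T :: _ \<Rightarrow>\<^sub>0 'k | \<kappa> \<mu>. \<kappa> \<noteq> 0 \<and> \<mu> \<noteq> 0}"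
  fix \<phi> :: "(nat \<Rightarrow> nat) list \<Rightarrow>\<^sub>0 'k"
  { assume "\<phi> \<in> {\<Sum>i<length [S, T]. \<kappa> i *\<^sub>k block_form ([S, T] ! i) |\<kappa>. \<forall>i<length [S, T]. \<kappa> i \<noteq> 0}"
    then obtain \<kappa> :: "nat \<Rightarrow> 'k" where "\<phi> = \<kappa> 0 *\<^sub>k block_form S + \<kappa> 1 *\<^sub>k block_form T" "\<kappa> 0 \<noteq> 0"
        "\<kappa> 1 \<noteq> 0"
      by (auto simp: less_Suc_eq)
    then have "\<phi> \<in> ?F" by blast
    then show "\<phi> \<in> {c *\<^sub>k \<phi> |c \<phi>. c \<noteq> 0 \<and> \<phi> \<in> ?F}"
      by (intro CollectI exI[of _ 1] exI[of _ \<phi>]) simp }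
  { assume "\<phi> \<in> {c *\<^sub>k \<phi> |c \<phi>. c \<noteq> 0 \<and> \<phi> \<in> ?F}"
    then obtain c \<kappa> \<mu> where "c \<noteq> 0" "\<kappa> \<noteq> 0" "\<mu> \<noteq> 0" "\<phi>
        = c *\<^sub>k (\<kappa> *\<^sub>k block_form S + \<mu> *\<^sub>k block_form T)"
      by blast
    then show "\<phi> \<in> {\<Sum>i<length [S, T]. \<kappa> i *\<^sub>k block_form ([S, T] ! i) |\<kappa>. \<forall>i<length [S, T].
        \<kappa> i \<noteq> 0}"
      by (intro CollectI exI[of _ "\<lambda>i. c * (if i = 0 then \<kappa> else \<mu>)"])
        (simp add: poly_vs.scale_right_distrib) }
qed

lemma cell_3:
  assumes "[S, T, U] \<in> set cs"
  shows "cell [S, T, U] = up_to_scale {\<kappa> *\<^sub>k block_form S + \<mu> *\<^sub>k block_form T + \<nu> *\<^sub>k block_form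
      U :: _ \<Rightarrow>\<^sub>0 'k::field_char_0 |
    \<kappa> \<mu> \<nu>. \<kappa> \<noteq> 0 \<and> \<mu> \<noteq> 0 \<and> \<nu> \<noteq> 0}"
  unfolding cell_eq[OF assms] up_to_scale_def
proof (intro equalityI subsetI)
  let ?F = "{\<kappa> *\<^sub>k block_form S + \<mu> *\<^sub>k block_form T + \<nu> *\<^sub>k block_form U :: _ \<Rightarrow>\<^sub>0 'k |
    \<kappa> \<mu> \<nu>. \<kappa> \<noteq> 0 \<and> \<mu> \<noteq> 0 \<and> \<nu> \<noteq> 0}"
  fix \<phi> :: "(nat \<Rightarrow> nat) list \<Rightarrow>\<^sub>0 'k"
  { assume "\<phi> \<in> {\<Sum>i<length [S, T, U]. \<kappa> i *\<^sub>k block_form ([S, T, U] ! i) |\<kappa>. \<forall>i<length [S, T, U].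
      \<kappa> i \<noteq> 0}"
    then obtain \<kappa> :: "nat \<Rightarrow> 'k" where "\<phi> = \<kappa> 0 *\<^sub>k block_form S + \<kappa> 1 *\<^sub>k block_form T + \<kappa> 2 *\<^sub>k
        block_form U"
      "\<kappa> 0 \<noteq> 0" "\<kappa> 1 \<noteq> 0" "\<kappa> 2 \<noteq> 0"
      by (auto simp: less_Suc_eq numeral_2_eq_2)
    then have "\<phi> \<in> ?F" by blast
    then show "\<phi> \<in> {c *\<^sub>k \<phi> |c \<phi>. c \<noteq> 0 \<and> \<phi> \<in> ?F}"
      by (intro CollectI exI[of _ 1] exI[of _ \<phi>]) simp }
  { assume "\<phi> \<in> {c *\<^sub>k \<phi> |c \<phi>. c \<noteq> 0 \<and> \<phi> \<in> ?F}"
    then obtain c \<kappa> \<mu> \<nu> where "c \<noteq> 0" "\<kappa> \<noteq> 0" "\<mu> \<noteq> 0" "\<nu> \<noteq> 0"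
      "\<phi> = c *\<^sub>k (\<kappa> *\<^sub>k block_form S + \<mu> *\<^sub>k block_form T + \<nu> *\<^sub>k block_form U)"
      by blast
    then show "\<phi> \<in> {\<Sum>i<length [S, T, U]. \<kappa> i *\<^sub>k block_form ([S, T, U] ! i) |\<kappa>. \<forall>i<length [S, T,
        U]. \<kappa> i \<noteq> 0}"
      by (intro CollectI exI[of _ "\<lambda>i. c * (if i = 0 then \<kappa> else if i = 1 then \<mu> else \<nu>)"])
        (simp add: poly_vs.scale_right_distrib) }
qed

lemma theta_C: "theta C = block_form L"
  using distinct_L by (simp add: theta_def C_def block_form_eq sum.reindex[OF inj_list_perm])

lemma basis_forms_C:
  assumes "\<forall>a\<in>set L. [[a]] \<in> set cs"
  shows "(\<Union>a\<in>set L. cell [[a]]) = up_to_scale {basis_form a :: _ \<Rightarrow>\<^sub>0 'k::field_char_0 |a. a \<in> C}"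
proof -
  have "(\<Union>a\<in>set L. cell [[a]]) = (\<Union>a\<in>set L. up_to_scale {basis_form (list_perm a) :: _ \<Rightarrow>\<^sub>0 'k})"
    using assms by (simp add: cell_1 block_form_def)
  also have "\<dots> = (\<Union>\<phi>\<in>{basis_form a |a. a \<in> C}. up_to_scale {\<phi>})"
    by (auto simp: C_def)
  finally show ?thesis by (simp only: up_to_scale_UN[symmetric])
qed

end

lemma cycles_3:
  "cycle_of_list [1, 2] = list_perm [2, 1, 3]"
  "cycle_of_list [1, 3] = list_perm [3, 2, 1]"
  "cycle_of_list [2, 3] = list_perm [1, 3, 2]"
  "cycle_of_list [1, 2, 3] = list_perm [2, 3, 1]"
  "cycle_of_list [1, 3, 2] = list_perm [3, 1, 2]"
  by (rule cycle_of_list_eq[where n = 3]; code_simp)+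

lemma cycles_4:
  "cycle_of_list [1, 2] = list_perm [2, 1, 3, 4]"
  "cycle_of_list [1, 3] = list_perm [3, 2, 1, 4]"
  "cycle_of_list [1, 4] = list_perm [4, 2, 3, 1]"
  "cycle_of_list [2, 1] = list_perm [2, 1, 3, 4]"
  "cycle_of_list [2, 3] = list_perm [1, 3, 2, 4]"
  "cycle_of_list [2, 4] = list_perm [1, 4, 3, 2]"
  "cycle_of_list [3, 1] = list_perm [3, 2, 1, 4]"
  "cycle_of_list [3, 2] = list_perm [1, 3, 2, 4]"
  "cycle_of_list [3, 4] = list_perm [1, 2, 4, 3]"
  "cycle_of_list [4, 1] = list_perm [4, 2, 3, 1]"
  "cycle_of_list [4, 2] = list_perm [1, 4, 3, 2]"
  "cycle_of_list [4, 3] = list_perm [1, 2, 4, 3]"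
  "cycle_of_list [1, 2, 3] = list_perm [2, 3, 1, 4]"
  "cycle_of_list [1, 4, 2] = list_perm [4, 1, 3, 2]"
  "cycle_of_list [1, 3, 4] = list_perm [3, 2, 4, 1]"
  "cycle_of_list [2, 4, 3] = list_perm [1, 4, 2, 3]"
  "cycle_of_list [1, 3, 2] = list_perm [3, 1, 2, 4]"
  "cycle_of_list [1, 2, 4] = list_perm [2, 4, 3, 1]"
  "cycle_of_list [1, 4, 3] = list_perm [4, 2, 1, 3]"
  "cycle_of_list [2, 3, 4] = list_perm [1, 3, 4, 2]"
  "cycle_of_list [1, 2, 3, 4] = list_perm [2, 3, 4, 1]"
  "cycle_of_list [1, 2, 4, 3] = list_perm [2, 4, 1, 3]"
  "cycle_of_list [1, 3, 2, 4] = list_perm [3, 4, 2, 1]"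
  "cycle_of_list [1, 3, 4, 2] = list_perm [3, 1, 4, 2]"
  "cycle_of_list [1, 4, 2, 3] = list_perm [4, 3, 1, 2]"
  "cycle_of_list [1, 4, 3, 2] = list_perm [4, 1, 2, 3]"
  by (rule cycle_of_list_eq[where n = 4]; code_simp)+

lemma double_transpositions:
  "cycle_of_list [1, 2] \<circ> cycle_of_list [3, 4] = list_perm [2, 1, 4, 3]"
  "cycle_of_list [1, 3] \<circ> cycle_of_list [2, 4] = list_perm [3, 4, 1, 2]"
  "cycle_of_list [1, 4] \<circ> cycle_of_list [2, 3] = list_perm [4, 3, 2, 1]"
  by (rule cycles_comp_eq[where n = 4]; code_simp)+

section \<open>The conjugacy classes of \<open>S\<^sub>3\<close> and \<open>S\<^sub>4\<close>\<close>

text \<open>The classification of the flat coefficient functions on a concrete class is a finite case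
  analysis over the conjugation table. The equations between coefficients loop as rewrite rules,
  hence \<open>no_asm_use\<close>.\<close>

lemmas cell_simps = flat_on_def cell_on_def list_all_Cons_iff list_all_Nil_iff
  list_ex_Cons_iff list_ex_Nil_iff simp_thms

text \<open>The transpositions (12), (13), (23) in this order.\<close>

definition transp_3 :: "nat list list"
  where "transp_3 = [[2, 1, 3], [3, 2, 1], [1, 3, 2]]"

definition transp_3_cells :: "nat list list list list"
  where "transp_3_cells =
    [[[[2, 1, 3], [3, 2, 1], [1, 3, 2]]],
     [[[1, 3, 2]]],
     [[[3, 2, 1]]],
     [[[2, 1, 3]]]]"

interpretation transp_3: perm_class 3 transp_3 transp_3_cells
proof
  show "set transp_3 \<subseteq> permutations_of_set {1..3}" by code_simp
  \<comment> \<open>Stated with bounded quantifiers, closure under conjugation is a finite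
    evaluation.\<close>
  have "\<forall>g\<in>permutations_of_set {1..3}. \<forall>a\<in>set transp_3. conj_list g a \<in> set transp_3" by code_simp
  then show "conj_list g a \<in> set transp_3" if "g \<in> permutations_of_set {1..3}" "a \<in> set transp_3"
      for g a
    using that by blast
qed code_simp+

lemma conj_class_transp_3: "conj_class (sym_group 3) (cycle_of_list [1, 2]) = transp_3.C"
proof -
  have "[2, 1, 3] \<in> permutations_of_set {1..3::nat}" by code_simp
  moreover have "(\<lambda>g. conj_list g [2, 1, 3]) ` permutations_of_set {1..3} = set transp_3"
      by code_simp
  ultimately show ?thesis by (simp only: cycles_3(1) conj_class_list_perm transp_3.C_def)
qed

text \<open>Row \<open>a\<close> and column \<open>b\<close> hold \<open>a b a\<inverse>\<close>.
  Splitting the list equation into its entries gives rewrite rules for \<open>conj_list\<close>, so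
  the case analysis that follows is about coefficients alone.\<close>

lemma transp_3_table: "map (\<lambda>a. map (conj_list a) [[2, 1, 3], [3, 2, 1], [1, 3, 2]]) [[2, 1, 3],
    [3, 2, 1], [1, 3, 2]] =
    [[[2, 1, 3], [1, 3, 2], [3, 2, 1]], [[1, 3, 2], [3, 2, 1], [2, 1, 3]], [[3, 2, 1], [2, 1, 3],
        [1, 3, 2]]]"
  by code_simp

text \<open>A nonzero coefficient at one transposition forces the other two coefficients to agree;
  with two nonzero coefficients all three coincide.\<close>

lemma transp_3_flat: "\<forall>x :: nat list \<Rightarrow> 'k::field_char_0. list_ex (\<lambda>a. x a \<noteq> 0) transp_3 \<longrightarrow>
    (flat_on transp_3 x \<longleftrightarrow> list_ex (\<lambda>p. cell_on transp_3 p x) transp_3_cells)"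
  unfolding transp_3_def transp_3_cells_def
  by (simp (no_asm_use) only: cell_simps transp_3_table[simplified list.map list.inject simp_thms],
      simp (no_asm_use) del: One_nat_def, smt (verit))

definition rot_3 :: "nat list list"
  where "rot_3 = [[2, 3, 1], [3, 1, 2]]"

definition rot_3_cells :: "nat list list list list"
  where "rot_3_cells =
    [[[[2, 3, 1]], [[3, 1, 2]]],
     [[[2, 3, 1]]],
     [[[3, 1, 2]]]]"

interpretation rot_3: perm_class 3 rot_3 rot_3_cells
proof
  show "set rot_3 \<subseteq> permutations_of_set {1..3}" by code_simp
  have "\<forall>g\<in>permutations_of_set {1..3}. \<forall>a\<in>set rot_3. conj_list g a \<in> set rot_3" by code_simp
  then show "conj_list g a \<in> set rot_3" if "g \<in> permutations_of_set {1..3}" "a \<in> set rot_3" for g a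
    using that by blast
qed code_simp+

lemma conj_class_rot_3: "conj_class (sym_group 3) (cycle_of_list [1, 2, 3]) = rot_3.C"
proof -
  have "[2, 3, 1] \<in> permutations_of_set {1..3::nat}" by code_simp
  moreover have "(\<lambda>g. conj_list g [2, 3, 1]) ` permutations_of_set {1..3} = set rot_3" by code_simp
  ultimately show ?thesis by (simp only: cycles_3(4) conj_class_list_perm rot_3.C_def)
qed

lemma rot_3_table: "map (\<lambda>a. map (conj_list a) [[2, 3, 1], [3, 1, 2]]) [[2, 3, 1], [3, 1, 2]] =
    [[[2, 3, 1], [3, 1, 2]], [[2, 3, 1], [3, 1, 2]]]"
  by code_simp

text \<open>The two elements commute, so conjugation within the class is trivial and every choice of
  coefficients is flat.\<close>

lemma rot_3_flat: "\<forall>x :: nat list \<Rightarrow> 'k::field_char_0. list_ex (\<lambda>a. x a \<noteq> 0) rot_3 \<longrightarrow>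
    (flat_on rot_3 x \<longleftrightarrow> list_ex (\<lambda>p. cell_on rot_3 p x) rot_3_cells)"
  unfolding rot_3_def rot_3_cells_def
  by (simp (no_asm_use) only: cell_simps rot_3_table[simplified list.map list.inject simp_thms],
      simp (no_asm_use) del: One_nat_def, auto)

definition transp_4 :: "nat list list"
  where "transp_4 = [[2, 1, 3, 4], [3, 2, 1, 4], [4, 2, 3, 1], [1, 3, 2, 4], [1, 4, 3, 2],
      [1, 2, 4, 3]]"

text \<open>After the full class come the triples of transpositions fixing 1, 2, 3, 4, then the
  three commuting pairs, whose two coefficients are independent, and the singletons.\<close>

definition transp_4_cells :: "nat list list list list"
  where "transp_4_cells =
    [[[[2, 1, 3, 4], [3, 2, 1, 4], [4, 2, 3, 1], [1, 3, 2, 4], [1, 4, 3, 2], [1, 2, 4, 3]]],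
     [[[1, 3, 2, 4], [1, 4, 3, 2], [1, 2, 4, 3]]],
     [[[3, 2, 1, 4], [4, 2, 3, 1], [1, 2, 4, 3]]],
     [[[2, 1, 3, 4], [4, 2, 3, 1], [1, 4, 3, 2]]],
     [[[2, 1, 3, 4], [3, 2, 1, 4], [1, 3, 2, 4]]],
     [[[4, 2, 3, 1]], [[1, 3, 2, 4]]],
     [[[3, 2, 1, 4]], [[1, 4, 3, 2]]],
     [[[2, 1, 3, 4]], [[1, 2, 4, 3]]],
     [[[2, 1, 3, 4]]],
     [[[3, 2, 1, 4]]],
     [[[4, 2, 3, 1]]],
     [[[1, 3, 2, 4]]],
     [[[1, 4, 3, 2]]],
     [[[1, 2, 4, 3]]]]"

interpretation transp_4: perm_class 4 transp_4 transp_4_cells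
proof
  show "set transp_4 \<subseteq> permutations_of_set {1..4}" by code_simp
  have "\<forall>g\<in>permutations_of_set {1..4}. \<forall>a\<in>set transp_4. conj_list g a \<in> set transp_4" by code_simp
  then show "conj_list g a \<in> set transp_4" if "g \<in> permutations_of_set {1..4}" "a \<in> set transp_4"
      for g a
    using that by blast
qed code_simp+

lemma conj_class_transp_4: "conj_class (sym_group 4) (cycle_of_list [1, 2]) = transp_4.C"
proof -
  have "[2, 1, 3, 4] \<in> permutations_of_set {1..4::nat}" by code_simp
  moreover have "(\<lambda>g. conj_list g [2, 1, 3, 4]) ` permutations_of_set {1..4} = set transp_4"
      by code_simp
  ultimately show ?thesis by (simp only: cycles_4(1) conj_class_list_perm transp_4.C_def)
qed

lemma transp_4_table: "map (\<lambda>a. map (conj_list a) [[2, 1, 3, 4], [3, 2, 1, 4], [4, 2, 3, 1],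
    [1, 3, 2, 4], [1, 4, 3, 2], [1, 2, 4, 3]]) [[2, 1, 3, 4], [3, 2, 1, 4], [4, 2, 3, 1],
    [1, 3, 2, 4], [1, 4, 3, 2], [1, 2, 4, 3]] =
    [[[2, 1, 3, 4], [1, 3, 2, 4], [1, 4, 3, 2], [3, 2, 1, 4], [4, 2, 3, 1], [1, 2, 4, 3]],
        [[1, 3, 2, 4], [3, 2, 1, 4], [1, 2, 4, 3], [2, 1, 3, 4], [1, 4, 3, 2], [4, 2, 3, 1]],
        [[1, 4, 3, 2], [1, 2, 4, 3], [4, 2, 3, 1], [1, 3, 2, 4], [2, 1, 3, 4], [3, 2, 1, 4]],
        [[3, 2, 1, 4], [2, 1, 3, 4], [4, 2, 3, 1], [1, 3, 2, 4], [1, 2, 4, 3], [1, 4, 3, 2]],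
        [[4, 2, 3, 1], [3, 2, 1, 4], [2, 1, 3, 4], [1, 2, 4, 3], [1, 4, 3, 2], [1, 3, 2, 4]],
        [[2, 1, 3, 4], [4, 2, 3, 1], [3, 2, 1, 4], [1, 4, 3, 2], [1, 3, 2, 4], [1, 2, 4, 3]]]"
  by code_simp

text \<open>The support is a graph on \<open>{1..4}\<close>. Two edges with a common vertex force
  the third side of the triangle, with equal coefficients, so the components are complete: the
  possibilities are the complete graph, one triangle, two disjoint edges or one edge.\<close>

lemma transp_4_flat: "\<forall>x :: nat list \<Rightarrow> 'k::field_char_0. list_ex (\<lambda>a. x a \<noteq> 0) transp_4 \<longrightarrow>
    (flat_on transp_4 x \<longleftrightarrow> list_ex (\<lambda>p. cell_on transp_4 p x) transp_4_cells)"
  unfolding transp_4_def transp_4_cells_def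
  by (simp (no_asm_use) only: cell_simps transp_4_table[simplified list.map list.inject simp_thms],
      simp (no_asm_use) del: One_nat_def, smt (verit))

definition double_4 :: "nat list list"
  where "double_4 = [[2, 1, 4, 3], [3, 4, 1, 2], [4, 3, 2, 1]]"

definition double_4_cells :: "nat list list list list"
  where "double_4_cells =
    [[[[2, 1, 4, 3]], [[3, 4, 1, 2]], [[4, 3, 2, 1]]],
     [[[2, 1, 4, 3]], [[3, 4, 1, 2]]],
     [[[3, 4, 1, 2]], [[4, 3, 2, 1]]],
     [[[2, 1, 4, 3]], [[4, 3, 2, 1]]],
     [[[2, 1, 4, 3]]],
     [[[3, 4, 1, 2]]],
     [[[4, 3, 2, 1]]]]"

interpretation double_4: perm_class 4 double_4 double_4_cells
proof
  show "set double_4 \<subseteq> permutations_of_set {1..4}" by code_simp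
  have "\<forall>g\<in>permutations_of_set {1..4}. \<forall>a\<in>set double_4. conj_list g a \<in> set double_4" by code_simp
  then show "conj_list g a \<in> set double_4" if "g \<in> permutations_of_set {1..4}" "a \<in> set double_4"
      for g a
    using that by blast
qed code_simp+

lemma conj_class_double_4: "conj_class (sym_group 4) (cycle_of_list [1, 2] \<circ> cycle_of_list [3, 4])
    = double_4.C"
proof -
  have "[2, 1, 4, 3] \<in> permutations_of_set {1..4::nat}" by code_simp
  moreover have "(\<lambda>g. conj_list g [2, 1, 4, 3]) ` permutations_of_set {1..4} = set double_4"
      by code_simp
  ultimately show ?thesis by (simp only: double_transpositions(1) conj_class_list_perm
      double_4.C_def)
qed

lemma double_4_table: "map (\<lambda>a. map (conj_list a) [[2, 1, 4, 3], [3, 4, 1, 2],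
    [4, 3, 2, 1]]) [[2, 1, 4, 3], [3, 4, 1, 2], [4, 3, 2, 1]] =
    [[[2, 1, 4, 3], [3, 4, 1, 2], [4, 3, 2, 1]], [[2, 1, 4, 3], [3, 4, 1, 2], [4, 3, 2, 1]],
        [[2, 1, 4, 3], [3, 4, 1, 2], [4, 3, 2, 1]]]"
  by code_simp

text \<open>The double transpositions lie in the abelian Klein four-group, so every nonempty support
  occurs, with free coefficients.\<close>

lemma double_4_flat: "\<forall>x :: nat list \<Rightarrow> 'k::field_char_0. list_ex (\<lambda>a. x a \<noteq> 0) double_4 \<longrightarrow>
    (flat_on double_4 x \<longleftrightarrow> list_ex (\<lambda>p. cell_on double_4 p x) double_4_cells)"
  unfolding double_4_def double_4_cells_def
  by (simp (no_asm_use) only: cell_simps double_4_table[simplified list.map list.inject simp_thms],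
      simp (no_asm_use) del: One_nat_def, auto)

definition three_4 :: "nat list list"
  \<comment> \<open>The first four entries, (123), (142), (134), (243), form one conjugacy class of
    \<open>A4\<close>; the last four are their inverses in the same order and form the
    other.\<close>
  where "three_4 = [[2, 3, 1, 4], [4, 1, 3, 2], [3, 2, 4, 1], [1, 4, 2, 3], [3, 1, 2, 4],
      [2, 4, 3, 1], [4, 2, 1, 3], [1, 3, 4, 2]]"

definition three_4_cells :: "nat list list list list"
  where "three_4_cells =
    [[[[2, 3, 1, 4], [4, 1, 3, 2], [3, 2, 4, 1], [1, 4, 2, 3]], [[3, 1, 2, 4], [2, 4, 3, 1],
        [4, 2, 1, 3], [1, 3, 4, 2]]],
     [[[2, 3, 1, 4], [4, 1, 3, 2], [3, 2, 4, 1], [1, 4, 2, 3]]],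
     [[[3, 1, 2, 4], [2, 4, 3, 1], [4, 2, 1, 3], [1, 3, 4, 2]]],
     [[[2, 3, 1, 4]], [[3, 1, 2, 4]]],
     [[[4, 1, 3, 2]], [[2, 4, 3, 1]]],
     [[[3, 2, 4, 1]], [[4, 2, 1, 3]]],
     [[[1, 4, 2, 3]], [[1, 3, 4, 2]]],
     [[[2, 3, 1, 4]]],
     [[[4, 1, 3, 2]]],
     [[[3, 2, 4, 1]]],
     [[[1, 4, 2, 3]]],
     [[[3, 1, 2, 4]]],
     [[[2, 4, 3, 1]]],
     [[[4, 2, 1, 3]]],
     [[[1, 3, 4, 2]]]]"

interpretation three_4: perm_class 4 three_4 three_4_cells
proof
  show "set three_4 \<subseteq> permutations_of_set {1..4}" by code_simp
  have "\<forall>g\<in>permutations_of_set {1..4}. \<forall>a\<in>set three_4. conj_list g a \<in> set three_4" by code_simp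
  then show "conj_list g a \<in> set three_4" if "g \<in> permutations_of_set {1..4}" "a \<in> set three_4"
      for g a
    using that by blast
qed code_simp+

lemma conj_class_three_4: "conj_class (sym_group 4) (cycle_of_list [1, 2, 3]) = three_4.C"
proof -
  have "[2, 3, 1, 4] \<in> permutations_of_set {1..4::nat}" by code_simp
  moreover have "(\<lambda>g. conj_list g [2, 3, 1, 4]) ` permutations_of_set {1..4} = set three_4"
      by code_simp
  ultimately show ?thesis by (simp only: cycles_4(13) conj_class_list_perm three_4.C_def)
qed

lemma three_4_table: "map (\<lambda>a. map (conj_list a) [[2, 3, 1, 4], [4, 1, 3, 2], [3, 2, 4, 1],
    [1, 4, 2, 3], [3, 1, 2, 4], [2, 4, 3, 1], [4, 2, 1, 3], [1, 3, 4, 2]]) [[2, 3, 1, 4],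
    [4, 1, 3, 2], [3, 2, 4, 1], [1, 4, 2, 3], [3, 1, 2, 4], [2, 4, 3, 1], [4, 2, 1, 3],
    [1, 3, 4, 2]] =
    [[[2, 3, 1, 4], [1, 4, 2, 3], [4, 1, 3, 2], [3, 2, 4, 1], [3, 1, 2, 4], [1, 3, 4, 2],
        [2, 4, 3, 1], [4, 2, 1, 3]], [[3, 2, 4, 1], [4, 1, 3, 2], [1, 4, 2, 3], [2, 3, 1, 4],
        [4, 2, 1, 3], [2, 4, 3, 1], [1, 3, 4, 2], [3, 1, 2, 4]], [[1, 4, 2, 3], [2, 3, 1, 4],
        [3, 2, 4, 1], [4, 1, 3, 2], [1, 3, 4, 2], [3, 1, 2, 4], [4, 2, 1, 3], [2, 4, 3, 1]],
        [[4, 1, 3, 2], [3, 2, 4, 1], [2, 3, 1, 4], [1, 4, 2, 3], [2, 4, 3, 1], [4, 2, 1, 3],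
        [3, 1, 2, 4], [1, 3, 4, 2]], [[2, 3, 1, 4], [3, 2, 4, 1], [1, 4, 2, 3], [4, 1, 3, 2],
        [3, 1, 2, 4], [4, 2, 1, 3], [1, 3, 4, 2], [2, 4, 3, 1]], [[1, 4, 2, 3], [4, 1, 3, 2],
        [2, 3, 1, 4], [3, 2, 4, 1], [1, 3, 4, 2], [2, 4, 3, 1], [3, 1, 2, 4], [4, 2, 1, 3]],
        [[4, 1, 3, 2], [1, 4, 2, 3], [3, 2, 4, 1], [2, 3, 1, 4], [2, 4, 3, 1], [1, 3, 4, 2],
        [4, 2, 1, 3], [3, 1, 2, 4]], [[3, 2, 4, 1], [2, 3, 1, 4], [4, 1, 3, 2], [1, 4, 2, 3],
        [4, 2, 1, 3], [3, 1, 2, 4], [2, 4, 3, 1], [1, 3, 4, 2]]]"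
  by code_simp

text \<open>Flat coefficients are invariant under the group generated by the support. Two 3-cycles
  that are not mutually inverse generate \<open>A4\<close>, so the coefficients are constant on each
  of its two classes of 3-cycles; a 3-cycle and its inverse commute and impose nothing on each
  other.\<close>

lemma three_4_flat: "\<forall>x :: nat list \<Rightarrow> 'k::field_char_0. list_ex (\<lambda>a. x a \<noteq> 0) three_4 \<longrightarrow>
    (flat_on three_4 x \<longleftrightarrow> list_ex (\<lambda>p. cell_on three_4 p x) three_4_cells)"
  unfolding three_4_def three_4_cells_def
  by (simp (no_asm_use) only: cell_simps three_4_table[simplified list.map list.inject simp_thms],
      simp (no_asm_use) del: One_nat_def, smt (verit))

text \<open>Three consecutive pairs of mutually inverse 4-cycles, starting with (1234), (1243) and
  (1324).\<close>

definition four_4 :: "nat list list"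
  where "four_4 = [[2, 3, 4, 1], [4, 1, 2, 3], [2, 4, 1, 3], [3, 1, 4, 2], [3, 4, 2, 1],
      [4, 3, 1, 2]]"

definition four_4_cells :: "nat list list list list"
  where "four_4_cells =
    [[[[2, 3, 4, 1], [4, 1, 2, 3], [2, 4, 1, 3], [3, 1, 4, 2], [3, 4, 2, 1], [4, 3, 1, 2]]],
     [[[2, 3, 4, 1]], [[4, 1, 2, 3]]],
     [[[2, 4, 1, 3]], [[3, 1, 4, 2]]],
     [[[3, 4, 2, 1]], [[4, 3, 1, 2]]],
     [[[2, 3, 4, 1]]],
     [[[4, 1, 2, 3]]],
     [[[2, 4, 1, 3]]],
     [[[3, 1, 4, 2]]],
     [[[3, 4, 2, 1]]],
     [[[4, 3, 1, 2]]]]"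

interpretation four_4: perm_class 4 four_4 four_4_cells
proof
  show "set four_4 \<subseteq> permutations_of_set {1..4}" by code_simp
  have "\<forall>g\<in>permutations_of_set {1..4}. \<forall>a\<in>set four_4. conj_list g a \<in> set four_4" by code_simp
  then show "conj_list g a \<in> set four_4" if "g \<in> permutations_of_set {1..4}" "a \<in> set four_4"
      for g a
    using that by blast
qed code_simp+

lemma conj_class_four_4: "conj_class (sym_group 4) (cycle_of_list [1, 2, 3, 4]) = four_4.C"
proof -
  have "[2, 3, 4, 1] \<in> permutations_of_set {1..4::nat}" by code_simp
  moreover have "(\<lambda>g. conj_list g [2, 3, 4, 1]) ` permutations_of_set {1..4} = set four_4"
      by code_simp
  ultimately show ?thesis by (simp only: cycles_4(21) conj_class_list_perm four_4.C_def)
qed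

lemma four_4_table: "map (\<lambda>a. map (conj_list a) [[2, 3, 4, 1], [4, 1, 2, 3], [2, 4, 1, 3],
    [3, 1, 4, 2], [3, 4, 2, 1], [4, 3, 1, 2]]) [[2, 3, 4, 1], [4, 1, 2, 3], [2, 4, 1, 3],
    [3, 1, 4, 2], [3, 4, 2, 1], [4, 3, 1, 2]] =
    [[[2, 3, 4, 1], [4, 1, 2, 3], [4, 3, 1, 2], [3, 4, 2, 1], [2, 4, 1, 3], [3, 1, 4, 2]],
        [[2, 3, 4, 1], [4, 1, 2, 3], [3, 4, 2, 1], [4, 3, 1, 2], [3, 1, 4, 2], [2, 4, 1, 3]],
        [[3, 4, 2, 1], [4, 3, 1, 2], [2, 4, 1, 3], [3, 1, 4, 2], [4, 1, 2, 3], [2, 3, 4, 1]],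
        [[4, 3, 1, 2], [3, 4, 2, 1], [2, 4, 1, 3], [3, 1, 4, 2], [2, 3, 4, 1], [4, 1, 2, 3]],
        [[3, 1, 4, 2], [2, 4, 1, 3], [2, 3, 4, 1], [4, 1, 2, 3], [3, 4, 2, 1], [4, 3, 1, 2]],
        [[2, 4, 1, 3], [3, 1, 4, 2], [4, 1, 2, 3], [2, 3, 4, 1], [3, 4, 2, 1], [4, 3, 1, 2]]]"
  by code_simp

text \<open>Two 4-cycles that are not mutually inverse generate \<open>S4\<close>, under which the
  class is a single orbit, so all coefficients agree. Otherwise the support lies in a pair of
  inverse elements, which commute.\<close>

lemma four_4_flat: "\<forall>x :: nat list \<Rightarrow> 'k::field_char_0. list_ex (\<lambda>a. x a \<noteq> 0) four_4 \<longrightarrow>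
    (flat_on four_4 x \<longleftrightarrow> list_ex (\<lambda>p. cell_on four_4 p x) four_4_cells)"
  unfolding four_4_def four_4_cells_def
  by (simp (no_asm_use) only: cell_simps four_4_table[simplified list.map list.inject simp_thms],
      simp (no_asm_use) del: One_nat_def, smt (verit))

section \<open>The strata of the six classes\<close>

lemma transp_3_theta: "theta transp_3.C = block_form [[2, 1, 3], [3, 2, 1], [1, 3, 2]]"
  by (subst transp_3.theta_C) (simp only: transp_3_def)

lemma transp_4_theta: "theta transp_4.C = block_form [[2, 1, 3, 4], [3, 2, 1, 4], [4, 2, 3, 1],
    [1, 3, 2, 4], [1, 4, 3, 2], [1, 2, 4, 3]]"
  by (subst transp_4.theta_C) (simp only: transp_4_def)

lemma four_4_theta: "theta four_4.C = block_form [[2, 3, 4, 1], [4, 1, 2, 3], [2, 4, 1, 3],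
    [3, 1, 4, 2], [3, 4, 2, 1], [4, 3, 1, 2]]"
  by (subst four_4.theta_C) (simp only: four_4_def)

text \<open>Removing the transpositions that move \<open>i\<close> leaves the three transpositions
  of the other points.\<close>

lemma theta_minus_theta_at:
  "theta transp_4.C - theta_at 1 = block_form [[1, 3, 2, 4], [1, 4, 3, 2], [1, 2, 4, 3]]"
  "theta transp_4.C - theta_at 2 = block_form [[3, 2, 1, 4], [4, 2, 3, 1], [1, 2, 4, 3]]"
  "theta transp_4.C - theta_at 3 = block_form [[2, 1, 3, 4], [4, 2, 3, 1], [1, 4, 3, 2]]"
  "theta transp_4.C - theta_at 4 = block_form [[2, 1, 3, 4], [3, 2, 1, 4], [1, 3, 2, 4]]"
proof -
  have "{1..4} - {1::nat} = {2, 3, 4}" "{1..4} - {2::nat} = {1, 3, 4}"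
    "{1..4} - {3::nat} = {1, 2, 4}" "{1..4} - {4::nat} = {1, 2, 3}" by auto
  note * = this theta_at_def transp_4_theta block_form_def cycles_4
  show "theta transp_4.C - theta_at 1 = block_form [[1, 3, 2, 4], [1, 4, 3, 2], [1, 2, 4, 3]]"
    \<comment> \<open>The recursion of \<open>cycle_of_list\<close> is switched off so that cycles
      stay folded until \<open>cycles_4\<close> replaces them.\<close>
    by (simp add: * algebra_simps del: One_nat_def cycle_of_list.simps)
  show "theta transp_4.C - theta_at 2 = block_form [[3, 2, 1, 4], [4, 2, 3, 1], [1, 2, 4, 3]]"
    by (simp add: * algebra_simps del: One_nat_def cycle_of_list.simps)
  show "theta transp_4.C - theta_at 3 = block_form [[2, 1, 3, 4], [4, 2, 3, 1], [1, 4, 3, 2]]"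
    by (simp add: * algebra_simps del: One_nat_def cycle_of_list.simps)
  show "theta transp_4.C - theta_at 4 = block_form [[2, 1, 3, 4], [3, 2, 1, 4], [1, 3, 2, 4]]"
    by (simp add: * algebra_simps del: One_nat_def cycle_of_list.simps)
qed

lemma transp_3_3: "(flat_stratum (sym_group 3) transp_3.C 3 :: (_ \<Rightarrow>\<^sub>0 'k::field_char_0) set) =
    up_to_scale {theta transp_3.C}"
proof -
  have cells: "filter (\<lambda>p. length (concat p) = 3) transp_3_cells = [[[[2, 1, 3], [3, 2, 1],
      [1, 3, 2]]]]"
    by code_simp
  have "(flat_stratum (sym_group 3) transp_3.C 3 :: (_ \<Rightarrow>\<^sub>0 'k) set) =
      (\<Union>p\<in>set (filter (\<lambda>p. length (concat p) = 3) transp_3_cells). transp_3.cell p)"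
    by (rule transp_3.flat_stratum_cells[OF transp_3_flat]) simp
  then show ?thesis
    unfolding cells cycles_3 transp_3_theta
    by (simp add: transp_3.cell_1 transp_3.cell_2 transp_3.cell_3 transp_3_cells_def block_form_def
      up_to_scale_Un up_to_scale_insert Un_assoc add.assoc del: One_nat_def)
qed

lemma transp_3_1: "(flat_stratum (sym_group 3) transp_3.C 1 :: (_ \<Rightarrow>\<^sub>0 'k::field_char_0) set) =
    up_to_scale {\<ee> [2,3], \<ee> [1,3], \<ee> [1,2]}"
proof -
  have cells: "filter (\<lambda>p. length (concat p) = 1) transp_3_cells = [[[[1, 3, 2]]], [[[3, 2, 1]]],
      [[[2, 1, 3]]]]"
    by code_simp
  have "(flat_stratum (sym_group 3) transp_3.C 1 :: (_ \<Rightarrow>\<^sub>0 'k) set) =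
      (\<Union>p\<in>set (filter (\<lambda>p. length (concat p) = 1) transp_3_cells). transp_3.cell p)"
    by (rule transp_3.flat_stratum_cells[OF transp_3_flat]) simp
  then show ?thesis
    unfolding cells cycles_3
    by (simp add: transp_3.cell_1 transp_3.cell_2 transp_3.cell_3 transp_3_cells_def block_form_def
      up_to_scale_Un up_to_scale_insert Un_assoc add.assoc del: One_nat_def)
qed

lemma transp_3_empty:
  assumes "m \<ge> 1" "m \<notin> {1, 3}"
  shows "(flat_stratum (sym_group 3) transp_3.C m :: (_ \<Rightarrow>\<^sub>0 'k::field_char_0) set) = {}"
proof -
  have "\<forall>p\<in>set transp_3_cells. length (concat p) \<in> {1, 3}" by code_simp
  then have "filter (\<lambda>p. length (concat p) = m) transp_3_cells = []"
    using assms(2) unfolding filter_empty_conv by blast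
  then show ?thesis using transp_3.flat_stratum_cells[OF transp_3_flat assms(1)] by simp
qed

lemma rot_3_2: "(flat_stratum (sym_group 3) rot_3.C 2 :: (_ \<Rightarrow>\<^sub>0 'k::field_char_0) set) =
    up_to_scale {\<kappa> *\<^sub>k \<ee> [1, 2, 3] + \<mu> *\<^sub>k \<ee> [1, 3, 2] | \<kappa> \<mu>. \<kappa> \<noteq> 0 \<and> \<mu> \<noteq> 0}"
proof -
  have cells: "filter (\<lambda>p. length (concat p) = 2) rot_3_cells = [[[[2, 3, 1]], [[3, 1, 2]]]]"
    by code_simp
  have "(flat_stratum (sym_group 3) rot_3.C 2 :: (_ \<Rightarrow>\<^sub>0 'k) set) =
      (\<Union>p\<in>set (filter (\<lambda>p. length (concat p) = 2) rot_3_cells). rot_3.cell p)"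
    by (rule rot_3.flat_stratum_cells[OF rot_3_flat]) simp
  then show ?thesis
    unfolding cells cycles_3
    by (simp add: rot_3.cell_1 rot_3.cell_2 rot_3.cell_3 rot_3_cells_def block_form_def
      up_to_scale_Un up_to_scale_insert Un_assoc add.assoc del: One_nat_def)
qed

lemma rot_3_1: "(flat_stratum (sym_group 3) rot_3.C 1 :: (_ \<Rightarrow>\<^sub>0 'k::field_char_0) set) =
    up_to_scale {\<ee> [1,2,3], \<ee> [1,3,2]}"
proof -
  have cells: "filter (\<lambda>p. length (concat p) = 1) rot_3_cells = [[[[2, 3, 1]]], [[[3, 1, 2]]]]"
    by code_simp
  have "(flat_stratum (sym_group 3) rot_3.C 1 :: (_ \<Rightarrow>\<^sub>0 'k) set) =
      (\<Union>p\<in>set (filter (\<lambda>p. length (concat p) = 1) rot_3_cells). rot_3.cell p)"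
    by (rule rot_3.flat_stratum_cells[OF rot_3_flat]) simp
  then show ?thesis
    unfolding cells cycles_3
    by (simp add: rot_3.cell_1 rot_3.cell_2 rot_3.cell_3 rot_3_cells_def block_form_def
      up_to_scale_Un up_to_scale_insert Un_assoc add.assoc del: One_nat_def)
qed

lemma rot_3_empty:
  assumes "m \<ge> 1" "m \<notin> {1, 2}"
  shows "(flat_stratum (sym_group 3) rot_3.C m :: (_ \<Rightarrow>\<^sub>0 'k::field_char_0) set) = {}"
proof -
  have "\<forall>p\<in>set rot_3_cells. length (concat p) \<in> {1, 2}" by code_simp
  then have "filter (\<lambda>p. length (concat p) = m) rot_3_cells = []"
    using assms(2) unfolding filter_empty_conv by blast
  then show ?thesis using rot_3.flat_stratum_cells[OF rot_3_flat assms(1)] by simp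
qed

lemma transp_4_6: "(flat_stratum (sym_group 4) transp_4.C 6 :: (_ \<Rightarrow>\<^sub>0 'k::field_char_0) set) =
    up_to_scale {theta transp_4.C}"
proof -
  have cells: "filter (\<lambda>p. length (concat p) = 6) transp_4_cells = [[[[2, 1, 3, 4], [3, 2, 1, 4],
      [4, 2, 3, 1], [1, 3, 2, 4], [1, 4, 3, 2], [1, 2, 4, 3]]]]"
    by code_simp
  have "(flat_stratum (sym_group 4) transp_4.C 6 :: (_ \<Rightarrow>\<^sub>0 'k) set) =
      (\<Union>p\<in>set (filter (\<lambda>p. length (concat p) = 6) transp_4_cells). transp_4.cell p)"
    by (rule transp_4.flat_stratum_cells[OF transp_4_flat]) simp
  then show ?thesis
    unfolding cells cycles_4 transp_4_theta
    by (simp add: transp_4.cell_1 transp_4.cell_2 transp_4.cell_3 transp_4_cells_def block_form_def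
      up_to_scale_Un up_to_scale_insert Un_assoc add.assoc del: One_nat_def)
qed

lemma transp_4_3: "(flat_stratum (sym_group 4) transp_4.C 3 :: (_ \<Rightarrow>\<^sub>0 'k::field_char_0) set) =
    up_to_scale {theta transp_4.C - theta_at i | i. i \<in> {1..4}}"
proof -
  have cells: "filter (\<lambda>p. length (concat p) = 3) transp_4_cells = [[[[1, 3, 2, 4], [1, 4, 3, 2],
      [1, 2, 4, 3]]], [[[3, 2, 1, 4], [4, 2, 3, 1], [1, 2, 4, 3]]], [[[2, 1, 3, 4], [4, 2, 3, 1],
      [1, 4, 3, 2]]], [[[2, 1, 3, 4], [3, 2, 1, 4], [1, 3, 2, 4]]]]"
    by code_simp
  have "(flat_stratum (sym_group 4) transp_4.C 3 :: (_ \<Rightarrow>\<^sub>0 'k) set) =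
      (\<Union>p\<in>set (filter (\<lambda>p. length (concat p) = 3) transp_4_cells). transp_4.cell p)"
    by (rule transp_4.flat_stratum_cells[OF transp_4_flat]) simp
  moreover have "{1..4} = {1, 2, 3, 4::nat}" by auto
  then have "{theta transp_4.C - theta_at i | i. i \<in> {1..4}} = {theta transp_4.C - theta_at 1,
      theta transp_4.C - theta_at 2,
      theta transp_4.C - theta_at 3, theta transp_4.C - theta_at 4 :: _ \<Rightarrow>\<^sub>0 'k}" by auto
  ultimately show ?thesis
    unfolding cells theta_minus_theta_at
    by (simp add: transp_4.cell_1 transp_4_cells_def up_to_scale_insert Un_assoc del: One_nat_def)
qed

lemma transp_4_2: "(flat_stratum (sym_group 4) transp_4.C 2 :: (_ \<Rightarrow>\<^sub>0 'k::field_char_0) set) =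
    up_to_scale ({\<kappa> *\<^sub>k \<ee> [1, 4] + \<mu> *\<^sub>k \<ee> [2, 3] | \<kappa> \<mu>. \<kappa> \<noteq> 0 \<and> \<mu> \<noteq> 0} \<union> {\<kappa> *\<^sub>k \<ee> [1,
        3] + \<mu> *\<^sub>k \<ee> [2, 4] | \<kappa> \<mu>. \<kappa> \<noteq> 0 \<and> \<mu> \<noteq> 0} \<union> {\<kappa> *\<^sub>k \<ee> [1, 2] + \<mu> *\<^sub>k \<ee> [3, 4] | \<kappa> \<mu>. \<kappa> \<noteq> 0
        \<and> \<mu> \<noteq> 0})"
proof -
  have cells: "filter (\<lambda>p. length (concat p) = 2) transp_4_cells = [[[[4, 2, 3, 1]],
      [[1, 3, 2, 4]]], [[[3, 2, 1, 4]], [[1, 4, 3, 2]]], [[[2, 1, 3, 4]], [[1, 2, 4, 3]]]]"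
    by code_simp
  have "(flat_stratum (sym_group 4) transp_4.C 2 :: (_ \<Rightarrow>\<^sub>0 'k) set) =
      (\<Union>p\<in>set (filter (\<lambda>p. length (concat p) = 2) transp_4_cells). transp_4.cell p)"
    by (rule transp_4.flat_stratum_cells[OF transp_4_flat]) simp
  then show ?thesis
    unfolding cells cycles_4
    by (simp add: transp_4.cell_1 transp_4.cell_2 transp_4.cell_3 transp_4_cells_def block_form_def
      up_to_scale_Un up_to_scale_insert Un_assoc add.assoc del: One_nat_def)
qed

lemma transp_4_1: "(flat_stratum (sym_group 4) transp_4.C 1 :: (_ \<Rightarrow>\<^sub>0 'k::field_char_0) set) =
    up_to_scale {basis_form a | a. a \<in> transp_4.C}"
proof -
  \<comment> \<open>The singleton cells are listed in the order of \<open>transp_4\<close>, so this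
    is an equality of lists.\<close>
  have cells: "filter (\<lambda>p. length (concat p) = 1) transp_4_cells = map (\<lambda>a. [[a]]) transp_4"
    by code_simp
  have "(flat_stratum (sym_group 4) transp_4.C 1 :: (_ \<Rightarrow>\<^sub>0 'k) set) =
      (\<Union>p\<in>set (filter (\<lambda>p. length (concat p) = 1) transp_4_cells). transp_4.cell p)"
    by (rule transp_4.flat_stratum_cells[OF transp_4_flat]) simp
  also have "\<dots> = (\<Union>a\<in>set transp_4. transp_4.cell [[a]])"
    unfolding cells by simp
  also have "\<dots> = up_to_scale {basis_form a | a. a \<in> transp_4.C}"
  proof (rule transp_4.basis_forms_C)
    show "\<forall>a\<in>set transp_4. [[a]] \<in> set transp_4_cells" by code_simp
  qed
  finally show ?thesis .
qed

lemma transp_4_empty: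
  assumes "m \<ge> 1" "m \<notin> {1, 2, 3, 6}"
  shows "(flat_stratum (sym_group 4) transp_4.C m :: (_ \<Rightarrow>\<^sub>0 'k::field_char_0) set) = {}"
proof -
  have "\<forall>p\<in>set transp_4_cells. length (concat p) \<in> {1, 2, 3, 6}" by code_simp
  then have "filter (\<lambda>p. length (concat p) = m) transp_4_cells = []"
    using assms(2) unfolding filter_empty_conv by blast
  then show ?thesis using transp_4.flat_stratum_cells[OF transp_4_flat assms(1)] by simp
qed

lemma double_4_3: "(flat_stratum (sym_group 4) double_4.C 3 :: (_ \<Rightarrow>\<^sub>0 'k::field_char_0) set) =
    up_to_scale {\<kappa> *\<^sub>k \<ee>\<ee> [1, 2] [3, 4] + \<mu> *\<^sub>k \<ee>\<ee> [1, 3] [2, 4] + \<nu> *\<^sub>k \<ee>\<ee> [1, 4] [2, 3] | \<kappa> \<mu> \<nu>.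
        \<kappa> \<noteq> 0 \<and> \<mu> \<noteq> 0 \<and> \<nu> \<noteq> 0}"
proof -
  have cells: "filter (\<lambda>p. length (concat p) = 3) double_4_cells = [[[[2, 1, 4, 3]],
      [[3, 4, 1, 2]], [[4, 3, 2, 1]]]]"
    by code_simp
  have "(flat_stratum (sym_group 4) double_4.C 3 :: (_ \<Rightarrow>\<^sub>0 'k) set) =
      (\<Union>p\<in>set (filter (\<lambda>p. length (concat p) = 3) double_4_cells). double_4.cell p)"
    by (rule double_4.flat_stratum_cells[OF double_4_flat]) simp
  then show ?thesis
    unfolding cells double_transpositions
    by (simp add: double_4.cell_1 double_4.cell_2 double_4.cell_3 double_4_cells_def block_form_def
      up_to_scale_Un up_to_scale_insert Un_assoc add.assoc del: One_nat_def)
qed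

lemma double_4_2: "(flat_stratum (sym_group 4) double_4.C 2 :: (_ \<Rightarrow>\<^sub>0 'k::field_char_0) set) =
    up_to_scale ({\<kappa> *\<^sub>k \<ee>\<ee> [1, 2] [3, 4] + \<mu> *\<^sub>k \<ee>\<ee> [1, 3] [2, 4] | \<kappa> \<mu>. \<kappa> \<noteq> 0 \<and> \<mu> \<noteq> 0}
        \<union> {\<kappa> *\<^sub>k \<ee>\<ee> [1, 3] [2, 4] + \<mu> *\<^sub>k \<ee>\<ee> [1, 4] [2, 3] | \<kappa> \<mu>. \<kappa> \<noteq> 0 \<and> \<mu> \<noteq> 0} \<union> {\<kappa> *\<^sub>k \<ee>\<ee> [1,
        2] [3, 4] + \<mu> *\<^sub>k \<ee>\<ee> [1, 4] [2, 3] | \<kappa> \<mu>. \<kappa> \<noteq> 0 \<and> \<mu> \<noteq> 0})"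
proof -
  have cells: "filter (\<lambda>p. length (concat p) = 2) double_4_cells = [[[[2, 1, 4, 3]],
      [[3, 4, 1, 2]]], [[[3, 4, 1, 2]], [[4, 3, 2, 1]]], [[[2, 1, 4, 3]], [[4, 3, 2, 1]]]]"
    by code_simp
  have "(flat_stratum (sym_group 4) double_4.C 2 :: (_ \<Rightarrow>\<^sub>0 'k) set) =
      (\<Union>p\<in>set (filter (\<lambda>p. length (concat p) = 2) double_4_cells). double_4.cell p)"
    by (rule double_4.flat_stratum_cells[OF double_4_flat]) simp
  then show ?thesis
    unfolding cells double_transpositions
    by (simp add: double_4.cell_1 double_4.cell_2 double_4.cell_3 double_4_cells_def block_form_def
      up_to_scale_Un up_to_scale_insert Un_assoc add.assoc del: One_nat_def)
qed

lemma double_4_1: "(flat_stratum (sym_group 4) double_4.C 1 :: (_ \<Rightarrow>\<^sub>0 'k::field_char_0) set) =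
    up_to_scale {basis_form a | a. a \<in> double_4.C}"
proof -
  have cells: "filter (\<lambda>p. length (concat p) = 1) double_4_cells = map (\<lambda>a. [[a]]) double_4"
    by code_simp
  have "(flat_stratum (sym_group 4) double_4.C 1 :: (_ \<Rightarrow>\<^sub>0 'k) set) =
      (\<Union>p\<in>set (filter (\<lambda>p. length (concat p) = 1) double_4_cells). double_4.cell p)"
    by (rule double_4.flat_stratum_cells[OF double_4_flat]) simp
  also have "\<dots> = (\<Union>a\<in>set double_4. double_4.cell [[a]])"
    unfolding cells by simp
  also have "\<dots> = up_to_scale {basis_form a | a. a \<in> double_4.C}"
  proof (rule double_4.basis_forms_C)
    show "\<forall>a\<in>set double_4. [[a]] \<in> set double_4_cells" by code_simp
  qed
  finally show ?thesis .
qed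

lemma double_4_empty:
  assumes "m \<ge> 1" "m \<notin> {1, 2, 3}"
  shows "(flat_stratum (sym_group 4) double_4.C m :: (_ \<Rightarrow>\<^sub>0 'k::field_char_0) set) = {}"
proof -
  have "\<forall>p\<in>set double_4_cells. length (concat p) \<in> {1, 2, 3}" by code_simp
  then have "filter (\<lambda>p. length (concat p) = m) double_4_cells = []"
    using assms(2) unfolding filter_empty_conv by blast
  then show ?thesis using double_4.flat_stratum_cells[OF double_4_flat assms(1)] by simp
qed

lemma three_4_8: "(flat_stratum (sym_group 4) three_4.C 8 :: (_ \<Rightarrow>\<^sub>0 'k::field_char_0) set) =
    up_to_scale {\<kappa> *\<^sub>k (\<ee> [1, 2, 3] + \<ee> [1, 4, 2] + \<ee> [1, 3, 4] + \<ee> [2, 4, 3]) + \<mu> *\<^sub>k (\<ee> [1, 3,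
        2] + \<ee> [1, 2, 4] + \<ee> [1, 4, 3] + \<ee> [2, 3, 4]) | \<kappa> \<mu>. \<kappa> \<noteq> 0 \<and> \<mu> \<noteq> 0}"
proof -
  have cells: "filter (\<lambda>p. length (concat p) = 8) three_4_cells = [[[[2, 3, 1, 4], [4, 1, 3, 2],
      [3, 2, 4, 1], [1, 4, 2, 3]], [[3, 1, 2, 4], [2, 4, 3, 1], [4, 2, 1, 3], [1, 3, 4, 2]]]]"
    by code_simp
  have "(flat_stratum (sym_group 4) three_4.C 8 :: (_ \<Rightarrow>\<^sub>0 'k) set) =
      (\<Union>p\<in>set (filter (\<lambda>p. length (concat p) = 8) three_4_cells). three_4.cell p)"
    by (rule three_4.flat_stratum_cells[OF three_4_flat]) simp
  then show ?thesis
    unfolding cells cycles_4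
    by (simp add: three_4.cell_1 three_4.cell_2 three_4.cell_3 three_4_cells_def block_form_def
      up_to_scale_Un up_to_scale_insert Un_assoc add.assoc del: One_nat_def)
qed

lemma three_4_4: "(flat_stratum (sym_group 4) three_4.C 4 :: (_ \<Rightarrow>\<^sub>0 'k::field_char_0) set) =
    up_to_scale {\<ee> [1, 2, 3] + \<ee> [1, 4, 2] + \<ee> [1, 3, 4] + \<ee> [2, 4, 3],
        \<ee> [1, 3, 2] + \<ee> [1, 2, 4] + \<ee> [1, 4, 3] + \<ee> [2, 3, 4]}"
proof -
  have cells: "filter (\<lambda>p. length (concat p) = 4) three_4_cells = [[[[2, 3, 1, 4], [4, 1, 3, 2],
      [3, 2, 4, 1], [1, 4, 2, 3]]], [[[3, 1, 2, 4], [2, 4, 3, 1], [4, 2, 1, 3], [1, 3, 4, 2]]]]"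
    by code_simp
  have "(flat_stratum (sym_group 4) three_4.C 4 :: (_ \<Rightarrow>\<^sub>0 'k) set) =
      (\<Union>p\<in>set (filter (\<lambda>p. length (concat p) = 4) three_4_cells). three_4.cell p)"
    by (rule three_4.flat_stratum_cells[OF three_4_flat]) simp
  then show ?thesis
    unfolding cells cycles_4
    by (simp add: three_4.cell_1 three_4.cell_2 three_4.cell_3 three_4_cells_def block_form_def
      up_to_scale_Un up_to_scale_insert Un_assoc add.assoc del: One_nat_def)
qed

lemma three_4_2: "(flat_stratum (sym_group 4) three_4.C 2 :: (_ \<Rightarrow>\<^sub>0 'k::field_char_0) set) =
    up_to_scale ({\<kappa> *\<^sub>k \<ee> [1, 2, 3] + \<mu> *\<^sub>k \<ee> [1, 3, 2] | \<kappa> \<mu>. \<kappa> \<noteq> 0 \<and> \<mu> \<noteq> 0} \<union> {\<kappa> *\<^sub>k \<ee> [1, 4,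
        2] + \<mu> *\<^sub>k \<ee> [1, 2, 4] | \<kappa> \<mu>. \<kappa> \<noteq> 0 \<and> \<mu> \<noteq> 0} \<union> {\<kappa> *\<^sub>k \<ee> [1, 3, 4] + \<mu> *\<^sub>k \<ee> [1, 4, 3]
        | \<kappa> \<mu>. \<kappa> \<noteq> 0 \<and> \<mu> \<noteq> 0} \<union> {\<kappa> *\<^sub>k \<ee> [2, 4, 3] + \<mu> *\<^sub>k \<ee> [2, 3, 4] | \<kappa> \<mu>. \<kappa> \<noteq> 0 \<and> \<mu> \<noteq> 0})"
proof -
  have cells: "filter (\<lambda>p. length (concat p) = 2) three_4_cells = [[[[2, 3, 1, 4]],
      [[3, 1, 2, 4]]], [[[4, 1, 3, 2]], [[2, 4, 3, 1]]], [[[3, 2, 4, 1]], [[4, 2, 1, 3]]],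
      [[[1, 4, 2, 3]], [[1, 3, 4, 2]]]]"
    by code_simp
  have "(flat_stratum (sym_group 4) three_4.C 2 :: (_ \<Rightarrow>\<^sub>0 'k) set) =
      (\<Union>p\<in>set (filter (\<lambda>p. length (concat p) = 2) three_4_cells). three_4.cell p)"
    by (rule three_4.flat_stratum_cells[OF three_4_flat]) simp
  then show ?thesis
    unfolding cells cycles_4
    by (simp add: three_4.cell_1 three_4.cell_2 three_4.cell_3 three_4_cells_def block_form_def
      up_to_scale_Un up_to_scale_insert Un_assoc add.assoc del: One_nat_def)
qed

lemma three_4_1: "(flat_stratum (sym_group 4) three_4.C 1 :: (_ \<Rightarrow>\<^sub>0 'k::field_char_0) set) =
    up_to_scale {basis_form a | a. a \<in> three_4.C}"
proof -
  have cells: "filter (\<lambda>p. length (concat p) = 1) three_4_cells = map (\<lambda>a. [[a]]) three_4"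
    by code_simp
  have "(flat_stratum (sym_group 4) three_4.C 1 :: (_ \<Rightarrow>\<^sub>0 'k) set) =
      (\<Union>p\<in>set (filter (\<lambda>p. length (concat p) = 1) three_4_cells). three_4.cell p)"
    by (rule three_4.flat_stratum_cells[OF three_4_flat]) simp
  also have "\<dots> = (\<Union>a\<in>set three_4. three_4.cell [[a]])"
    unfolding cells by simp
  also have "\<dots> = up_to_scale {basis_form a | a. a \<in> three_4.C}"
  proof (rule three_4.basis_forms_C)
    show "\<forall>a\<in>set three_4. [[a]] \<in> set three_4_cells" by code_simp
  qed
  finally show ?thesis .
qed

lemma three_4_empty:
  assumes "m \<ge> 1" "m \<notin> {1, 2, 4, 8}"
  shows "(flat_stratum (sym_group 4) three_4.C m :: (_ \<Rightarrow>\<^sub>0 'k::field_char_0) set) = {}"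
proof -
  have "\<forall>p\<in>set three_4_cells. length (concat p) \<in> {1, 2, 4, 8}" by code_simp
  then have "filter (\<lambda>p. length (concat p) = m) three_4_cells = []"
    using assms(2) unfolding filter_empty_conv by blast
  then show ?thesis using three_4.flat_stratum_cells[OF three_4_flat assms(1)] by simp
qed

lemma four_4_6: "(flat_stratum (sym_group 4) four_4.C 6 :: (_ \<Rightarrow>\<^sub>0 'k::field_char_0) set) =
    up_to_scale {theta four_4.C}"
proof -
  have cells: "filter (\<lambda>p. length (concat p) = 6) four_4_cells = [[[[2, 3, 4, 1], [4, 1, 2, 3],
      [2, 4, 1, 3], [3, 1, 4, 2], [3, 4, 2, 1], [4, 3, 1, 2]]]]"
    by code_simp
  have "(flat_stratum (sym_group 4) four_4.C 6 :: (_ \<Rightarrow>\<^sub>0 'k) set) =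
      (\<Union>p\<in>set (filter (\<lambda>p. length (concat p) = 6) four_4_cells). four_4.cell p)"
    by (rule four_4.flat_stratum_cells[OF four_4_flat]) simp
  then show ?thesis
    unfolding cells cycles_4 four_4_theta
    by (simp add: four_4.cell_1 four_4.cell_2 four_4.cell_3 four_4_cells_def block_form_def
      up_to_scale_Un up_to_scale_insert Un_assoc add.assoc del: One_nat_def)
qed

lemma four_4_2: "(flat_stratum (sym_group 4) four_4.C 2 :: (_ \<Rightarrow>\<^sub>0 'k::field_char_0) set) =
    up_to_scale ({\<kappa> *\<^sub>k \<ee> [1, 2, 3, 4] + \<mu> *\<^sub>k \<ee> [1, 4, 3, 2] | \<kappa> \<mu>. \<kappa> \<noteq> 0 \<and> \<mu> \<noteq> 0} \<union> {\<kappa> *\<^sub>k \<ee> [1,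
        2, 4, 3] + \<mu> *\<^sub>k \<ee> [1, 3, 4, 2] | \<kappa> \<mu>. \<kappa> \<noteq> 0 \<and> \<mu> \<noteq> 0} \<union> {\<kappa> *\<^sub>k \<ee> [1, 3, 2,
        4] + \<mu> *\<^sub>k \<ee> [1, 4, 2, 3] | \<kappa> \<mu>. \<kappa> \<noteq> 0 \<and> \<mu> \<noteq> 0})"
proof -
  have cells: "filter (\<lambda>p. length (concat p) = 2) four_4_cells = [[[[2, 3, 4, 1]],
      [[4, 1, 2, 3]]], [[[2, 4, 1, 3]], [[3, 1, 4, 2]]], [[[3, 4, 2, 1]], [[4, 3, 1, 2]]]]"
    by code_simp
  have "(flat_stratum (sym_group 4) four_4.C 2 :: (_ \<Rightarrow>\<^sub>0 'k) set) =
      (\<Union>p\<in>set (filter (\<lambda>p. length (concat p) = 2) four_4_cells). four_4.cell p)"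
    by (rule four_4.flat_stratum_cells[OF four_4_flat]) simp
  then show ?thesis
    unfolding cells cycles_4
    by (simp add: four_4.cell_1 four_4.cell_2 four_4.cell_3 four_4_cells_def block_form_def
      up_to_scale_Un up_to_scale_insert Un_assoc add.assoc del: One_nat_def)
qed

lemma four_4_1: "(flat_stratum (sym_group 4) four_4.C 1 :: (_ \<Rightarrow>\<^sub>0 'k::field_char_0) set) =
    up_to_scale {basis_form a | a. a \<in> four_4.C}"
proof -
  have cells: "filter (\<lambda>p. length (concat p) = 1) four_4_cells = map (\<lambda>a. [[a]]) four_4"
    by code_simp
  have "(flat_stratum (sym_group 4) four_4.C 1 :: (_ \<Rightarrow>\<^sub>0 'k) set) =
      (\<Union>p\<in>set (filter (\<lambda>p. length (concat p) = 1) four_4_cells). four_4.cell p)"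
    by (rule four_4.flat_stratum_cells[OF four_4_flat]) simp
  also have "\<dots> = (\<Union>a\<in>set four_4. four_4.cell [[a]])"
    unfolding cells by simp
  also have "\<dots> = up_to_scale {basis_form a | a. a \<in> four_4.C}"
  proof (rule four_4.basis_forms_C)
    show "\<forall>a\<in>set four_4. [[a]] \<in> set four_4_cells" by code_simp
  qed
  finally show ?thesis .
qed

lemma four_4_empty:
  assumes "m \<ge> 1" "m \<notin> {1, 2, 6}"
  shows "(flat_stratum (sym_group 4) four_4.C m :: (_ \<Rightarrow>\<^sub>0 'k::field_char_0) set) = {}"
proof -
  have "\<forall>p\<in>set four_4_cells. length (concat p) \<in> {1, 2, 6}" by code_simp
  then have "filter (\<lambda>p. length (concat p) = m) four_4_cells = []"
    using assms(2) unfolding filter_empty_conv by blast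
  then show ?thesis using four_4.flat_stratum_cells[OF four_4_flat assms(1)] by simp
qed

section \<open>Incidences with pairings, and the representations of the strata\<close>

lemma conj_by_image:
  assumes "g \<in> carrier (sym_group n)" "a \<in> carrier (sym_group n)"
  shows "conj_by (sym_group n) g a ` g ` S = g ` a ` S"
  by (simp add: image_image conj_by_apply[OF assms])

lemma inj_image: "inj f \<Longrightarrow> inj ((`) f)"
  by (simp add: inj_def inj_image_eq_iff)

text \<open>The conjugate of \<open>a\<close> acts on the image under \<open>g\<close> as
  \<open>a\<close> acts before applying \<open>g\<close>, and an injective \<open>g\<close> stays
  injective on sets of sets.\<close>

lemma fixes_pairing_conj:
  assumes "g \<in> carrier (sym_group n)" "a \<in> carrier (sym_group n)"
  shows "((`) ((`) (conj_by (sym_group n) g a)) ((`) ((`) g) P) = (`) ((`) g) P) \<longleftrightarrow> ((`) ((`) a) P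
      = P)"
proof -
  have "inj ((`) ((`) g))"
    using assms(1) by (intro inj_image) (simp add: sym_group_carrier permutes_inj)
  moreover have "(`) ((`) (conj_by (sym_group n) g a)) ((`) ((`) g) P)
      = (`) ((`) g) ((`) ((`) a) P)"
    by (simp only: image_image conj_by_apply[OF assms])
  ultimately show ?thesis by (simp only: inj_eq)
qed

text \<open>Double transpositions fix all pairings, but move the blocks of exactly two of them.\<close>

lemma moves_block_conj:
  assumes "g \<in> carrier (sym_group n)" "a \<in> carrier (sym_group n)"
  shows "(\<exists>S\<in>(`) ((`) g) P. conj_by (sym_group n) g a ` S \<noteq> S) \<longleftrightarrow> (\<exists>S\<in>P. a ` S \<noteq> S)"
proof -
  have "inj ((`) g)"
    using assms(1) by (intro inj_image) (simp add: sym_group_carrier permutes_inj)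
  then show ?thesis by (simp add: conj_by_image[OF assms] inj_eq del: image_eqI)
qed

text \<open>Each transposition of three points fixes exactly one of them, hence
  \<open>k = 1\<close>.\<close>

lemma transp_3_rep_1:
  "rep_iso (sym_group 3) (stratum_rep (sym_group 3) transp_3.C 1 :: (nat \<Rightarrow> nat, 'k::field_char_0,
      _) rep) (fund_rep 3) \<and>
    irreducible_rep (sym_group 3) (stratum_rep (sym_group 3) transp_3.C 1 :: (nat \<Rightarrow> nat, 'k,
        _) rep) \<and>
    has_dim (stratum_rep (sym_group 3) transp_3.C 1 :: (nat \<Rightarrow> nat, 'k, _) rep) 2"
proof (rule transp_3.stratum_fund[OF transp_3_flat, where k = 1])
  show "(\<lambda>i. set (filter (\<lambda>a. list_perm a i = i) transp_3)) ` {1..3} =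
      (\<lambda>p. set (concat p)) ` set (filter (\<lambda>p. length (concat p) = 1) transp_3_cells)" by code_simp
  show count: "\<forall>a\<in>set transp_3. card {i \<in> {1..3}. list_perm a i = i} = 1" by code_simp
  fix c :: "nat \<Rightarrow> 'k"
  assume c: "\<forall>a\<in>set transp_3. (\<Sum>i=1..3. if list_perm a i = i then c i else 0) = 0"
  have "{1..3::nat} = {1, 2, 3}" by auto
  then have "\<forall>i\<in>{1..3}. \<exists>a\<in>set transp_3. list_perm a i = i"
      by (simp add: transp_3_def list_perm_def)
  from indep_of_card_1[OF _ count this c] show "\<forall>i\<in>{1..3}. c i = 0" by simp
qed simp_all

text \<open>Transpositions invert 3-cycles, so they exchange (123), the single element of
  \<open>K\<close>, with (132).\<close>

lemma rot_3_rep_1: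
  "rep_iso (sym_group 3) (stratum_rep (sym_group 3) rot_3.C 1 :: (nat \<Rightarrow> nat, 'k::field_char_0,
      _) rep) sign_rep \<and>
    irreducible_rep (sym_group 3) (stratum_rep (sym_group 3) rot_3.C 1 :: (nat \<Rightarrow> nat, 'k, _) rep) \<and>
    has_dim (stratum_rep (sym_group 3) rot_3.C 1 :: (nat \<Rightarrow> nat, 'k, _) rep) 1"
proof (rule rot_3.stratum_sign[OF rot_3_flat, where K = "[[2, 3, 1]]"])
  show "{set (filter (\<lambda>a. a \<in> set [[2, 3, 1]]) rot_3), set (filter (\<lambda>a. a \<notin> set [[2, 3,
      1]]) rot_3)} =
      (\<lambda>p. set (concat p)) ` set (filter (\<lambda>p. length (concat p) = 1) rot_3_cells)" by code_simp
  show "\<forall>i\<in>{1..3}. \<forall>j\<in>{1..3}. i = j \<or> (\<forall>a\<in>set rot_3.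
      conj_list (map (Transposition.transpose i j) [1..<Suc 3]) a \<in> set [[2, 3, 1]] \<longleftrightarrow>
      a \<notin> set [[2, 3, 1]])" by code_simp
  show "\<exists>a\<in>set rot_3. a \<in> set [[2, 3, 1]]" "\<exists>a\<in>set rot_3. a \<notin> set [[2, 3, 1]]"
    "set [[2, 3, 1]] \<subseteq> set rot_3" by code_simp+
qed simp_all

text \<open>Each transposition fixes two points, hence \<open>k = 2\<close>. The equations are
  \<open>c i + c j = 0\<close> for all pairs; going around three points gives
  \<open>c i = - c i\<close>, so \<open>c i = 0\<close> in characteristic 0.\<close>

lemma transp_4_rep_3:
  "rep_iso (sym_group 4) (stratum_rep (sym_group 4) transp_4.C 3 :: (nat \<Rightarrow> nat, 'k::field_char_0,
      _) rep) (fund_rep 4) \<and>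
    irreducible_rep (sym_group 4) (stratum_rep (sym_group 4) transp_4.C 3 :: (nat \<Rightarrow> nat, 'k,
        _) rep) \<and>
    has_dim (stratum_rep (sym_group 4) transp_4.C 3 :: (nat \<Rightarrow> nat, 'k, _) rep) 3"
proof (rule transp_4.stratum_fund[OF transp_4_flat, where k = 2])
  show "(\<lambda>i. set (filter (\<lambda>a. list_perm a i = i) transp_4)) ` {1..4} =
      (\<lambda>p. set (concat p)) ` set (filter (\<lambda>p. length (concat p) = 3) transp_4_cells)" by code_simp
  show count: "\<forall>a\<in>set transp_4. card {i \<in> {1..4}. list_perm a i = i} = 2" by code_simp
  fix c :: "nat \<Rightarrow> 'k"
  assume c: "\<forall>a\<in>set transp_4. (\<Sum>i=1..4. if list_perm a i = i then c i else 0) = 0"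
  have "{1..4::nat} = {1, 2, 3, 4}" by auto
  with c show "\<forall>i\<in>{1..4}. c i = 0" by (auto simp: transp_4_def list_perm_def add_eq_0_iff)
qed simp_all

text \<open>A transposition preserves the one pairing that has its two moved points as a block and
  exchanges the other two, hence \<open>k = 1\<close>; the support at a pairing is a commuting
  pair.\<close>

lemma transp_4_rep_2:
  "rep_iso (sym_group 4) (stratum_rep (sym_group 4) transp_4.C 2 :: (nat \<Rightarrow> nat, 'k::field_char_0,
      _) rep) two_rep \<and>
    irreducible_rep (sym_group 4) (stratum_rep (sym_group 4) transp_4.C 2 :: (nat \<Rightarrow> nat, 'k,
        _) rep) \<and>
    has_dim (stratum_rep (sym_group 4) transp_4.C 2 :: (nat \<Rightarrow> nat, 'k, _) rep) 2"
proof (rule transp_4.stratum_two[OF transp_4_flat, where k = 1 and R = "\<lambda>a P. (`) ((`) a) P = P"])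
  show "((`) ((`) (conj_by (sym_group 4) g a)) ((`) ((`) g) P) = ((`) ((`) g) P)) \<longleftrightarrow> ((`) ((`) a) P
      = P)"
    if "g \<in> carrier (sym_group 4)" "a \<in> transp_4.C" for g a P
    by (rule fixes_pairing_conj[OF that(1) subsetD[OF transp_4.C_carrier that(2)]])
  show "(\<lambda>P. set (filter (\<lambda>a. (`) ((`) (list_perm a)) P = P) transp_4)) ` pairings =
      (\<lambda>p. set (concat p)) ` set (filter (\<lambda>p. length (concat p) = 2) transp_4_cells)" by code_simp
  show count: "\<forall>a\<in>set transp_4. card {P \<in> pairings. (`) ((`) (list_perm a)) P = P} = 1" by code_simp
  fix c :: "nat set set \<Rightarrow> 'k"
  assume c: "\<forall>a\<in>set transp_4. (\<Sum>P\<in>pairings. if (`) ((`) (list_perm a)) P = P then c P else 0) = 0"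
  have "\<forall>P\<in>pairings. \<exists>a\<in>set transp_4. (`) ((`) (list_perm a)) P = P" by code_simp
  from indep_of_card_1[OF _ count this c] show "\<forall>P\<in>pairings. c P = 0" by simp
qed simp_all

text \<open>The support at a pairing omits the double transposition whose 2-cycles are its blocks
  and contains the other two, hence \<open>k = 2\<close>. As there are three pairings, the equations
  \<open>c P + c P' = 0\<close> over all pairs again force \<open>c = 0\<close>.\<close>

lemma double_4_rep_2:
  "rep_iso (sym_group 4) (stratum_rep (sym_group 4) double_4.C 2 :: (nat \<Rightarrow> nat, 'k::field_char_0,
      _) rep) two_rep \<and>
    irreducible_rep (sym_group 4) (stratum_rep (sym_group 4) double_4.C 2 :: (nat \<Rightarrow> nat, 'k,
        _) rep) \<and>
    has_dim (stratum_rep (sym_group 4) double_4.C 2 :: (nat \<Rightarrow> nat, 'k, _) rep) 2"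
proof (rule double_4.stratum_two[OF double_4_flat, where k = 2 and R = "\<lambda>a P. \<exists>S\<in>P. a ` S \<noteq> S"])
  show "(\<exists>S\<in>((`) ((`) g) P). (conj_by (sym_group 4) g a) ` S \<noteq> S) \<longleftrightarrow> (\<exists>S\<in>P. a ` S \<noteq> S)"
    if "g \<in> carrier (sym_group 4)" "a \<in> double_4.C" for g a P
    by (rule moves_block_conj[OF that(1) subsetD[OF double_4.C_carrier that(2)]])
  show "(\<lambda>P. set (filter (\<lambda>a. \<exists>S\<in>P. (list_perm a) ` S \<noteq> S) double_4)) ` pairings =
      (\<lambda>p. set (concat p)) ` set (filter (\<lambda>p. length (concat p) = 2) double_4_cells)" by code_simp
  show count: "\<forall>a\<in>set double_4. card {P \<in> pairings. \<exists>S\<in>P. (list_perm a) ` S \<noteq> S} = 2" by code_simp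
  fix c :: "nat set set \<Rightarrow> 'k"
  assume c: "\<forall>a\<in>set double_4. (\<Sum>P\<in>pairings. if \<exists>S\<in>P. (list_perm a) ` S \<noteq> S then c P else 0) = 0"
  then show "\<forall>P\<in>pairings. c P = 0"
    by (simp add: double_4_def list_perm_def doubleton_eq_iff add_eq_0_iff) (auto simp:
        add_eq_0_iff)
qed simp_all

text \<open>\<open>K\<close> is the \<open>A4\<close>-class of (123). Odd permutations exchange the
  two \<open>A4\<close>-classes into which the 3-cycles split.\<close>

lemma three_4_rep_4:
  "rep_iso (sym_group 4) (stratum_rep (sym_group 4) three_4.C 4 :: (nat \<Rightarrow> nat, 'k::field_char_0,
      _) rep) sign_rep \<and>
    irreducible_rep (sym_group 4) (stratum_rep (sym_group 4) three_4.C 4 :: (nat \<Rightarrow> nat, 'k,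
        _) rep) \<and>
    has_dim (stratum_rep (sym_group 4) three_4.C 4 :: (nat \<Rightarrow> nat, 'k, _) rep) 1"
proof (rule three_4.stratum_sign[OF three_4_flat, where K = "[[2, 3, 1, 4], [4, 1, 3, 2],
    [3, 2, 4, 1], [1, 4, 2, 3]]"])
  show "{set (filter (\<lambda>a. a \<in> set [[2, 3, 1, 4], [4, 1, 3, 2], [3, 2, 4, 1],
      [1, 4, 2, 3]]) three_4), set (filter (\<lambda>a. a \<notin> set [[2, 3, 1, 4], [4, 1, 3, 2], [3, 2, 4, 1],
      [1, 4, 2, 3]]) three_4)} =
      (\<lambda>p. set (concat p)) ` set (filter (\<lambda>p. length (concat p) = 4) three_4_cells)" by code_simp
  show "\<forall>i\<in>{1..4}. \<forall>j\<in>{1..4}. i = j \<or> (\<forall>a\<in>set three_4.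
      conj_list (map (Transposition.transpose i j) [1..<Suc 4]) a \<in> set [[2, 3, 1, 4],
          [4, 1, 3, 2], [3, 2, 4, 1], [1, 4, 2, 3]] \<longleftrightarrow>
      a \<notin> set [[2, 3, 1, 4], [4, 1, 3, 2], [3, 2, 4, 1], [1, 4, 2, 3]])" by code_simp
  show "\<exists>a\<in>set three_4. a \<in> set [[2, 3, 1, 4], [4, 1, 3, 2], [3, 2, 4, 1],
      [1, 4, 2, 3]]" "\<exists>a\<in>set three_4. a \<notin> set [[2, 3, 1, 4], [4, 1, 3, 2], [3, 2, 4, 1],
      [1, 4, 2, 3]]"
    "set [[2, 3, 1, 4], [4, 1, 3, 2], [3, 2, 4, 1], [1, 4, 2, 3]] \<subseteq> set three_4" by code_simp+
qed simp_all

text \<open>A 3-cycle fixes exactly one point and shares it with its inverse, so the support at a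
  point is a pair of inverse 3-cycles.\<close>

lemma three_4_rep_2:
  "rep_iso (sym_group 4) (stratum_rep (sym_group 4) three_4.C 2 :: (nat \<Rightarrow> nat, 'k::field_char_0,
      _) rep) (fund_rep 4) \<and>
    irreducible_rep (sym_group 4) (stratum_rep (sym_group 4) three_4.C 2 :: (nat \<Rightarrow> nat, 'k,
        _) rep) \<and>
    has_dim (stratum_rep (sym_group 4) three_4.C 2 :: (nat \<Rightarrow> nat, 'k, _) rep) 3"
proof (rule three_4.stratum_fund[OF three_4_flat, where k = 1])
  show "(\<lambda>i. set (filter (\<lambda>a. list_perm a i = i) three_4)) ` {1..4} =
      (\<lambda>p. set (concat p)) ` set (filter (\<lambda>p. length (concat p) = 2) three_4_cells)" by code_simp
  show count: "\<forall>a\<in>set three_4. card {i \<in> {1..4}. list_perm a i = i} = 1" by code_simp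
  fix c :: "nat \<Rightarrow> 'k"
  assume c: "\<forall>a\<in>set three_4. (\<Sum>i=1..4. if list_perm a i = i then c i else 0) = 0"
  have "{1..4::nat} = {1, 2, 3, 4}" by auto
  then have "\<forall>i\<in>{1..4}. \<exists>a\<in>set three_4. list_perm a i = i" by (simp add: three_4_def list_perm_def)
  from indep_of_card_1[OF _ count this c] show "\<forall>i\<in>{1..4}. c i = 0" by simp
qed simp_all

text \<open>A 4-cycle preserves exactly one pairing, the one joining opposite points of the cycle,
  and shares it with its inverse.\<close>

lemma four_4_rep_2:
  "rep_iso (sym_group 4) (stratum_rep (sym_group 4) four_4.C 2 :: (nat \<Rightarrow> nat, 'k::field_char_0,
      _) rep) two_rep \<and>
    irreducible_rep (sym_group 4) (stratum_rep (sym_group 4) four_4.C 2 :: (nat \<Rightarrow> nat, 'k, _) rep) \<and>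
    has_dim (stratum_rep (sym_group 4) four_4.C 2 :: (nat \<Rightarrow> nat, 'k, _) rep) 2"
proof (rule four_4.stratum_two[OF four_4_flat, where k = 1 and R = "\<lambda>a P. (`) ((`) a) P = P"])
  show "((`) ((`) (conj_by (sym_group 4) g a)) ((`) ((`) g) P) = ((`) ((`) g) P)) \<longleftrightarrow> ((`) ((`) a) P
      = P)"
    if "g \<in> carrier (sym_group 4)" "a \<in> four_4.C" for g a P
    by (rule fixes_pairing_conj[OF that(1) subsetD[OF four_4.C_carrier that(2)]])
  show "(\<lambda>P. set (filter (\<lambda>a. (`) ((`) (list_perm a)) P = P) four_4)) ` pairings =
      (\<lambda>p. set (concat p)) ` set (filter (\<lambda>p. length (concat p) = 2) four_4_cells)" by code_simp
  show count: "\<forall>a\<in>set four_4. card {P \<in> pairings. (`) ((`) (list_perm a)) P = P} = 1" by code_simp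
  fix c :: "nat set set \<Rightarrow> 'k"
  assume c: "\<forall>a\<in>set four_4. (\<Sum>P\<in>pairings. if (`) ((`) (list_perm a)) P = P then c P else 0) = 0"
  have "\<forall>P\<in>pairings. \<exists>a\<in>set four_4. (`) ((`) (list_perm a)) P = P" by code_simp
  from indep_of_card_1[OF _ count this c] show "\<forall>P\<in>pairings. c P = 0" by simp
qed simp_all

section \<open>All nontrivial conjugacy classes, and the conclusion\<close>

lemma nontrivial_conj_classes_sym_group_3:
  "nontrivial_conj_classes (sym_group 3) = {transp_3.C, rot_3.C}"
proof -
  \<comment> \<open>The enumeration is evaluated on one-line notations; \<open>[1, 2, 3]\<close> is
    the identity, whose class is split off to be removed at the end.\<close>
  have classes: "(\<lambda>b. (\<lambda>g. conj_list g b) ` permutations_of_set {1..3}) ` permutations_of_set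
      {1..3} =
      insert {[1, 2, 3]} {set transp_3, set rot_3}" by code_simp
  have "(\<lambda>b. list_perm ` (\<lambda>g. conj_list g b) ` permutations_of_set {1..3}) ` permutations_of_set
      {1..3} =
      (`) list_perm ` insert {[1, 2, 3]} {set transp_3, set rot_3}"
    unfolding classes[symmetric] by (rule image_image[symmetric])
  also have "\<dots> = insert {id} {transp_3.C, rot_3.C}"
  proof -
    have "[1..<Suc 3] = [1, 2, 3]" by code_simp
    then have "list_perm [1, 2, 3] = id" using list_perm_upt[of 3] by simp
    then show ?thesis by (simp only: image_insert image_empty transp_3.C_def rot_3.C_def)
  qed
  finally have eq: "(\<lambda>b. list_perm ` (\<lambda>g. conj_list g b) ` permutations_of_set {1..3}) `
      permutations_of_set {1..3} =
      insert {id} {transp_3.C, rot_3.C}" .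
  have "[1..<Suc 3] \<notin> set transp_3" "[1..<Suc 3] \<notin> set rot_3" by code_simp+
  then have "{id} \<notin> {transp_3.C, rot_3.C}"
    using transp_3.id_neq_C rot_3.id_neq_C by simp
  then show ?thesis
    unfolding nontrivial_conj_classes_sym_group eq by simp
qed

lemma nontrivial_conj_classes_sym_group_4:
  "nontrivial_conj_classes (sym_group 4) = {transp_4.C, double_4.C, three_4.C, four_4.C}"
proof -
  have classes: "(\<lambda>b. (\<lambda>g. conj_list g b) ` permutations_of_set {1..4}) ` permutations_of_set
      {1..4} =
      insert {[1, 2, 3, 4]} {set transp_4, set double_4, set three_4, set four_4}" by code_simp
  have "(\<lambda>b. list_perm ` (\<lambda>g. conj_list g b) ` permutations_of_set {1..4}) ` permutations_of_set
      {1..4} =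
      (`) list_perm ` insert {[1, 2, 3, 4]} {set transp_4, set double_4, set three_4, set four_4}"
    unfolding classes[symmetric] by (rule image_image[symmetric])
  also have "\<dots> = insert {id} {transp_4.C, double_4.C, three_4.C, four_4.C}"
  proof -
    have "[1..<Suc 4] = [1, 2, 3, 4]" by code_simp
    then have "list_perm [1, 2, 3, 4] = id" using list_perm_upt[of 4] by simp
    then show ?thesis by (simp only: image_insert image_empty transp_4.C_def double_4.C_def
        three_4.C_def four_4.C_def)
  qed
  finally have eq: "(\<lambda>b. list_perm ` (\<lambda>g. conj_list g b) ` permutations_of_set {1..4}) `
      permutations_of_set {1..4} =
      insert {id} {transp_4.C, double_4.C, three_4.C, four_4.C}" .
  have "[1..<Suc 4] \<notin> set transp_4" "[1..<Suc 4] \<notin> set double_4" "[1..<Suc 4] \<notin> set three_4"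
      "[1..<Suc 4] \<notin> set four_4" by code_simp+
  then have "{id} \<notin> {transp_4.C, double_4.C, three_4.C, four_4.C}"
    using transp_4.id_neq_C double_4.id_neq_C three_4.id_neq_C four_4.id_neq_C by simp
  then show ?thesis
    unfolding nontrivial_conj_classes_sym_group eq by simp
qed

theorem proposition4p3:
  shows
  "nontrivial_conj_classes (sym_group 3) =
     {conj_class (sym_group 3) (cycle_of_list [1,2]),
      conj_class (sym_group 3) (cycle_of_list [1,2,3])} \<and>
   nontrivial_conj_classes (sym_group 4) =
     {conj_class (sym_group 4) (cycle_of_list [1,2]),
      conj_class (sym_group 4) (cycle_of_list [1,2] \<circ> cycle_of_list [3,4]),
      conj_class (sym_group 4) (cycle_of_list [1,2,3]),
      conj_class (sym_group 4) (cycle_of_list [1,2,3,4])} \<and>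
   (let G = sym_group 3;
        C = conj_class G (cycle_of_list [1,2]);
        F = (flat_stratum G C :: nat \<Rightarrow> ((nat \<Rightarrow> nat) list \<Rightarrow>\<^sub>0 'k::field_char_0) set);
        V = (stratum_rep G C :: nat \<Rightarrow>
              (nat \<Rightarrow> nat, 'k, ((nat \<Rightarrow> nat) list \<Rightarrow>\<^sub>0 'k) set) rep)
    in F 3 = up_to_scale {theta C} \<and>
       F 1 = up_to_scale {\<ee> [2,3], \<ee> [1,3], \<ee> [1,2]} \<and>
       (\<forall>n\<ge>1. n \<notin> {1, 3} \<longrightarrow> F n = {}) \<and>
       rep_iso G (V 1) (fund_rep 3) \<and> irreducible_rep G (V 1) \<and> has_dim (V 1) 2) \<and>
   (let G = sym_group 3;
        C = conj_class G (cycle_of_list [1,2,3]);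
        F = (flat_stratum G C :: nat \<Rightarrow> ((nat \<Rightarrow> nat) list \<Rightarrow>\<^sub>0 'k) set);
        V = (stratum_rep G C :: nat \<Rightarrow>
              (nat \<Rightarrow> nat, 'k, ((nat \<Rightarrow> nat) list \<Rightarrow>\<^sub>0 'k) set) rep)
    in F 2 = up_to_scale
         {\<kappa> *\<^sub>k \<ee> [1,2,3] + \<mu> *\<^sub>k \<ee> [1,3,2] | \<kappa> \<mu>. \<kappa> \<noteq> 0 \<and> \<mu> \<noteq> 0} \<and>
       F 1 = up_to_scale {\<ee> [1,2,3], \<ee> [1,3,2]} \<and>
       (\<forall>n\<ge>1. n \<notin> {1, 2} \<longrightarrow> F n = {}) \<and>
       rep_iso G (V 1) sign_rep \<and> irreducible_rep G (V 1) \<and> has_dim (V 1) 1) \<and>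
   (let G = sym_group 4;
        C = conj_class G (cycle_of_list [1,2]);
        F = (flat_stratum G C :: nat \<Rightarrow> ((nat \<Rightarrow> nat) list \<Rightarrow>\<^sub>0 'k) set);
        V = (stratum_rep G C :: nat \<Rightarrow>
              (nat \<Rightarrow> nat, 'k, ((nat \<Rightarrow> nat) list \<Rightarrow>\<^sub>0 'k) set) rep)
    in F 6 = up_to_scale {theta C} \<and>
       F 3 = up_to_scale {theta C - theta_at i | i. i \<in> {1..4}} \<and>
       F 2 = up_to_scale
         ({\<kappa> *\<^sub>k \<ee> [1,4] + \<mu> *\<^sub>k \<ee> [2,3] | \<kappa> \<mu>. \<kappa> \<noteq> 0 \<and> \<mu> \<noteq> 0} \<union>
          {\<kappa> *\<^sub>k \<ee> [1,3] + \<mu> *\<^sub>k \<ee> [2,4] | \<kappa> \<mu>. \<kappa> \<noteq> 0 \<and> \<mu> \<noteq> 0} \<union>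
          {\<kappa> *\<^sub>k \<ee> [1,2] + \<mu> *\<^sub>k \<ee> [3,4] | \<kappa> \<mu>. \<kappa> \<noteq> 0 \<and> \<mu> \<noteq> 0}) \<and>
       F 1 = up_to_scale {basis_form a | a. a \<in> C} \<and>
       (\<forall>n\<ge>1. n \<notin> {1, 2, 3, 6} \<longrightarrow> F n = {}) \<and>
       rep_iso G (V 3) (fund_rep 4) \<and> irreducible_rep G (V 3) \<and> has_dim (V 3) 3 \<and>
       rep_iso G (V 2) two_rep \<and> irreducible_rep G (V 2) \<and> has_dim (V 2) 2) \<and>
   (let G = sym_group 4;
        C = conj_class G (cycle_of_list [1,2] \<circ> cycle_of_list [3,4]);
        F = (flat_stratum G C :: nat \<Rightarrow> ((nat \<Rightarrow> nat) list \<Rightarrow>\<^sub>0 'k) set);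
        V = (stratum_rep G C :: nat \<Rightarrow>
              (nat \<Rightarrow> nat, 'k, ((nat \<Rightarrow> nat) list \<Rightarrow>\<^sub>0 'k) set) rep)
    in F 3 = up_to_scale
         {\<kappa> *\<^sub>k \<ee>\<ee> [1,2] [3,4] + \<mu> *\<^sub>k \<ee>\<ee> [1,3] [2,4] + \<nu> *\<^sub>k \<ee>\<ee> [1,4] [2,3]
            | \<kappa> \<mu> \<nu>. \<kappa> \<noteq> 0 \<and> \<mu> \<noteq> 0 \<and> \<nu> \<noteq> 0} \<and>
       F 2 = up_to_scale
         ({\<kappa> *\<^sub>k \<ee>\<ee> [1,2] [3,4] + \<mu> *\<^sub>k \<ee>\<ee> [1,3] [2,4] | \<kappa> \<mu>. \<kappa> \<noteq> 0 \<and> \<mu> \<noteq> 0} \<union>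
          {\<kappa> *\<^sub>k \<ee>\<ee> [1,3] [2,4] + \<mu> *\<^sub>k \<ee>\<ee> [1,4] [2,3] | \<kappa> \<mu>. \<kappa> \<noteq> 0 \<and> \<mu> \<noteq> 0} \<union>
          {\<kappa> *\<^sub>k \<ee>\<ee> [1,2] [3,4] + \<mu> *\<^sub>k \<ee>\<ee> [1,4] [2,3] | \<kappa> \<mu>. \<kappa> \<noteq> 0 \<and> \<mu> \<noteq> 0}) \<and>
       F 1 = up_to_scale {basis_form a | a. a \<in> C} \<and>
       (\<forall>n\<ge>1. n \<notin> {1, 2, 3} \<longrightarrow> F n = {}) \<and>
       rep_iso G (V 2) two_rep \<and> irreducible_rep G (V 2) \<and> has_dim (V 2) 2) \<and>
   (let G = sym_group 4;
        C = conj_class G (cycle_of_list [1,2,3]);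
        F = (flat_stratum G C :: nat \<Rightarrow> ((nat \<Rightarrow> nat) list \<Rightarrow>\<^sub>0 'k) set);
        V = (stratum_rep G C :: nat \<Rightarrow>
              (nat \<Rightarrow> nat, 'k, ((nat \<Rightarrow> nat) list \<Rightarrow>\<^sub>0 'k) set) rep)
    in F 8 = up_to_scale
         {\<kappa> *\<^sub>k (\<ee> [1,2,3] + \<ee> [1,4,2] + \<ee> [1,3,4] + \<ee> [2,4,3]) +
          \<mu> *\<^sub>k (\<ee> [1,3,2] + \<ee> [1,2,4] + \<ee> [1,4,3] + \<ee> [2,3,4])
            | \<kappa> \<mu>. \<kappa> \<noteq> 0 \<and> \<mu> \<noteq> 0} \<and>
       F 4 = up_to_scale
         {\<ee> [1,2,3] + \<ee> [1,4,2] + \<ee> [1,3,4] + \<ee> [2,4,3],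
          \<ee> [1,3,2] + \<ee> [1,2,4] + \<ee> [1,4,3] + \<ee> [2,3,4]} \<and>
       F 2 = up_to_scale
         ({\<kappa> *\<^sub>k \<ee> [1,2,3] + \<mu> *\<^sub>k \<ee> [1,3,2] | \<kappa> \<mu>. \<kappa> \<noteq> 0 \<and> \<mu> \<noteq> 0} \<union>
          {\<kappa> *\<^sub>k \<ee> [1,4,2] + \<mu> *\<^sub>k \<ee> [1,2,4] | \<kappa> \<mu>. \<kappa> \<noteq> 0 \<and> \<mu> \<noteq> 0} \<union>
          {\<kappa> *\<^sub>k \<ee> [1,3,4] + \<mu> *\<^sub>k \<ee> [1,4,3] | \<kappa> \<mu>. \<kappa> \<noteq> 0 \<and> \<mu> \<noteq> 0} \<union>
          {\<kappa> *\<^sub>k \<ee> [2,4,3] + \<mu> *\<^sub>k \<ee> [2,3,4] | \<kappa> \<mu>. \<kappa> \<noteq> 0 \<and> \<mu> \<noteq> 0}) \<and>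
       F 1 = up_to_scale {basis_form a | a. a \<in> C} \<and>
       (\<forall>n\<ge>1. n \<notin> {1, 2, 4, 8} \<longrightarrow> F n = {}) \<and>
       rep_iso G (V 4) sign_rep \<and> irreducible_rep G (V 4) \<and> has_dim (V 4) 1 \<and>
       rep_iso G (V 2) (fund_rep 4) \<and> irreducible_rep G (V 2) \<and> has_dim (V 2) 3) \<and>
   (let G = sym_group 4;
        C = conj_class G (cycle_of_list [1,2,3,4]);
        F = (flat_stratum G C :: nat \<Rightarrow> ((nat \<Rightarrow> nat) list \<Rightarrow>\<^sub>0 'k) set);
        V = (stratum_rep G C :: nat \<Rightarrow>
              (nat \<Rightarrow> nat, 'k, ((nat \<Rightarrow> nat) list \<Rightarrow>\<^sub>0 'k) set) rep)
    in F 6 = up_to_scale {theta C} \<and>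
       F 2 = up_to_scale
         ({\<kappa> *\<^sub>k \<ee> [1,2,3,4] + \<mu> *\<^sub>k \<ee> [1,4,3,2] | \<kappa> \<mu>. \<kappa> \<noteq> 0 \<and> \<mu> \<noteq> 0} \<union>
          {\<kappa> *\<^sub>k \<ee> [1,2,4,3] + \<mu> *\<^sub>k \<ee> [1,3,4,2] | \<kappa> \<mu>. \<kappa> \<noteq> 0 \<and> \<mu> \<noteq> 0} \<union>
          {\<kappa> *\<^sub>k \<ee> [1,3,2,4] + \<mu> *\<^sub>k \<ee> [1,4,2,3] | \<kappa> \<mu>. \<kappa> \<noteq> 0 \<and> \<mu> \<noteq> 0}) \<and>
       F 1 = up_to_scale {basis_form a | a. a \<in> C} \<and>
       (\<forall>n\<ge>1. n \<notin> {1, 2, 6} \<longrightarrow> F n = {}) \<and>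
       rep_iso G (V 2) two_rep \<and> irreducible_rep G (V 2) \<and> has_dim (V 2) 2)"
  unfolding Let_def
  \<comment> \<open>Once every class is replaced by its copy built from lists, each conjunct is an
    instance of a lemma above.\<close>
  unfolding conj_class_transp_3 conj_class_rot_3 conj_class_transp_4 conj_class_double_4
      conj_class_three_4 conj_class_four_4
  by (intro conjI allI impI nontrivial_conj_classes_sym_group_3 nontrivial_conj_classes_sym_group_4
    transp_3_3 transp_3_1 transp_3_empty
    rot_3_2 rot_3_1 rot_3_empty
    transp_4_6 transp_4_3 transp_4_2 transp_4_1 transp_4_empty
    double_4_3 double_4_2 double_4_1 double_4_empty
    three_4_8 three_4_4 three_4_2 three_4_1 three_4_empty
    four_4_6 four_4_2 four_4_1 four_4_empty
    transp_3_rep_1[THEN conjunct1]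
    transp_3_rep_1[THEN conjunct2, THEN conjunct1]
    transp_3_rep_1[THEN conjunct2, THEN conjunct2]
    rot_3_rep_1[THEN conjunct1]
    rot_3_rep_1[THEN conjunct2, THEN conjunct1]
    rot_3_rep_1[THEN conjunct2, THEN conjunct2]
    transp_4_rep_3[THEN conjunct1]
    transp_4_rep_3[THEN conjunct2, THEN conjunct1]
    transp_4_rep_3[THEN conjunct2, THEN conjunct2]
    transp_4_rep_2[THEN conjunct1]
    transp_4_rep_2[THEN conjunct2, THEN conjunct1]
    transp_4_rep_2[THEN conjunct2, THEN conjunct2]
    double_4_rep_2[THEN conjunct1]
    double_4_rep_2[THEN conjunct2, THEN conjunct1]
    double_4_rep_2[THEN conjunct2, THEN conjunct2]
    three_4_rep_4[THEN conjunct1]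
    three_4_rep_4[THEN conjunct2, THEN conjunct1]
    three_4_rep_4[THEN conjunct2, THEN conjunct2]
    three_4_rep_2[THEN conjunct1]
    three_4_rep_2[THEN conjunct2, THEN conjunct1]
    three_4_rep_2[THEN conjunct2, THEN conjunct2]
    four_4_rep_2[THEN conjunct1]
    four_4_rep_2[THEN conjunct2, THEN conjunct1]
    four_4_rep_2[THEN conjunct2, THEN conjunct2])

end
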